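(* One has $$L^{1,\infty}(\Omega;L^{1}(S)) \subseteq R(\mathrm{Id}+A).$$ Consequently, the following assertions hold. (i) $R(\mathrm{Id}+A)$ is a dense subset of $L^{1}(\Omega;L^{1}(S))$. (ii) $\mathcal{A}$ is m-accretive.
   Context: Setting. $n\in\mathbb{N}$, $n\ge 2$; $p\in(1,\infty)\setminus\{2\}$; $S\subseteq\mathbb{R}^{n}$ is a nonempty open, bounded, connected set of class $C^{1}$; $\lambda$ is Lebesgue measure; $0<g_{1}\le g_{2}<\infty$ are constants. $(\Omega,\mathcal{F},\mathbb{P})$ is a complete probability space. For a Banach space $X$, $L^{1}(\Omega;X)$ is the space of $\mathcal{F}$-$\mathfrak{B}(X)$-measurable $f:\Omega\to X$ with $\int_{\Omega}\|f\|_{X}\,d\mathbb{P}<\infty$ (with its usual norm). $L^{1}_{g_{1},g_{2}}(S):=\{\gamma\in L^{1}(S): g_{1}\le\gamma\le g_{2}\text{ a.e. on }S\}$, and $g\in L^{1}(\Omega;L^{1}(S))$ is fixed with $\mathbb{P}(g\in L^{1}_{g_{1},g_{2}}(S))=1$. Convention: $|x|^{p-2}x:=0$ if $x=0$. Operators. $A$ is the operator on $L^{1}(\Omega;L^{1}(S))$ with $(f,\hat f)\in A$ if and only if $f,\hat f\in L^{1}(\Omega;L^{1}(S))$, $\mathbb{P}(f\in W^{1,p}(S)\cap L^{\infty}(S))=1$, and with probability one $\int_{S}g|\nabla f|^{p-2}\nabla f\cdot\nabla\varphi\,d\lambda=\int_{S}\hat f\varphi\,d\lambda$ for all $\varphi\in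 W^{1,p}(S)\cap L^{\infty}(S)$. $\mathcal{A}$ is the closure of $A$ (as a subset of $L^{1}(\Omega;L^{1}(S))^{2}$). $L^{1,\infty}(\Omega;L^{1}(S)):=\{f\in L^{1}(\Omega;L^{1}(S)):\mathbb{P}(f\in L^{\infty}(S))=1\}$. For an operator $B:D(B)\to 2^{X}$ on a Banach space $X$, $R(\mathrm{Id}+B)$ is the set of all $f+\hat f$ with $(f,\hat f)\in B$. $B$ is accretive if $\|f-h\|_{X}\le\|f-h+\alpha(\hat f-\hat h)\|_{X}$ for all $(f,\hat f),(h,\hat h)\in B$ and $\alpha>0$; $B$ is m-accretive if it is accretive and $R(\mathrm{Id}+B)=X$. *)

theory Defs
  imports "HOL-Probability.Probability"
begin

section \<open>Lebesgue-integrable functions modulo equality almost everywhere\<close>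

text \<open>The normed space of Lebesgue-integrable real functions on the whole Euclidean space.  For a
  measurable set \<open>S\<close>, the space of integrable functions on \<open>S\<close> is its closed subspace of elements
  that vanish almost everywhere outside \<open>S\<close> (extension by zero is an isometric isomorphism); a
  HOL type cannot depend on the set \<open>S\<close> itself.\<close>

quotient_type (overloaded) 'a lebesgue_L1 = "'a::euclidean_space \<Rightarrow> real" / partial:
  "\<lambda>f g. integrable lebesgue f \<and> integrable lebesgue g \<and> (AE x in lebesgue. f x = g x)"
  morphisms rep_L1 abs_L1
proof (rule part_equivpI)
  let ?R = "\<lambda>f g::'a \<Rightarrow> real.
    integrable lebesgue f \<and> integrable lebesgue g \<and> (AE x in lebesgue. f x = g x)"
  show "\<exists>f. ?R f f"
    by (rule exI[of _ "\<lambda>_. 0"]) simp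
  have "?R g f" if "?R f g" for f g
  proof -
    from that have "AE x in lebesgue. f x = g x" by blast
    then have "AE x in lebesgue. g x = f x" by eventually_elim simp
    with that show ?thesis by blast
  qed
  then show "symp ?R" by (rule sympI)
  have "?R f h" if "?R f g" "?R g h" for f g h
  proof -
    from that have "AE x in lebesgue. f x = g x" "AE x in lebesgue. g x = h x" by blast+
    then have "AE x in lebesgue. f x = h x" by eventually_elim simp
    with that show ?thesis by blast
  qed
  then show "transp ?R" by (rule transpI)
qed

instantiation lebesgue_L1 :: (euclidean_space) real_normed_vector
begin

lift_definition zero_lebesgue_L1 :: "'a lebesgue_L1" is "\<lambda>_. 0"
  by simp

lift_definition plus_lebesgue_L1 :: "'a lebesgue_L1 \<Rightarrow> 'a lebesgue_L1 \<Rightarrow> 'a lebesgue_L1"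
  is "\<lambda>f g x. f x + g x"
  by (force elim: eventually_elim2)

lift_definition minus_lebesgue_L1 :: "'a lebesgue_L1 \<Rightarrow> 'a lebesgue_L1 \<Rightarrow> 'a lebesgue_L1"
  is "\<lambda>f g x. f x - g x"
  by (force elim: eventually_elim2)

lift_definition uminus_lebesgue_L1 :: "'a lebesgue_L1 \<Rightarrow> 'a lebesgue_L1"
  is "\<lambda>f x. - f x"
  by (auto elim: eventually_mono)

lift_definition scaleR_lebesgue_L1 :: "real \<Rightarrow> 'a lebesgue_L1 \<Rightarrow> 'a lebesgue_L1"
  is "\<lambda>c f x. c * f x"
  by (auto elim: eventually_mono)

lift_definition norm_lebesgue_L1 :: "'a lebesgue_L1 \<Rightarrow> real"
  is "\<lambda>f. \<integral>x. \<bar>f x\<bar> \<partial>lebesgue"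
  by (rule integral_cong_AE) (auto elim: eventually_mono)

definition dist_lebesgue_L1 :: "'a lebesgue_L1 \<Rightarrow> 'a lebesgue_L1 \<Rightarrow> real"
  where "dist_lebesgue_L1 u v = norm (u - v)"

definition sgn_lebesgue_L1 :: "'a lebesgue_L1 \<Rightarrow> 'a lebesgue_L1"
  where "sgn_lebesgue_L1 u = inverse (norm u) *\<^sub>R u"

definition uniformity_lebesgue_L1 :: "('a lebesgue_L1 \<times> 'a lebesgue_L1) filter"
  where "uniformity_lebesgue_L1 = (INF e\<in>{0<..}. principal {(u, v). dist u v < e})"

definition open_lebesgue_L1 :: "'a lebesgue_L1 set \<Rightarrow> bool"
  where "open_lebesgue_L1 U \<longleftrightarrow> (\<forall>u\<in>U. \<forall>\<^sub>F (u', v) in uniformity. u' = u \<longrightarrow> v \<in> U)"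

instance
proof
  fix u v w :: "'a lebesgue_L1" and a b :: real and U :: "'a lebesgue_L1 set"
  show "u + v + w = u + (v + w)" by transfer (auto simp: algebra_simps)
  show "u + v = v + u" by transfer (auto simp: algebra_simps)
  show "0 + u = u" by transfer auto
  show "- u + u = 0" by transfer auto
  show "u - v = u + - v" by transfer auto
  show "a *\<^sub>R (u + v) = a *\<^sub>R u + a *\<^sub>R v" by transfer (auto simp: algebra_simps)
  show "(a + b) *\<^sub>R u = a *\<^sub>R u + b *\<^sub>R u" by transfer (auto simp: algebra_simps)
  show "a *\<^sub>R b *\<^sub>R u = (a * b) *\<^sub>R u" by transfer (auto simp: algebra_simps)
  show "1 *\<^sub>R u = u" by transfer auto
  show "dist u v = norm (u - v)" by (rule dist_lebesgue_L1_def)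
  show "sgn u = inverse (norm u) *\<^sub>R u" by (rule sgn_lebesgue_L1_def)
  show "uniformity = (INF e\<in>{0<..}. principal {(u::'a lebesgue_L1, v). dist u v < e})"
    by (rule uniformity_lebesgue_L1_def)
  show "open U \<longleftrightarrow> (\<forall>u\<in>U. \<forall>\<^sub>F (u', v) in uniformity. u' = u \<longrightarrow> v \<in> U)"
    by (rule open_lebesgue_L1_def)
  show "norm u = 0 \<longleftrightarrow> u = 0"
    by transfer (auto simp: integral_nonneg_eq_0_iff_AE)
  show "norm (u + v) \<le> norm u + norm v"
  proof transfer
    fix f g :: "'a \<Rightarrow> real"
    assume "integrable lebesgue f \<and> integrable lebesgue f \<and> (AE x in lebesgue. f x = f x)"
      and "integrable lebesgue g \<and> integrable lebesgue g \<and> (AE x in lebesgue. g x = g x)"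
    then have i: "integrable lebesgue (\<lambda>x. \<bar>f x\<bar>)" "integrable lebesgue (\<lambda>x. \<bar>g x\<bar>)"
      "integrable lebesgue (\<lambda>x. \<bar>f x + g x\<bar>)" by auto
    have "(\<integral>x. \<bar>f x + g x\<bar> \<partial>lebesgue) \<le> (\<integral>x. \<bar>f x\<bar> + \<bar>g x\<bar> \<partial>lebesgue)"
      by (rule integral_mono) (use i in auto)
    then show "(\<integral>x. \<bar>f x + g x\<bar> \<partial>lebesgue) \<le> (\<integral>x. \<bar>f x\<bar> \<partial>lebesgue) + (\<integral>x. \<bar>g x\<bar> \<partial>lebesgue)"
      using i by simp
  qed
  show "norm (a *\<^sub>R u) = \<bar>a\<bar> * norm u"
    by transfer (simp add: abs_mult)
qed

end

text \<open>An element \<open>u\<close> is a class; \<open>rep_L1 u\<close> is some representative of it, so \<open>rep_L1 u\<close> may only be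
  used in ways that do not depend on null sets.\<close>

definition L1 :: "'a::euclidean_space set \<Rightarrow> 'a lebesgue_L1 set"
  where "L1 S = {u. AE x in lebesgue. x \<notin> S \<longrightarrow> rep_L1 u x = 0}"

definition L1_between :: "real \<Rightarrow> real \<Rightarrow> 'a::euclidean_space set \<Rightarrow> 'a lebesgue_L1 set"
  where "L1_between g1 g2 S =
    {u \<in> L1 S. AE x in lebesgue_on S. g1 \<le> rep_L1 u x \<and> rep_L1 u x \<le> g2}"

section \<open>Sobolev functions\<close>

text \<open>Functions of class \<open>C\<close> to the power \<open>k\<close> on an open set \<open>U\<close>, through iterated partial
  derivatives.\<close>

primrec Ck_on :: "nat \<Rightarrow> ('a::euclidean_space \<Rightarrow> real) \<Rightarrow> 'a set \<Rightarrow> bool"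
  where
    "Ck_on 0 f U \<longleftrightarrow> continuous_on U f"
  | "Ck_on (Suc k) f U \<longleftrightarrow> (\<forall>x\<in>U. f differentiable (at x)) \<and>
       (\<forall>b\<in>Basis. Ck_on k (\<lambda>x. frechet_derivative f (at x) b) U)"

definition test_functions :: "'a::euclidean_space set \<Rightarrow> ('a \<Rightarrow> real) set"
  where "test_functions S =
    {\<phi>. (\<forall>k. Ck_on k \<phi> UNIV) \<and> (\<exists>K. compact K \<and> K \<subseteq> S \<and> (\<forall>x. x \<notin> K \<longrightarrow> \<phi> x = 0))}"

definition locally_integrable_on :: "('a::euclidean_space \<Rightarrow> 'b::euclidean_space) \<Rightarrow> 'a set \<Rightarrow> bool"
  where "locally_integrable_on f S \<longleftrightarrow>
    (\<forall>K. compact K \<and> K \<subseteq> S \<longrightarrow> integrable (lebesgue_on K) f)"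

definition has_weak_gradient ::
  "'a::euclidean_space set \<Rightarrow> ('a \<Rightarrow> real) \<Rightarrow> ('a \<Rightarrow> 'a) \<Rightarrow> bool"
  where "has_weak_gradient S u G \<longleftrightarrow>
    locally_integrable_on u S \<and> locally_integrable_on G S \<and>
    (\<forall>\<phi>\<in>test_functions S. \<forall>b\<in>Basis.
       (\<integral>x. u x * frechet_derivative \<phi> (at x) b \<partial>lebesgue_on S) =
       - (\<integral>x. (G x \<bullet> b) * \<phi> x \<partial>lebesgue_on S))"

definition Lp :: "real \<Rightarrow> 'a::euclidean_space set \<Rightarrow> ('a \<Rightarrow> 'b::euclidean_space) set"
  where "Lp p S = {f \<in> borel_measurable (lebesgue_on S).
    integrable (lebesgue_on S) (\<lambda>x. norm (f x) powr p)}"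

definition Linfty :: "'a::euclidean_space set \<Rightarrow> ('a \<Rightarrow> real) set"
  where "Linfty S = {f \<in> borel_measurable (lebesgue_on S).
    \<exists>C. AE x in lebesgue_on S. \<bar>f x\<bar> \<le> C}"

text \<open>\<open>W1p_gradient p S u G\<close>: the function \<open>u\<close> lies in the Sobolev space and \<open>G\<close> is (a representative
  of) its weak gradient, which is unique up to null sets.\<close>

definition W1p_gradient ::
  "real \<Rightarrow> 'a::euclidean_space set \<Rightarrow> ('a \<Rightarrow> real) \<Rightarrow> ('a \<Rightarrow> 'a) \<Rightarrow> bool"
  where "W1p_gradient p S u G \<longleftrightarrow> u \<in> Lp p S \<and> G \<in> Lp p S \<and> has_weak_gradient S u G"

definition W1p :: "real \<Rightarrow> 'a::euclidean_space set \<Rightarrow> ('a \<Rightarrow> real) set"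
  where "W1p p S = {u. \<exists>G. W1p_gradient p S u G}"

text \<open>Class \<open>C\<close> to the power 1: near each boundary point, \<open>S\<close> is the part strictly above a graph of
  class \<open>C\<close> to the power 1 in some direction \<open>\<nu>\<close>.  The graph function lives on the hyperplane
  orthogonal to \<open>\<nu>\<close>; \<open>\<gamma>\<close> is an extension of it to the whole space and only its values on that
  hyperplane are used.\<close>

definition C1_domain :: "'a::euclidean_space set \<Rightarrow> bool"
  where "C1_domain S \<longleftrightarrow>
    (\<forall>x0\<in>frontier S. \<exists>r>0. \<exists>\<nu> \<gamma>. norm \<nu> = 1 \<and> Ck_on 1 \<gamma> UNIV \<and>
       S \<inter> ball x0 r = {x \<in> ball x0 r. \<gamma> (x - (x \<bullet> \<nu>) *\<^sub>R \<nu>) < x \<bullet> \<nu>})"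

section \<open>Integrable random variables with values in a normed space, and operators on them\<close>

text \<open>Random variables are functions on the sample space, not classes: their distance is a
  seminorm, whose kernel is equality almost surely.  All operators are identified with their graphs.\<close>

definition bochner_L1 :: "'w measure \<Rightarrow> 'b::real_normed_vector set \<Rightarrow> ('w \<Rightarrow> 'b) set"
  where "bochner_L1 M X = {f \<in> borel_measurable M.
    (\<forall>\<omega>\<in>space M. f \<omega> \<in> X) \<and> integrable M (\<lambda>\<omega>. norm (f \<omega>))}"

definition bochner_norm :: "'w measure \<Rightarrow> ('w \<Rightarrow> 'b::real_normed_vector) \<Rightarrow> real"
  where "bochner_norm M f = (\<integral>\<omega>. norm (f \<omega>) \<partial>M)"

definition range_Id_plus :: "(('w \<Rightarrow> 'b::real_normed_vector) \<times> ('w \<Rightarrow> 'b)) set \<Rightarrow> ('w \<Rightarrow> 'b) set"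
  where "range_Id_plus B = {(\<lambda>\<omega>. f \<omega> + f' \<omega>) | f f'. (f, f') \<in> B}"

definition accretive ::
  "'w measure \<Rightarrow> (('w \<Rightarrow> 'b::real_normed_vector) \<times> ('w \<Rightarrow> 'b)) set \<Rightarrow> bool"
  where "accretive M B \<longleftrightarrow>
    (\<forall>(f, f')\<in>B. \<forall>(h, h')\<in>B. \<forall>\<alpha>>0.
       bochner_norm M (\<lambda>\<omega>. f \<omega> - h \<omega>) \<le>
       bochner_norm M (\<lambda>\<omega>. f \<omega> - h \<omega> + \<alpha> *\<^sub>R (f' \<omega> - h' \<omega>)))"

definition m_accretive ::
  "'w measure \<Rightarrow> 'b::real_normed_vector set \<Rightarrow> (('w \<Rightarrow> 'b) \<times> ('w \<Rightarrow> 'b)) set \<Rightarrow> bool"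
  where "m_accretive M X B \<longleftrightarrow>
    B \<subseteq> bochner_L1 M X \<times> bochner_L1 M X \<and> accretive M B \<and> range_Id_plus B = bochner_L1 M X"

definition dense_in_bochner_L1 ::
  "'w measure \<Rightarrow> 'b::real_normed_vector set \<Rightarrow> ('w \<Rightarrow> 'b) set \<Rightarrow> bool"
  where "dense_in_bochner_L1 M X D \<longleftrightarrow> D \<subseteq> bochner_L1 M X \<and>
    (\<forall>f\<in>bochner_L1 M X. \<forall>e>0. \<exists>h\<in>D. bochner_norm M (\<lambda>\<omega>. f \<omega> - h \<omega>) < e)"

definition operator_closure ::
  "'w measure \<Rightarrow> 'b::real_normed_vector set \<Rightarrow> (('w \<Rightarrow> 'b) \<times> ('w \<Rightarrow> 'b)) set \<Rightarrow>
    (('w \<Rightarrow> 'b) \<times> ('w \<Rightarrow> 'b)) set"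
  where "operator_closure M X B =
    {(f, f') \<in> bochner_L1 M X \<times> bochner_L1 M X. \<forall>e>0. \<exists>(h, h')\<in>B.
       bochner_norm M (\<lambda>\<omega>. f \<omega> - h \<omega>) < e \<and> bochner_norm M (\<lambda>\<omega>. f' \<omega> - h' \<omega>) < e}"

section \<open>The weighted \<open>p\<close>-Laplace operator with random weight\<close>

definition L1_infty :: "'w measure \<Rightarrow> 'a::euclidean_space set \<Rightarrow> ('w \<Rightarrow> 'a lebesgue_L1) set"
  where "L1_infty M S = {f \<in> bochner_L1 M (L1 S). AE \<omega> in M. rep_L1 (f \<omega>) \<in> Linfty S}"

text \<open>The factor \<open>norm v powr (p - 2) *\<^sub>R v\<close> is 0 for \<open>v = 0\<close>, also when \<open>p < 2\<close>.\<close>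

definition p_laplace_equation ::
  "real \<Rightarrow> 'a::euclidean_space set \<Rightarrow> ('a \<Rightarrow> real) \<Rightarrow> ('a \<Rightarrow> real) \<Rightarrow> ('a \<Rightarrow> real) \<Rightarrow> bool"
  where "p_laplace_equation p S g u v \<longleftrightarrow>
    (\<exists>G. W1p_gradient p S u G \<and>
      (\<forall>\<phi> \<Phi>. W1p_gradient p S \<phi> \<Phi> \<and> \<phi> \<in> Linfty S \<longrightarrow>
        (\<integral>x. g x * ((norm (G x) powr (p - 2) *\<^sub>R G x) \<bullet> \<Phi> x) \<partial>lebesgue_on S) =
        (\<integral>x. v x * \<phi> x \<partial>lebesgue_on S)))"

definition p_laplace_op ::
  "'w measure \<Rightarrow> real \<Rightarrow> 'a::euclidean_space set \<Rightarrow> ('w \<Rightarrow> 'a lebesgue_L1) \<Rightarrow>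
    (('w \<Rightarrow> 'a lebesgue_L1) \<times> ('w \<Rightarrow> 'a lebesgue_L1)) set"
  where "p_laplace_op M p S g =
    {(f, f'). f \<in> bochner_L1 M (L1 S) \<and> f' \<in> bochner_L1 M (L1 S) \<and>
       (AE \<omega> in M. rep_L1 (f \<omega>) \<in> W1p p S \<inter> Linfty S) \<and>
       (AE \<omega> in M. p_laplace_equation p S (rep_L1 (g \<omega>)) (rep_L1 (f \<omega>)) (rep_L1 (f' \<omega>)))}"

end

theory Submission
  imports Defs
begin

text \<open>For a fixed outcome the problem is deterministic: given a weight \<open>\<gamma>\<close> with values in
\<open>[g1, g2]\<close> and a bounded datum \<open>h\<close>, one has to solve
\<open>u - div (\<gamma> |\<nabla>u|^(p-2) \<nabla>u) = h\<close> weakly, against all bounded Sobolev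
functions.  This is the Euler--Lagrange equation of the strictly convex energy
\<open>J u = \<integral> \<gamma>/p |\<nabla>u|^p + u^2/2 - h u\<close>.

Existence is the direct method.  The energy is minimised over the Sobolev functions with
\<open>|u| \<le> m + 1\<close>, where \<open>m\<close> bounds \<open>h\<close>.  The function \<open>|v|^p\<close> is uniformly convex
(\<open>p_uniform_convexity\<close>), so a minimising sequence and its gradients are Cauchy in norm and converge
strongly (\<open>ex_minimiser\<close>).  Testing the resulting variational inequality with a function of \<open>u\<close>
that vanishes for \<open>|u| \<le> m\<close> gives \<open>|u| \<le> m\<close>; hence the constraint is inactive and \<open>u\<close> solves
the equation (\<open>ex_bounded_solution\<close>).

This test and the next one are nonlinear functions of Sobolev functions, so both rest on the chain
rule: \<open>F \<circ> u\<close> has weak gradient \<open>F'(u) \<nabla>u\<close> (\<open>has_weak_gradient_compose\<close>), proved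
by mollification.  Testing the difference of two equations with a smooth approximation of the sign of
\<open>u1 - u2\<close>, and using that \<open>v \<mapsto> |v|^(p-2) v\<close> is monotone, yields the accretivity
estimate in \<open>L^1\<close> (\<open>weak_solution_accretive\<close>).  Integrated over the sample space it says that the
random operator is accretive; pointwise it gives uniqueness, so there is a solution map
\<open>resolvent\<close>, which is nonexpansive in \<open>h\<close>.

The remaining question for the first assertion is whether the pointwise solution depends measurably on
the outcome.  The resolvent is continuous in \<open>\<gamma>\<close> and \<open>h\<close> jointly (\<open>resolvent_continuous\<close>):
for fixed \<open>h\<close> the equations with weights \<open>\<gamma>n\<close> and \<open>\<gamma>\<close> are tested with the difference of
their solutions (\<open>weight_perturbation_estimate\<close>).  As \<open>L^1\<close> is separable, the pair of weight and
datum is a measurable random variable, and its composition with a continuous map is measurable.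

Density follows by truncating the values of a datum at height \<open>n\<close>.  Finally, the closure of any
accretive operator for which \<open>Id + B\<close> has dense range is m-accretive, because accretivity turns an
approximation of the right-hand side into a Cauchy sequence of solutions and the space of integrable
random variables is complete (\<open>m_accretive_operator_closure\<close>).\<close>

section \<open>Completeness of spaces of p-integrable functions\<close>

lemma norm_add_powr_le:
  fixes a b :: "'b::real_normed_vector"
  assumes "p > 0"
  shows "norm (a + b) powr p \<le> 2 powr p * (norm a powr p + norm b powr p)"
proof -
  have "norm (a + b) \<le> 2 * max (norm a) (norm b)"
    using norm_triangle_ineq[of a b] by linarith
  then have "norm (a + b) powr p \<le> (2 * max (norm a) (norm b)) powr p"
    using assms by (intro powr_mono2) auto
  also have "\<dots> = 2 powr p * max (norm a) (norm b) powr p"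
    by (simp add: powr_mult)
  also have "max (norm a) (norm b) powr p \<le> norm a powr p + norm b powr p"
    by (auto simp: max_def)
  finally show ?thesis by simp
qed

lemma integrable_norm_powr_add:
  fixes f g :: "'a \<Rightarrow> 'b::{banach,second_countable_topology}"
  assumes p: "p > 0" and [measurable]: "f \<in> borel_measurable M" "g \<in> borel_measurable M"
    and "integrable M (\<lambda>x. norm (f x) powr p)" "integrable M (\<lambda>x. norm (g x) powr p)"
  shows "integrable M (\<lambda>x. norm (f x + g x) powr p)"
proof (rule Bochner_Integration.integrable_bound)
  show "integrable M (\<lambda>x. 2 powr p * (norm (f x) powr p + norm (g x) powr p))"
    using assms by auto
  show "AE x in M. norm (norm (f x + g x) powr p) \<le> norm (2 powr p * (norm (f x) powr p + norm (g x) powr p))"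
    using norm_add_powr_le[OF p] by auto
qed measurable

lemma integrable_norm_powr_diff:
  fixes f g :: "'a \<Rightarrow> 'b::{banach,second_countable_topology}"
  assumes p: "p > 0" and [measurable]: "f \<in> borel_measurable M" "g \<in> borel_measurable M"
    and "integrable M (\<lambda>x. norm (f x) powr p)" "integrable M (\<lambda>x. norm (g x) powr p)"
  shows "integrable M (\<lambda>x. norm (f x - g x) powr p)"
  using integrable_norm_powr_add[of p f M "\<lambda>x. - g x"] assms by simp

text \<open>The Riesz--Fischer argument: a subsequence whose consecutive distances decay fast converges almost
everywhere by Borel--Cantelli, and Fatou's lemma identifies the pointwise limit as the limit in the
\<open>p\<close>-th mean.  The codomain is a general separable Banach space, so that the lemma serves for real
functions, for gradients, and for random variables with values in \<open>L^1\<close>.\<close>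

lemma Lp_complete:
  fixes f :: "nat \<Rightarrow> 'a \<Rightarrow> 'b::{banach,second_countable_topology}"
  assumes p: "p > 0"
    and meas [measurable]: "\<And>n. f n \<in> borel_measurable M"
    and int: "\<And>m n. integrable M (\<lambda>x. norm (f m x - f n x) powr p)"
    and cauchy: "\<And>e. e > 0 \<Longrightarrow> \<exists>N. \<forall>m\<ge>N. \<forall>n\<ge>N. (\<integral>x. norm (f m x - f n x) powr p \<partial>M) < e"
  obtains F where "F \<in> borel_measurable M" "\<And>n. integrable M (\<lambda>x. norm (f n x - F x) powr p)"
    "(\<lambda>n. \<integral>x. norm (f n x - F x) powr p \<partial>M) \<longlonglongrightarrow> 0"
proof -
  define d where "d k = (1/2::real)^k" for k
  have d0: "d k > 0" for k by (simp add: d_def)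
  have sd: "summable d" unfolding d_def[abs_def] by (rule summable_geometric) simp
  have "\<exists>N. \<forall>m\<ge>N. \<forall>n\<ge>N. (\<integral>x. norm (f m x - f n x) powr p \<partial>M) < d k * d k powr p" for k
    using d0[of k] by (intro cauchy mult_pos_pos) auto
  \<comment> \<open>the factor \<open>d k powr p\<close> pays for the Markov inequality at height \<open>d k\<close>\<close>
  then obtain N where N: "\<And>k m n. m \<ge> N k \<Longrightarrow> n \<ge> N k \<Longrightarrow>
      (\<integral>x. norm (f m x - f n x) powr p \<partial>M) < d k * d k powr p" by metis
  \<comment> \<open>an index beyond \<open>N k\<close> that also tends to infinity\<close>
  define r where "r k = k + (\<Sum>i\<le>k. N i)" for k
  have rN: "r k \<ge> N k" for k
    unfolding r_def by (intro trans_le_add2 member_le_sum) auto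
  have rN': "r (Suc k) \<ge> N k" for k
    unfolding r_def by (intro trans_le_add2 member_le_sum) auto
  have rk: "r k \<ge> k" for k by (simp add: r_def)
  define E where "E k = {x\<in>space M. norm (f (r (Suc k)) x - f (r k) x) > d k}" for k
  have E [measurable]: "E k \<in> sets M" for k
    unfolding E_def by measurable
  have emE: "emeasure M (E k) \<le> ennreal (d k)" for k
  proof -
    have "ennreal (d k powr p) * emeasure M (E k) = (\<integral>\<^sup>+x. ennreal (d k powr p) * indicator (E k) x \<partial>M)"
      by (simp add: nn_integral_cmult_indicator)
    also have "\<dots> \<le> (\<integral>\<^sup>+x. ennreal (norm (f (r (Suc k)) x - f (r k) x) powr p) \<partial>M)"
    proof (rule nn_integral_mono)
      fix x
      show "ennreal (d k powr p) * indicator (E k) x \<le> ennreal (norm (f (r (Suc k)) x - f (r k) x) powr p)"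
        using p d0[of k] by (cases "x \<in> E k") (auto simp: E_def intro!: ennreal_leI powr_mono2)
    qed
    also have "\<dots> = ennreal (\<integral>x. norm (f (r (Suc k)) x - f (r k) x) powr p \<partial>M)"
      by (rule nn_integral_eq_integral) (use int in auto)
    also have "\<dots> \<le> ennreal (d k powr p) * ennreal (d k)"
      using N[OF rN' rN, of k] d0[of k] by (auto simp: ennreal_mult[symmetric] mult.commute intro!: ennreal_leI)
    finally show ?thesis
      using d0[of k] by (subst (asm) ennreal_mult_le_mult_iff) auto
  qed
  have "AE x in M. eventually (\<lambda>k. x \<in> space M - E k) sequentially"
  proof (rule borel_cantelli_AE1)
    show "emeasure M (E n) < \<infinity>" for n
      using emE[of n] by (simp add: le_less_trans)
    have "measure M (E n) \<le> d n" for n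
      using emE[of n] d0[of n] unfolding measure_def
      by (metis enn2real_leI less_imp_le)
    then show "summable (\<lambda>n. measure M (E n))"
      by (intro summable_comparison_test[OF _ sd]) auto
  qed measurable
  moreover have conv: "convergent (\<lambda>k. f (r k) x)" if ev: "eventually (\<lambda>k. x \<in> space M - E k) sequentially" for x
  proof -
    have "summable (\<lambda>k. norm (f (r (Suc k)) x - f (r k) x))"
    proof (rule summable_comparison_test_ev)
      show "eventually (\<lambda>k. norm (norm (f (r (Suc k)) x - f (r k) x)) \<le> d k) sequentially"
        using ev by eventually_elim (auto simp: E_def)
      show "summable d" by (rule sd)
    qed
    then have "summable (\<lambda>k. f (r (Suc k)) x - f (r k) x)"
      by (rule summable_norm_cancel)
    then have "convergent (\<lambda>n. \<Sum>k<n. f (r (Suc k)) x - f (r k) x)"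
      by (simp add: summable_iff_convergent)
    then have "convergent (\<lambda>n. f (r n) x - f (r 0) x)"
      by (simp only: sum_lessThan_telescope[of "\<lambda>k. f (r k) x"])
    then have "convergent (\<lambda>n. (f (r n) x - f (r 0) x) + f (r 0) x)"
      by (intro convergent_add convergent_const)
    then show ?thesis by simp
  qed
  define F where "F x = lim (\<lambda>k. f (r k) x)" for x
  have F [measurable]: "F \<in> borel_measurable M" unfolding F_def by measurable
  have AEF: "AE x in M. (\<lambda>k. f (r k) x) \<longlonglongrightarrow> F x"
    using calculation
  proof eventually_elim
    case (elim x)
    from conv[OF elim] show ?case by (simp add: F_def convergent_LIMSEQ_iff)
  qed
  have bound: "(\<integral>\<^sup>+x. ennreal (norm (f n x - F x) powr p) \<partial>M) \<le> ennreal e"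
    if e: "e > 0" and n: "\<And>m. m \<ge> N0 \<Longrightarrow> (\<integral>x. norm (f n x - f m x) powr p \<partial>M) \<le> e" for n e N0
  proof -
    have "(\<integral>\<^sup>+x. ennreal (norm (f n x - F x) powr p) \<partial>M) =
        (\<integral>\<^sup>+x. liminf (\<lambda>k. ennreal (norm (f n x - f (r k) x) powr p)) \<partial>M)"
    proof (rule nn_integral_cong_AE)
      show "AE x in M. ennreal (norm (f n x - F x) powr p) = liminf (\<lambda>k. ennreal (norm (f n x - f (r k) x) powr p))"
        using AEF
      proof eventually_elim
        fix x assume "(\<lambda>k. f (r k) x) \<longlonglongrightarrow> F x"
        then have "(\<lambda>k. ennreal (norm (f n x - f (r k) x) powr p)) \<longlonglongrightarrow> ennreal (norm (f n x - F x) powr p)"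
          using p by (intro tendsto_intros tendsto_powr2) auto
        then show "ennreal (norm (f n x - F x) powr p) = liminf (\<lambda>k. ennreal (norm (f n x - f (r k) x) powr p))"
          by (intro lim_imp_Liminf[symmetric]) auto
      qed
    qed
    also have "\<dots> \<le> liminf (\<lambda>k. \<integral>\<^sup>+x. ennreal (norm (f n x - f (r k) x) powr p) \<partial>M)"
      by (rule nn_integral_liminf) auto
    also have "\<dots> \<le> ennreal e"
    proof (rule Liminf_le)
      have "eventually (\<lambda>k. r k \<ge> N0) sequentially"
        using eventually_ge_at_top[of N0] by eventually_elim (use rk order_trans in blast)
      then show "\<forall>\<^sub>F k in sequentially. (\<integral>\<^sup>+x. ennreal (norm (f n x - f (r k) x) powr p) \<partial>M) \<le> ennreal e"
      proof eventually_elim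
        fix k assume "r k \<ge> N0"
        have "(\<integral>\<^sup>+x. ennreal (norm (f n x - f (r k) x) powr p) \<partial>M) = ennreal (\<integral>x. norm (f n x - f (r k) x) powr p \<partial>M)"
          by (rule nn_integral_eq_integral) (use int in auto)
        then show "(\<integral>\<^sup>+x. ennreal (norm (f n x - f (r k) x) powr p) \<partial>M) \<le> ennreal e"
          using n[OF \<open>r k \<ge> N0\<close>] by (auto intro!: ennreal_leI)
      qed
    qed auto
    finally show ?thesis .
  qed
  have ev: "\<exists>n0. \<forall>n\<ge>n0. integrable M (\<lambda>x. norm (f n x - F x) powr p) \<and> (\<integral>x. norm (f n x - F x) powr p \<partial>M) \<le> e" if "e > 0" for e
  proof -
    obtain n0 where n0: "\<And>m n. m \<ge> n0 \<Longrightarrow> n \<ge> n0 \<Longrightarrow> (\<integral>x. norm (f m x - f n x) powr p \<partial>M) < e"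
      using cauchy[OF \<open>e > 0\<close>] by blast
    show ?thesis
    proof (intro exI[of _ n0] allI impI conjI)
      fix n assume n: "n \<ge> n0"
      have b: "(\<integral>\<^sup>+x. ennreal (norm (f n x - F x) powr p) \<partial>M) \<le> ennreal e"
        by (rule bound[OF that, of n0]) (use n0 n in \<open>auto intro: less_imp_le\<close>)
      then show i: "integrable M (\<lambda>x. norm (f n x - F x) powr p)"
        by (intro integrableI_bounded) (auto simp: le_less_trans)
      then have "ennreal (\<integral>x. norm (f n x - F x) powr p \<partial>M) \<le> ennreal e"
        using b by (subst nn_integral_eq_integral[symmetric]) auto
      then show "(\<integral>x. norm (f n x - F x) powr p \<partial>M) \<le> e"
        using \<open>e > 0\<close> by (simp add: ennreal_le_iff)
    qed
  qed
  show thesis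
  proof
    show "F \<in> borel_measurable M" by fact
    obtain n0 where n0: "integrable M (\<lambda>x. norm (f n0 x - F x) powr p)"
      using ev[of 1] by auto
    have "integrable M (\<lambda>x. norm ((f n x - f n0 x) + (f n0 x - F x)) powr p)" for n
      by (rule integrable_norm_powr_add[OF p]) (use int n0 in auto)
    then show "integrable M (\<lambda>x. norm (f n x - F x) powr p)" for n by simp
    show "(\<lambda>n. \<integral>x. norm (f n x - F x) powr p \<partial>M) \<longlonglongrightarrow> 0"
    proof (rule LIMSEQ_I)
      fix e :: real assume "e > 0"
      then obtain n0 where "\<And>n. n \<ge> n0 \<Longrightarrow> (\<integral>x. norm (f n x - F x) powr p \<partial>M) \<le> e/2"
        using ev[of "e/2"] by auto
      moreover have "(\<integral>x. norm (f n x - F x) powr p \<partial>M) \<ge> 0" for n by auto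
      ultimately show "\<exists>no. \<forall>n\<ge>no. norm ((\<integral>x. norm (f n x - F x) powr p \<partial>M) - 0) < e"
        using \<open>e > 0\<close> by (intro exI[of _ n0]) force
    qed
  qed
qed

section \<open>The Banach space of Lebesgue-integrable functions\<close>

lemma rep_L1_integrable [simp]: "integrable lebesgue (rep_L1 u)"
  using Quotient_rep_reflp[OF Quotient_lebesgue_L1, of u] by simp

lemma rep_L1_measurable [measurable]: "rep_L1 u \<in> borel_measurable lebesgue"
  using rep_L1_integrable by (rule borel_measurable_integrable)

lemma rep_abs_L1:
  assumes "integrable lebesgue f"
  shows "AE x in lebesgue. rep_L1 (abs_L1 f) x = f x"
  using Quotient_rep_abs[OF Quotient_lebesgue_L1, of f] assms by simp

lemma L1_eq_iff: "u = v \<longleftrightarrow> (AE x in lebesgue. rep_L1 u x = rep_L1 v x)"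
proof
  assume "AE x in lebesgue. rep_L1 u x = rep_L1 v x"
  then have "abs_L1 (rep_L1 u) = abs_L1 (rep_L1 v)"
    by (intro Quotient_rel_abs[OF Quotient_lebesgue_L1]) auto
  then show "u = v" by (simp add: Quotient_abs_rep[OF Quotient_lebesgue_L1])
qed simp

lemma norm_L1: "norm u = (\<integral>x. \<bar>rep_L1 u x\<bar> \<partial>lebesgue)"
  by (rule norm_lebesgue_L1.rep_eq)

lemma abs_rep_L1: "abs_L1 (rep_L1 u) = u"
  by (rule Quotient_abs_rep[OF Quotient_lebesgue_L1])

lemma rep_L1_add: "AE x in lebesgue. rep_L1 (u + v) x = rep_L1 u x + rep_L1 v x"
  using rep_abs_L1[of "\<lambda>x. rep_L1 u x + rep_L1 v x"]
  by (simp add: plus_lebesgue_L1.abs_eq[symmetric] abs_rep_L1)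

lemma rep_L1_diff: "AE x in lebesgue. rep_L1 (u - v) x = rep_L1 u x - rep_L1 v x"
  using rep_abs_L1[of "\<lambda>x. rep_L1 u x - rep_L1 v x"]
  by (simp add: minus_lebesgue_L1.abs_eq[symmetric] abs_rep_L1)

lemma rep_L1_scaleR: "AE x in lebesgue. rep_L1 (c *\<^sub>R u) x = c * rep_L1 u x"
  using rep_abs_L1[of "\<lambda>x. c * rep_L1 u x"]
  by (simp add: scaleR_lebesgue_L1.abs_eq[symmetric] abs_rep_L1)

lemma rep_L1_zero: "AE x in lebesgue. rep_L1 0 x = 0"
  using rep_abs_L1[of "\<lambda>x. 0"] by (simp add: zero_lebesgue_L1.abs_eq[symmetric])

lemma norm_diff_L1: "norm (u - v) = (\<integral>x. \<bar>rep_L1 u x - rep_L1 v x\<bar> \<partial>lebesgue)"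
  unfolding norm_L1 by (rule integral_cong_AE) (use rep_L1_diff[of u v] in auto)

lemma norm_diff_abs_L1:
  assumes "integrable lebesgue f"
  shows "norm (u - abs_L1 f) = (\<integral>x. \<bar>rep_L1 u x - f x\<bar> \<partial>lebesgue)"
  unfolding norm_diff_L1 by (rule integral_cong_AE) (use rep_abs_L1[OF assms] assms in auto)

instance lebesgue_L1 :: (euclidean_space) banach
proof
  fix X :: "nat \<Rightarrow> 'a lebesgue_L1"
  assume X: "Cauchy X"
  obtain F where F: "F \<in> borel_measurable lebesgue"
      "\<And>n. integrable lebesgue (\<lambda>x. norm (rep_L1 (X n) x - F x) powr 1)"
      "(\<lambda>n. \<integral>x. norm (rep_L1 (X n) x - F x) powr 1 \<partial>lebesgue) \<longlonglongrightarrow> 0"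
  proof (rule Lp_complete[of 1 "\<lambda>n. rep_L1 (X n)" lebesgue])
    fix e :: real assume "e > 0"
    then obtain N where "\<forall>m\<ge>N. \<forall>n\<ge>N. norm (X m - X n) < e"
      using X by (auto simp: Cauchy_def dist_norm)
    then show "\<exists>N. \<forall>m\<ge>N. \<forall>n\<ge>N. (\<integral>x. norm (rep_L1 (X m) x - rep_L1 (X n) x) powr 1 \<partial>lebesgue) < e"
      by (auto simp: norm_diff_L1)
  qed auto
  have i: "integrable lebesgue F"
  proof -
    have "integrable lebesgue (\<lambda>x. rep_L1 (X 0) x - F x)"
      using F(2)[of 0] F(1) by (simp add: integrable_abs_iff)
    then have "integrable lebesgue (\<lambda>x. rep_L1 (X 0) x - (rep_L1 (X 0) x - F x))"
      by (rule Bochner_Integration.integrable_diff[OF rep_L1_integrable])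
    moreover have "(\<lambda>x. rep_L1 (X 0) x - (rep_L1 (X 0) x - F x)) = F" by auto
    ultimately show ?thesis by (simp only:)
  qed
  have "(\<lambda>n. norm (X n - abs_L1 F)) \<longlonglongrightarrow> 0"
    using F(3) by (simp add: norm_diff_abs_L1[OF i])
  then have "X \<longlonglongrightarrow> abs_L1 F"
    by (simp add: tendsto_norm_zero_iff LIM_zero_iff)
  then show "convergent X" by (rule convergentI)
qed

section \<open>Separability of the space of integrable functions\<close>

text \<open>Induction over integrable functions can start from indicators of open sets instead of measurable sets,
because Lebesgue measure is outer regular.  Open sets are what makes the base case easy both for
separability (they are unions of basic sets) and for continuity of translations.\<close>

lemma integrable_lborel_induct_open [consumes 1, case_names indicator add scale limit]:
  fixes f :: "'a::euclidean_space \<Rightarrow> real"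
  assumes f: "integrable lborel f"
    and op: "\<And>U. open U \<Longrightarrow> emeasure lborel U < \<infinity> \<Longrightarrow> P (indicat_real U)"
    and add: "\<And>f g. integrable lborel f \<Longrightarrow> integrable lborel g \<Longrightarrow> P f \<Longrightarrow> P g \<Longrightarrow> P (\<lambda>x. f x + g x)"
    and scale: "\<And>f c. integrable lborel f \<Longrightarrow> P f \<Longrightarrow> P (\<lambda>x. c * f x)"
    and lim: "\<And>f. integrable lborel f \<Longrightarrow>
      (\<And>e. e > 0 \<Longrightarrow> \<exists>h. integrable lborel h \<and> P h \<and> (\<integral>x. \<bar>f x - h x\<bar> \<partial>lborel) < e) \<Longrightarrow> P f"
  shows "P f"
  using f
proof (induction rule: integrable_induct)
  case (base A c)
  have A [measurable]: "A \<in> sets borel" using base by simp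
  have iA: "integrable lborel (indicat_real A)" using base by auto
  have "P (indicat_real A)"
  proof (rule lim[OF iA])
    fix e :: real assume "e > 0"
    from outer_regular_lborel[OF A this] obtain U where U: "open U" "A \<subseteq> U" "emeasure lborel (U - A) < e"
      by auto
    have [measurable]: "U \<in> sets borel" using U by auto
    have "emeasure lborel U = emeasure lborel (A \<union> (U - A))" using U by (auto intro!: arg_cong[where f="emeasure lborel"])
    also have "\<dots> \<le> emeasure lborel A + emeasure lborel (U - A)"
      by (rule emeasure_subadditive) auto
    also have "\<dots> < \<infinity>" using base(2) U(3) by (auto simp: less_top[symmetric])
    finally have fU: "emeasure lborel U < \<infinity>" .
    have "(\<integral>x. \<bar>indicator A x - indicat_real U x\<bar> \<partial>lborel) = (\<integral>x. indicat_real (U - A) x \<partial>lborel)"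
      using U(2) by (intro Bochner_Integration.integral_cong) (auto simp: indicator_def)
    also have "\<dots> = measure lborel (U - A)" by simp
    also have "\<dots> < e" using U(3) \<open>e > 0\<close>
      by (metis Sigma_Algebra.measure_def enn2real_less_iff order_less_trans top.not_eq_extremum ennreal_less_top)
    finally have "(\<integral>x. \<bar>indicator A x - indicat_real U x\<bar> \<partial>lborel) < e" .
    then show "\<exists>h. integrable lborel h \<and> P h \<and> (\<integral>x. \<bar>indicator A x - h x\<bar> \<partial>lborel) < e"
      using fU U op by (intro exI[of _ "indicat_real U"]) auto
  qed
  from scale[OF iA this, where c=c] show ?case by (simp add: mult.commute)
next
  case (add f g) then show ?case using assms(3) by blast
next
  case (lim f s)
  show ?case
  proof (rule assms(5))
    fix e :: real assume "e > 0"
    have bd: "\<bar>s i x\<bar> \<le> 2 * \<bar>f x\<bar>" for i x using lim by simp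
    have [measurable]: "f \<in> borel_measurable lborel" "s i \<in> borel_measurable lborel" for i
      using lim by auto
    have "(\<lambda>i. \<integral>x. \<bar>f x - s i x\<bar> \<partial>lborel) \<longlonglongrightarrow> (\<integral>x. 0 \<partial>(lborel::'a measure))"
    proof (rule integral_dominated_convergence[where w="\<lambda>x. 3 * \<bar>f x\<bar>"])
      show "AE x in lborel. (\<lambda>i. \<bar>f x - s i x\<bar>) \<longlonglongrightarrow> 0"
      proof (rule AE_I2)
        fix x
        have "(\<lambda>i. \<bar>f x - s i x\<bar>) \<longlonglongrightarrow> \<bar>f x - f x\<bar>"
          using lim by (intro tendsto_intros) auto
        then show "(\<lambda>i. \<bar>f x - s i x\<bar>) \<longlonglongrightarrow> 0" by simp
      qed
      show "AE x in lborel. norm \<bar>f x - s i x\<bar> \<le> 3 * \<bar>f x\<bar>" for i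
      proof (rule AE_I2)
        fix x show "norm \<bar>f x - s i x\<bar> \<le> 3 * \<bar>f x\<bar>" using bd[of i x] by auto
      qed
    qed (use lim in auto)
    then have "eventually (\<lambda>i. (\<integral>x. \<bar>f x - s i x\<bar> \<partial>lborel) < e) sequentially"
      using \<open>e > 0\<close> by (intro order_tendstoD(2)) auto
    then obtain i where "(\<integral>x. \<bar>f x - s i x\<bar> \<partial>lborel) < e"
      by (auto simp: eventually_sequentially)
    then show "\<exists>h. integrable lborel h \<and> P h \<and> (\<integral>x. \<bar>f x - h x\<bar> \<partial>lborel) < e"
      using lim by (intro exI[of _ "s i"]) simp
  qed fact
qed

text \<open>Rational combinations of indicators of finite unions of sets from a list; with the sets taken from a
countable basis, these are the countable dense family of \<open>L^1\<close>.  Finite unions, rather than single basic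
sets, allow an open set to be exhausted from inside with one indicator at a time.\<close>

definition union_step :: "(rat \<times> 'a set list) list \<Rightarrow> 'a \<Rightarrow> real"
  where "union_step l x = (\<Sum>(c, F)\<leftarrow>l. of_rat c * indicat_real (\<Union>(set F)) x)"

lemma union_step_append: "union_step (l @ l') x = union_step l x + union_step l' x"
  by (simp add: union_step_def)

lemma union_step_scale: "union_step (map (\<lambda>(c, F). (r * c, F)) l) x = of_rat r * union_step l x"
  by (induction l) (auto simp: union_step_def of_rat_mult algebra_simps)

lemma union_steps_dense:
  fixes f :: "'a::euclidean_space \<Rightarrow> real" and B :: "'a set set"
  assumes B: "topological_basis B" "countable B" and f: "integrable lborel f" and e: "e > 0"
  shows "\<exists>l\<in>lists (UNIV \<times> lists B). integrable lborel (union_step l) \<and>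
    (\<integral>x. \<bar>f x - union_step l x\<bar> \<partial>lborel) < e"
proof -
  let ?L = "lists (UNIV \<times> lists B) :: (rat \<times> 'a set list) list set"
  define P where "P f \<longleftrightarrow> (\<forall>e>0. \<exists>l\<in>?L. integrable lborel (union_step l) \<and>
    (\<integral>x. \<bar>f x - union_step l x\<bar> \<partial>lborel) < e)" for f :: "'a \<Rightarrow> real"
  have "P f"
    using f
  proof (induction rule: integrable_lborel_induct_open)
    case (indicator U)
    show ?case unfolding P_def
    proof (intro allI impI)
      fix e :: real assume "e > 0"
      obtain B' where B': "B' \<subseteq> B" "\<Union>B' = U"
        using B(1) indicator(1) unfolding topological_basis_def by metis
      have cB': "countable B'" using B(2) B'(1) by (rule countable_subset[rotated])
      \<comment> \<open>\<open>B'\<close> may be empty, so a dummy set is enumerated with it and then filtered out\<close>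
      define b where "b n = map (from_nat_into (insert {} B')) [0..<n]" for n
      have bset: "set (b n) \<subseteq> insert {} B'" for n
        using from_nat_into[of "insert {} B'"] by (auto simp: b_def)
      define b' where "b' n = filter (\<lambda>X. X \<in> B') (b n)" for n
      have b'B: "b' n \<in> lists B" for n using B' by (auto simp: b'_def)
      have sub: "\<Union>(set (b' n)) \<subseteq> U" for n using B' by (auto simp: b'_def)
      have op [measurable]: "\<Union>(set (b' n)) \<in> sets borel" for n
      proof -
        have "open X" if "X \<in> set (b' n)" for X using that B' topological_basis_open[OF B(1)] by (auto simp: b'_def)
        then show ?thesis by auto
      qed
      have [measurable]: "U \<in> sets borel" using indicator by auto
      have "(\<lambda>n. \<integral>x. \<bar>indicat_real U x - indicat_real (\<Union>(set (b' n))) x\<bar> \<partial>lborel) \<longlonglongrightarrow> (\<integral>x. 0 \<partial>(lborel::'a measure))"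
      proof (rule integral_dominated_convergence[where w="indicat_real U"])
        show "AE x in lborel. norm \<bar>indicat_real U x - indicat_real (\<Union>(set (b' n))) x\<bar> \<le> indicat_real U x" for n
          using sub[of n] by (auto simp: indicator_def)
        show "AE x in lborel. (\<lambda>n. \<bar>indicat_real U x - indicat_real (\<Union>(set (b' n))) x\<bar>) \<longlonglongrightarrow> 0"
        proof (rule AE_I2)
          fix x :: 'a
          have "eventually (\<lambda>n. \<bar>indicat_real U x - indicat_real (\<Union>(set (b' n))) x\<bar> = 0) sequentially"
          proof (cases "x \<in> U")
            case True
            then obtain X where X: "X \<in> B'" "x \<in> X" using B' by auto
            then obtain k where k: "from_nat_into (insert {} B') k = X"
              using from_nat_into_surj[of "insert {} B'" X] cB' by auto
            have "x \<in> \<Union>(set (b' n))" if "n > k" for n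
              using that k X by (auto simp: b'_def b_def intro!: bexI[of _ X] image_eqI[of _ _ k])
            then show ?thesis using True
              by (intro eventually_mono[OF eventually_gt_at_top[of k]]) simp
          next
            case False
            then show ?thesis using sub by (intro always_eventually allI) (auto simp: indicator_def)
          qed
          then show "(\<lambda>n. \<bar>indicat_real U x - indicat_real (\<Union>(set (b' n))) x\<bar>) \<longlonglongrightarrow> 0"
            by (rule tendsto_eventually)
        qed
        show "integrable lborel (indicat_real U)" using indicator by auto
      qed auto
      then have "eventually (\<lambda>n. (\<integral>x. \<bar>indicat_real U x - indicat_real (\<Union>(set (b' n))) x\<bar> \<partial>lborel) < e) sequentially"
        using \<open>e > 0\<close> by (intro order_tendstoD(2)) auto
      then obtain n where n: "(\<integral>x. \<bar>indicat_real U x - indicat_real (\<Union>(set (b' n))) x\<bar> \<partial>lborel) < e"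
        by (auto simp: eventually_sequentially)
      have us: "union_step [(1, b' n)] = indicat_real (\<Union>(set (b' n)))"
        by (auto simp: union_step_def)
      have "integrable lborel (indicat_real (\<Union>(set (b' n))))"
        using indicator(2) emeasure_mono[OF sub[of n], of lborel] by (auto simp: le_less_trans)
      then show "\<exists>l\<in>?L. integrable lborel (union_step l) \<and> (\<integral>x. \<bar>indicat_real U x - union_step l x\<bar> \<partial>lborel) < e"
        using n b'B[of n] by (intro bexI[of _ "[(1, b' n)]"]) (simp_all only: us, auto)
    qed
  next
    case (add f g)
    show ?case unfolding P_def
    proof (intro allI impI)
      fix e :: real assume "e > 0"
      then have "e/2 > 0" by simp
      obtain l where l: "l \<in> ?L" "integrable lborel (union_step l)" "(\<integral>x. \<bar>f x - union_step l x\<bar> \<partial>lborel) < e/2"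
        using add(3) \<open>e/2 > 0\<close> unfolding P_def by blast
      obtain l' where l': "l' \<in> ?L" "integrable lborel (union_step l')" "(\<integral>x. \<bar>g x - union_step l' x\<bar> \<partial>lborel) < e/2"
        using add(4) \<open>e/2 > 0\<close> unfolding P_def by blast
      have i: "integrable lborel (\<lambda>x. union_step (l @ l') x)"
        using l l' by (simp add: union_step_append)
      have "(\<integral>x. \<bar>f x + g x - union_step (l @ l') x\<bar> \<partial>lborel) \<le>
          (\<integral>x. \<bar>f x - union_step l x\<bar> + \<bar>g x - union_step l' x\<bar> \<partial>lborel)"
        using add l l' i by (intro integral_mono) (auto simp: union_step_append)
      also have "\<dots> < e" using add l l' by (subst Bochner_Integration.integral_add) auto
      finally show "\<exists>l\<in>?L. integrable lborel (union_step l) \<and> (\<integral>x. \<bar>f x + g x - union_step l x\<bar> \<partial>lborel) < e"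
        using i l(1) l'(1) by (intro bexI[of _ "l @ l'"]) auto
    qed
  next
    case (scale f c)
    show ?case unfolding P_def
    proof (intro allI impI)
      fix e :: real assume e: "e > 0"
      have "e / (2 * (\<bar>c\<bar> + 1)) > 0" using e by (auto intro!: divide_pos_pos)
      then obtain l where l: "l \<in> ?L" "integrable lborel (union_step l)"
          "(\<integral>x. \<bar>f x - union_step l x\<bar> \<partial>lborel) < e / (2 * (\<bar>c\<bar> + 1))"
        using scale(2) unfolding P_def by blast
      define N where "N = (\<integral>x. \<bar>union_step l x\<bar> \<partial>lborel)"
      have N: "N \<ge> 0" by (simp add: N_def)
      have "e / (2 * (N + 1)) > 0" using e N by (auto intro!: divide_pos_pos)
      then obtain r where r0: "c < real_of_rat r" "real_of_rat r < c + e / (2 * (N + 1))"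
        using of_rat_dense[of c "c + e / (2 * (N + 1))"] by auto
      then have r: "\<bar>c - real_of_rat r\<bar> < e / (2 * (N + 1))" by simp
      let ?l = "map (\<lambda>(c, F). (r * c, F)) l"
      have i: "integrable lborel (\<lambda>x. union_step ?l x)"
        using l by (simp add: union_step_scale)
      have "(\<integral>x. \<bar>c * f x - union_step ?l x\<bar> \<partial>lborel) \<le>
          (\<integral>x. \<bar>c\<bar> * \<bar>f x - union_step l x\<bar> + \<bar>c - of_rat r\<bar> * \<bar>union_step l x\<bar> \<partial>lborel)"
      proof (rule integral_mono)
        fix x
        have "c * f x - union_step ?l x = c * (f x - union_step l x) + (c - of_rat r) * union_step l x"
          unfolding union_step_scale by (simp add: algebra_simps)
        then show "\<bar>c * f x - union_step ?l x\<bar> \<le> \<bar>c\<bar> * \<bar>f x - union_step l x\<bar> + \<bar>c - of_rat r\<bar> * \<bar>union_step l x\<bar>"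
          by (metis abs_mult abs_triangle_ineq)
      qed (use scale l i in auto)
      also have "\<dots> = \<bar>c\<bar> * (\<integral>x. \<bar>f x - union_step l x\<bar> \<partial>lborel) + \<bar>c - of_rat r\<bar> * N"
        using scale l by (subst Bochner_Integration.integral_add) (auto simp: N_def)
      also have "\<dots> < e/2 + e/2"
      proof (rule add_le_less_mono)
        have "\<bar>c\<bar> * (\<integral>x. \<bar>f x - union_step l x\<bar> \<partial>lborel) \<le> (\<bar>c\<bar> + 1) * (e / (2 * (\<bar>c\<bar> + 1)))"
          using l(3) by (intro mult_mono) auto
        also have "\<dots> = e/2" by (simp add: field_simps add_eq_0_iff)
        finally show "\<bar>c\<bar> * (\<integral>x. \<bar>f x - union_step l x\<bar> \<partial>lborel) \<le> e/2" .
        have "\<bar>c - of_rat r\<bar> * N \<le> \<bar>c - of_rat r\<bar> * (N + 1)" using N by (intro mult_left_mono) auto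
        also have "\<dots> < (e / (2 * (N + 1))) * (N + 1)" using r N by (intro mult_strict_right_mono) auto
        also have "\<dots> = e/2" using N by (simp add: field_simps)
        finally show "\<bar>c - of_rat r\<bar> * N < e/2" .
      qed
      finally show "\<exists>l\<in>?L. integrable lborel (union_step l) \<and> (\<integral>x. \<bar>c * f x - union_step l x\<bar> \<partial>lborel) < e"
        using i l(1) by (intro bexI[of _ ?l]) (auto simp: in_lists_conv_set)
    qed
  next
    case (limit f)
    show ?case unfolding P_def
    proof (intro allI impI)
      fix e :: real assume "e > 0"
      then have e: "e/2 > 0" by simp
      obtain h where h: "integrable lborel h" "P h" "(\<integral>x. \<bar>f x - h x\<bar> \<partial>lborel) < e/2"
        using limit(2)[OF e] by blast
      obtain l where l: "l \<in> ?L" "integrable lborel (union_step l)" "(\<integral>x. \<bar>h x - union_step l x\<bar> \<partial>lborel) < e/2"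
        using h(2) e unfolding P_def by blast
      have "(\<integral>x. \<bar>f x - union_step l x\<bar> \<partial>lborel) \<le> (\<integral>x. \<bar>f x - h x\<bar> + \<bar>h x - union_step l x\<bar> \<partial>lborel)"
        using limit(1) h l by (intro integral_mono) auto
      also have "\<dots> < e" using limit(1) h l by (subst Bochner_Integration.integral_add) auto
      finally show "\<exists>l\<in>?L. integrable lborel (union_step l) \<and> (\<integral>x. \<bar>f x - union_step l x\<bar> \<partial>lborel) < e"
        using l by blast
    qed
  qed
  then show ?thesis using e unfolding P_def by blast
qed

lemma second_countable_if_dense:
  fixes D :: "'b::metric_space set"
  assumes D: "countable D" and dense: "\<And>x e. e > 0 \<Longrightarrow> \<exists>d\<in>D. dist x d < e"
  shows "\<exists>B::'b set set. countable B \<and> topological_basis B"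
proof (intro exI conjI)
  let ?B = "(\<lambda>(d, r). ball d (of_rat r)) ` (D \<times> (UNIV::rat set))"
  show "countable ?B" using D by auto
  show "topological_basis ?B"
  proof (rule topological_basisI)
    fix O' and x :: 'b assume "open O'" "x \<in> O'"
    then obtain e where e: "e > 0" "ball x e \<subseteq> O'" by (auto simp: open_contains_ball)
    obtain r where r: "0 < real_of_rat r" "real_of_rat r < e/2" using of_rat_dense[of 0 "e/2"] e(1) half_gt_zero[OF e(1)] by metis
    obtain d where d: "d \<in> D" "dist x d < of_rat r" using dense[OF r(1), of x] by auto
    have "ball d (of_rat r) \<subseteq> ball x e"
    proof
      fix y assume "y \<in> ball d (of_rat r)"
      then show "y \<in> ball x e" using d r dist_triangle[of x y d] by (auto simp: dist_commute)
    qed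
    then show "\<exists>B'\<in>?B. x \<in> B' \<and> B' \<subseteq> O'"
      using d e by (intro bexI[of _ "ball d (of_rat r)"]) (auto simp: dist_commute)
  qed auto
qed

lemma ex_borel_representative_integrable:
  fixes f :: "'a::euclidean_space \<Rightarrow> real"
  assumes "integrable lebesgue f"
  obtains f' where "integrable lborel f'" "AE x in lebesgue. f x = f' x"
proof -
  obtain f' where f': "f' \<in> borel_measurable lborel" "AE x in lborel. f x = f' x"
    using completion_ex_borel_measurable_real[of f lborel] assms by auto
  have ae: "AE x in lebesgue. f x = f' x"
    using f'(2) by (rule AE_completion)
  have "integrable lebesgue f'"
    using assms ae f'(1) by (subst integrable_cong_AE[of f' _ f]) (auto intro: measurable_completion)
  then have "integrable lborel f'"
    using f'(1) by (simp add: integrable_completion)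
  with ae show thesis using that by blast
qed

text \<open>Separability makes pairs and sums of random variables with values in \<open>L^1\<close> Borel
  measurable.\<close>

instance lebesgue_L1 :: (euclidean_space) second_countable_topology
proof
  obtain B :: "'a set set" where B: "countable B" "topological_basis B"
    using ex_countable_basis by blast
  let ?D = "(\<lambda>l. abs_L1 (union_step l)) ` lists (UNIV \<times> lists B)"
  have "\<exists>B::'a lebesgue_L1 set set. countable B \<and> topological_basis B"
  proof (rule second_countable_if_dense)
    show "countable ?D" using B by auto
    fix u :: "'a lebesgue_L1" and e :: real assume e: "e > 0"
    obtain f where f: "integrable lborel f" "AE x in lebesgue. rep_L1 u x = f x"
      using ex_borel_representative_integrable[of "rep_L1 u"] by auto
    obtain l where l: "l \<in> lists (UNIV \<times> lists B)" "integrable lborel (union_step l)"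
        "(\<integral>x. \<bar>f x - union_step l x\<bar> \<partial>lborel) < e"
      using union_steps_dense[OF B(2,1) f(1) e] by blast
    have i: "integrable lebesgue (union_step l)" "integrable lebesgue f"
      using l(2) f(1) by (auto simp: integrable_completion)
    have "norm (u - abs_L1 (union_step l)) = (\<integral>x. \<bar>f x - union_step l x\<bar> \<partial>lebesgue)"
      unfolding norm_diff_abs_L1[OF i(1)]
      by (rule integral_cong_AE) (use i f(2) in auto)
    also have "\<dots> = (\<integral>x. \<bar>f x - union_step l x\<bar> \<partial>lborel)"
      using l(2) f(1) by (intro integral_completion) auto
    finally show "\<exists>d\<in>?D. dist u d < e"
      using l(1,3) by (intro bexI[of _ "abs_L1 (union_step l)"] imageI) (simp_all only: dist_norm)
  qed
  then show "\<exists>B::'a lebesgue_L1 set set. countable B \<and> open = generate_topology B"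
    by (meson topological_basis_imp_subbasis)
qed

section \<open>Continuity of translations\<close>

lemma integrable_lborel_shift:
  fixes f :: "'a::euclidean_space \<Rightarrow> real"
  shows "integrable lborel (\<lambda>x. f (x - z)) \<longleftrightarrow> integrable lborel f"
proof -
  have "integrable lborel (\<lambda>x. f (x - z))" if "integrable lborel f" for f :: "'a \<Rightarrow> real" and z
  proof -
    have "integrable (distr lborel borel ((+) (- z))) f" using that by (simp add: lborel_distr_plus)
    then have "integrable lborel (\<lambda>x. f (- z + x))"
      using that by (subst (asm) integrable_distr_eq) auto
    then show ?thesis by (simp add: add.commute)
  qed
  from this[of f z] this[of "\<lambda>x. f (x - z)" "-z"] show ?thesis by auto
qed

lemma integral_lborel_shift:
  fixes f :: "'a::euclidean_space \<Rightarrow> real"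
  assumes [measurable]: "f \<in> borel_measurable borel"
  shows "(\<integral>x. f (x - z) \<partial>lborel) = (\<integral>x. f x \<partial>lborel)"
proof -
  have "(\<integral>x. f x \<partial>lborel) = (\<integral>x. f x \<partial>distr lborel borel ((+) (- z)))"
    by (simp add: lborel_distr_plus)
  also have "\<dots> = (\<integral>x. f (- z + x) \<partial>lborel)" by (subst integral_distr) auto
  finally show ?thesis by (simp add: add.commute)
qed

lemma lborel_distr_reflect: "distr lborel borel (\<lambda>y. x - y) = (lborel :: 'a::euclidean_space measure)"
proof -
  have "lborel = density (distr lborel borel (\<lambda>y. x + (-1) *\<^sub>R y)) (\<lambda>_. ennreal (\<bar>-1\<bar> ^ DIM('a)))"
    by (rule lborel_affine) simp
  then show ?thesis by (simp add: density_1)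
qed

lemma integral_lborel_reflect:
  fixes f :: "'a::euclidean_space \<Rightarrow> real"
  assumes [measurable]: "f \<in> borel_measurable borel"
  shows "(\<integral>y. f (x - y) \<partial>lborel) = (\<integral>y. f y \<partial>lborel)"
  by (subst (2) lborel_distr_reflect[symmetric, of x], subst integral_distr) auto

text \<open>The property is preserved by sums, multiples and limits in \<open>L^1\<close>, so only indicators of open sets \<open>U\<close>
matter.  For them translation invariance turns \<open>|a - b| = a + b - 2 a b\<close> into twice the measure of the
part of \<open>U\<close> that leaves \<open>U\<close>, and every point of \<open>U\<close> eventually stays in \<open>U\<close> because \<open>U\<close> is open.\<close>

lemma L1_translation_continuous:
  fixes f :: "'a::euclidean_space \<Rightarrow> real"
  assumes "integrable lborel f" "z \<longlonglongrightarrow> 0"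
  shows "(\<lambda>n. \<integral>x. \<bar>f (x - z n) - f x\<bar> \<partial>lborel) \<longlonglongrightarrow> 0"
  using assms(1)
proof (induction rule: integrable_lborel_induct_open)
  case (indicator U)
  let ?i = "indicat_real U"
  have [measurable]: "U \<in> sets borel" using indicator by auto
  have i: "integrable lborel ?i" using indicator by auto
  have iz: "integrable lborel (\<lambda>x. ?i (x - w))" for w using i by (simp add: integrable_lborel_shift)
  have im: "integrable lborel (\<lambda>x. ?i x * ?i (x - w))" for w
    by (rule Bochner_Integration.integrable_bound[OF i]) (auto simp: indicator_def)
  have eq: "(\<integral>x. \<bar>?i (x - z n) - ?i x\<bar> \<partial>lborel) = 2 * (\<integral>x. ?i x - ?i x * ?i (x - z n) \<partial>lborel)" for n
  proof -
    have "(\<integral>x. \<bar>?i (x - z n) - ?i x\<bar> \<partial>lborel) = (\<integral>x. ?i (x - z n) + ?i x - 2 * (?i x * ?i (x - z n)) \<partial>lborel)"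
      by (rule Bochner_Integration.integral_cong) (auto simp: indicator_def)
    also have "\<dots> = (\<integral>x. ?i (x - z n) \<partial>lborel) + (\<integral>x. ?i x \<partial>lborel) - 2 * (\<integral>x. ?i x * ?i (x - z n) \<partial>lborel)"
      using i iz im by simp
    also have "(\<integral>x. ?i (x - z n) \<partial>lborel) = (\<integral>x. ?i x \<partial>lborel)" by (rule integral_lborel_shift) simp
    finally show ?thesis using i im by simp
  qed
  have "(\<lambda>n. \<integral>x. ?i x - ?i x * ?i (x - z n) \<partial>lborel) \<longlonglongrightarrow> (\<integral>x. 0 \<partial>(lborel::'a measure))"
  proof (rule integral_dominated_convergence[where w="?i"])
    show "AE x in lborel. (\<lambda>n. ?i x - ?i x * ?i (x - z n)) \<longlonglongrightarrow> 0"
    proof (rule AE_I2)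
      fix x
      show "(\<lambda>n. ?i x - ?i x * ?i (x - z n)) \<longlonglongrightarrow> 0"
      proof (cases "x \<in> U")
        case True
        have "(\<lambda>n. x - z n) \<longlonglongrightarrow> x - 0" using assms(2) by (intro tendsto_intros)
        then have "eventually (\<lambda>n. x - z n \<in> U) sequentially"
          using indicator(1) True by (intro topological_tendstoD) auto
        then have "eventually (\<lambda>n. ?i x - ?i x * ?i (x - z n) = 0) sequentially"
          by eventually_elim (simp add: True)
        then show ?thesis by (rule tendsto_eventually)
      qed simp
    qed
    show "AE x in lborel. norm (?i x - ?i x * ?i (x - z n)) \<le> ?i x" for n
      by (auto simp: indicator_def)
  qed (use i in auto)
  then have "(\<lambda>n. 2 * (\<integral>x. ?i x - ?i x * ?i (x - z n) \<partial>lborel)) \<longlonglongrightarrow> 2 * 0"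
    by (intro tendsto_intros) simp
  then show ?case by (simp add: eq)
next
  case (add f g)
  have iz: "integrable lborel (\<lambda>x. f (x - w))" "integrable lborel (\<lambda>x. g (x - w))" for w
    using add by (simp_all add: integrable_lborel_shift)
  have le: "(\<integral>x. \<bar>f (x - w) + g (x - w) - (f x + g x)\<bar> \<partial>lborel) \<le>
      (\<integral>x. \<bar>f (x - w) - f x\<bar> \<partial>lborel) + (\<integral>x. \<bar>g (x - w) - g x\<bar> \<partial>lborel)" for w
  proof -
    have "(\<integral>x. \<bar>f (x - w) + g (x - w) - (f x + g x)\<bar> \<partial>lborel) \<le> (\<integral>x. \<bar>f (x - w) - f x\<bar> + \<bar>g (x - w) - g x\<bar> \<partial>lborel)"
      using iz add(1,2) by (intro integral_mono) auto
    also have "\<dots> = (\<integral>x. \<bar>f (x - w) - f x\<bar> \<partial>lborel) + (\<integral>x. \<bar>g (x - w) - g x\<bar> \<partial>lborel)"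
      using iz add(1,2) by (intro Bochner_Integration.integral_add) auto
    finally show ?thesis .
  qed
  show ?case
    by (rule tendsto_sandwich[OF _ _ tendsto_const tendsto_add_zero[OF add(3,4)]]) (auto intro!: always_eventually le)
next
  case (scale f c)
  have "\<bar>c * f (x - w) - c * f x\<bar> = \<bar>c\<bar> * \<bar>f (x - w) - f x\<bar>" for x w
    by (simp add: abs_mult[symmetric] right_diff_distrib)
  then show ?case using scale by (auto intro!: tendsto_mult_right_zero)
next
  case (limit f)
  show ?case
  proof (rule LIMSEQ_I)
    fix e :: real assume e: "e > 0"
    then have "e/4 > 0" by simp
    then obtain h where h: "integrable lborel h" "(\<lambda>n. \<integral>x. \<bar>h (x - z n) - h x\<bar> \<partial>lborel) \<longlonglongrightarrow> 0"
       "(\<integral>x. \<bar>f x - h x\<bar> \<partial>lborel) < e/4" using limit(2) by blast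
    have "eventually (\<lambda>n. (\<integral>x. \<bar>h (x - z n) - h x\<bar> \<partial>lborel) < e/4) sequentially"
      by (rule order_tendstoD(2)[OF h(2)]) (use e in simp)
    then obtain N where N: "\<And>n. n \<ge> N \<Longrightarrow> (\<integral>x. \<bar>h (x - z n) - h x\<bar> \<partial>lborel) < e/4"
      by (auto simp: eventually_sequentially)
    have iz: "integrable lborel (\<lambda>x. f (x - w))" "integrable lborel (\<lambda>x. h (x - w))" for w
      using limit h by (simp_all add: integrable_lborel_shift)
    have "(\<integral>x. \<bar>f (x - z n) - f x\<bar> \<partial>lborel) < e" if "n \<ge> N" for n
    proof -
      have [measurable]: "f \<in> borel_measurable borel" "h \<in> borel_measurable borel" using limit h by auto
      have "(\<integral>x. \<bar>f (x - z n) - f x\<bar> \<partial>lborel) \<le>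
        (\<integral>x. \<bar>f (x - z n) - h (x - z n)\<bar> + (\<bar>h (x - z n) - h x\<bar> + \<bar>f x - h x\<bar>) \<partial>lborel)"
        using iz limit(1) h by (intro integral_mono) auto
      also have "\<dots> = (\<integral>x. \<bar>f (x - z n) - h (x - z n)\<bar> \<partial>lborel) + ((\<integral>x. \<bar>h (x - z n) - h x\<bar> \<partial>lborel) + (\<integral>x. \<bar>f x - h x\<bar> \<partial>lborel))"
        using iz limit(1) h by simp
      also have "(\<integral>x. \<bar>f (x - z n) - h (x - z n)\<bar> \<partial>lborel) = (\<integral>x. \<bar>f x - h x\<bar> \<partial>lborel)"
        by (rule integral_lborel_shift[of "\<lambda>x. \<bar>f x - h x\<bar>"]) simp
      finally show ?thesis using N[OF that] h(3) e by linarith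
    qed
    then show "\<exists>no. \<forall>n\<ge>no. norm ((\<integral>x. \<bar>f (x - z n) - f x\<bar> \<partial>lborel) - 0) < e"
      by (intro exI[of _ N]) auto
  qed
qed

section \<open>Smooth functions and mollifiers\<close>

lemma Ck_on_SucD: "Ck_on (Suc k) f UNIV \<Longrightarrow> Ck_on k f UNIV"
proof (induction k arbitrary: f)
  case 0
  then show ?case
    by (auto intro!: continuous_at_imp_continuous_on differentiable_imp_continuous_within)
next
  case (Suc k)
  then show ?case by auto
qed

lemma frechet_derivative_add:
  fixes f g :: "'a::euclidean_space \<Rightarrow> real"
  assumes "f differentiable (at x)" "g differentiable (at x)"
  shows "frechet_derivative (\<lambda>x. f x + g x) (at x) b =
    frechet_derivative f (at x) b + frechet_derivative g (at x) b"
proof -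
  have "((\<lambda>x. f x + g x) has_derivative (\<lambda>h. frechet_derivative f (at x) h + frechet_derivative g (at x) h)) (at x)"
    using assms by (intro has_derivative_add) (simp_all add: frechet_derivative_works[symmetric])
  from frechet_derivative_at[OF this, symmetric] show ?thesis by simp
qed

lemma Ck_on_add: "Ck_on k f UNIV \<Longrightarrow> Ck_on k g UNIV \<Longrightarrow> Ck_on k (\<lambda>x. f x + g x) UNIV"
proof (induction k arbitrary: f g)
  case 0 then show ?case by (auto intro: continuous_intros)
next
  case (Suc k)
  have "frechet_derivative (\<lambda>x. f x + g x) (at x) b = frechet_derivative f (at x) b + frechet_derivative g (at x) b" for x b
    using Suc.prems by (intro frechet_derivative_add) auto
  then show ?case using Suc by (auto intro: differentiable_add)
qed

lemma frechet_derivative_mult: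
  fixes f g :: "'a::euclidean_space \<Rightarrow> real"
  assumes "f differentiable (at x)" "g differentiable (at x)"
  shows "frechet_derivative (\<lambda>x. f x * g x) (at x) b =
    f x * frechet_derivative g (at x) b + frechet_derivative f (at x) b * g x"
proof -
  have "((\<lambda>x. f x * g x) has_derivative (\<lambda>h. f x * frechet_derivative g (at x) h + frechet_derivative f (at x) h * g x)) (at x)"
    using assms by (intro has_derivative_mult) (simp_all add: frechet_derivative_works[symmetric])
  from frechet_derivative_at[OF this, symmetric] show ?thesis by simp
qed

lemma Ck_on_mult: "Ck_on k f UNIV \<Longrightarrow> Ck_on k g UNIV \<Longrightarrow> Ck_on k (\<lambda>x. f x * g x) UNIV"
proof (induction k arbitrary: f g)
  case 0 then show ?case by (auto intro: continuous_intros)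
next
  case (Suc k)
  have eq: "frechet_derivative (\<lambda>x. f x * g x) (at x) b =
    f x * frechet_derivative g (at x) b + frechet_derivative f (at x) b * g x" for x b
    using Suc.prems by (intro frechet_derivative_mult) auto
  have "Ck_on k f UNIV" "Ck_on k g UNIV" using Suc.prems Ck_on_SucD by blast+
  then show ?case using Suc by (auto simp: eq intro!: Ck_on_add differentiable_mult)
qed

lemma Ck_on_const: "Ck_on k (\<lambda>x. c) UNIV"
  by (induction k arbitrary: c) auto

lemma frechet_derivative_affine:
  fixes f :: "'a::euclidean_space \<Rightarrow> real"
  assumes "f differentiable (at (a + c *\<^sub>R x))"
  shows "(\<lambda>x. f (a + c *\<^sub>R x)) differentiable (at x)"
    and "frechet_derivative (\<lambda>x. f (a + c *\<^sub>R x)) (at x) b = c * frechet_derivative f (at (a + c *\<^sub>R x)) b"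
proof -
  let ?f' = "frechet_derivative f (at (a + c *\<^sub>R x))"
  have f': "(f has_derivative ?f') (at (a + c *\<^sub>R x))"
    using assms by (simp add: frechet_derivative_works[symmetric])
  have "((\<lambda>x. f (a + c *\<^sub>R x)) has_derivative (\<lambda>h. ?f' (c *\<^sub>R h))) (at x)"
    by (rule has_derivative_compose[where f="\<lambda>x. a + c *\<^sub>R x", OF _ f']) (auto intro!: derivative_eq_intros)
  moreover have "?f' (c *\<^sub>R h) = c * ?f' h" for h
    using linear_cmul[OF has_derivative_linear[OF f']] by simp
  ultimately have h: "((\<lambda>x. f (a + c *\<^sub>R x)) has_derivative (\<lambda>h. c * ?f' h)) (at x)" by simp
  then show "(\<lambda>x. f (a + c *\<^sub>R x)) differentiable (at x)" by (auto simp: differentiable_def)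
  show "frechet_derivative (\<lambda>x. f (a + c *\<^sub>R x)) (at x) b = c * ?f' b"
    using frechet_derivative_at[OF h, symmetric] by simp
qed

lemma Ck_on_affine: "Ck_on k f UNIV \<Longrightarrow> Ck_on k (\<lambda>x. f (a + c *\<^sub>R x)) UNIV"
proof (induction k arbitrary: f)
  case 0 then show ?case
    by (auto intro!: continuous_on_compose2[of UNIV f] continuous_intros)
next
  case (Suc k)
  then show ?case
    by (auto simp: frechet_derivative_affine intro!: Ck_on_mult Ck_on_const Suc.IH)
qed

text \<open>Test functions are smooth on the whole space, and the calculus of \<open>Ck_on\<close> above is only for that case.\<close>

definition smooth :: "('a::euclidean_space \<Rightarrow> real) \<Rightarrow> bool"
  where "smooth f \<longleftrightarrow> (\<forall>k. Ck_on k f UNIV)"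

lemma smooth_continuous: "smooth f \<Longrightarrow> continuous_on UNIV f"
  unfolding smooth_def using Ck_on.simps(1) by blast

lemma smooth_differentiable: "smooth f \<Longrightarrow> f differentiable (at x)"
  unfolding smooth_def using Ck_on.simps(2) by blast

lemma smooth_derivative_continuous: "smooth f \<Longrightarrow> b \<in> Basis \<Longrightarrow> continuous_on UNIV (\<lambda>x. frechet_derivative f (at x) b)"
  unfolding smooth_def using Ck_on.simps by blast

lemma differentiable_imp_directional:
  fixes f :: "'a::euclidean_space \<Rightarrow> real"
  assumes "f differentiable (at (x + t *\<^sub>R b))"
  shows "((\<lambda>s. f (x + s *\<^sub>R b)) has_real_derivative frechet_derivative f (at (x + t *\<^sub>R b)) b) (at t)"
proof -
  let ?f' = "frechet_derivative f (at (x + t *\<^sub>R b))"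
  have f': "(f has_derivative ?f') (at (x + t *\<^sub>R b))"
    using assms by (simp add: frechet_derivative_works[symmetric])
  have "((\<lambda>s. f (x + s *\<^sub>R b)) has_derivative (\<lambda>h. ?f' (h *\<^sub>R b))) (at t)"
    by (rule has_derivative_compose[where f="\<lambda>s. x + s *\<^sub>R b", OF _ f']) (auto intro!: derivative_eq_intros)
  moreover have "?f' (h *\<^sub>R b) = ?f' b * h" for h
    using linear_cmul[OF has_derivative_linear[OF f']] by simp
  ultimately show ?thesis by (simp add: has_field_derivative_def)
qed

lemma derivative_zero_outside:
  fixes f :: "'a::euclidean_space \<Rightarrow> real"
  assumes "closed K" "\<And>x. x \<notin> K \<Longrightarrow> f x = 0" "x \<notin> K"
  shows "frechet_derivative f (at x) b = 0"
proof -
  have "open (- K)" using assms(1) by auto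
  have "(f has_derivative (\<lambda>h. 0)) (at x)"
    by (rule has_derivative_transform_within_open[OF has_derivative_const[of 0] \<open>open (- K)\<close>]) (use assms in auto)
  from frechet_derivative_at[OF this, symmetric] show ?thesis by simp
qed

lemma continuous_compact_support_bounded:
  fixes f :: "'a::euclidean_space \<Rightarrow> real"
  assumes "continuous_on UNIV f" "compact K" "\<And>x. x \<notin> K \<Longrightarrow> f x = 0"
  obtains C where "C \<ge> 0" "\<And>x. \<bar>f x\<bar> \<le> C"
proof -
  have "compact (f ` K)" using assms by (meson compact_continuous_image continuous_on_subset subset_UNIV)
  then obtain C where C: "\<And>x. x \<in> K \<Longrightarrow> \<bar>f x\<bar> \<le> C"
    using compact_imp_bounded bounded_iff by (metis imageI real_norm_def)
  show thesis
  proof (rule that[of "max C 0"])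
    fix x show "\<bar>f x\<bar> \<le> max C 0" using C[of x] assms(3)[of x] by (cases "x \<in> K") auto
  qed simp
qed

lemma continuous_compact_support_integrable:
  fixes f :: "'a::euclidean_space \<Rightarrow> real"
  assumes "continuous_on UNIV f" "compact K" "\<And>x. x \<notin> K \<Longrightarrow> f x = 0"
  shows "integrable lborel f"
proof -
  have "integrable lborel (\<lambda>x. indicator K x *\<^sub>R f x)"
    by (rule borel_integrable_compact[OF assms(2)]) (use assms(1) continuous_on_subset in blast)
  moreover have "(\<lambda>x. indicator K x *\<^sub>R f x) = f" by (rule ext) (use assms(3) in \<open>auto simp: indicator_def\<close>)
  ultimately show ?thesis by (simp only:)
qed

text \<open>Any test function \<open>\<phi>\<close> that is not identically zero supplies mollifiers: \<open>\<phi>\<^sup>2\<close>, recentred at a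
point where \<open>\<phi>\<close> does not vanish and contracted by a large factor, is smooth, nonnegative, has positive
integral and support in a small ball.\<close>

lemma ex_mollifier:
  fixes \<phi> :: "'a::euclidean_space \<Rightarrow> real"
  assumes sm: "smooth \<phi>" and K: "compact K" "\<And>x. x \<notin> K \<Longrightarrow> \<phi> x = 0" and nz: "\<phi> x0 \<noteq> 0" and r: "r > 0"
  obtains \<rho> :: "'a \<Rightarrow> real" where "smooth \<rho>" "\<And>y. \<rho> y \<ge> 0" "\<And>y. \<rho> y \<noteq> 0 \<Longrightarrow> norm y \<le> r" "integrable lborel \<rho>" "(\<integral>y. \<rho> y \<partial>lborel) = 1"
proof -
  obtain B where B: "B > 0" "\<And>x. x \<in> K \<Longrightarrow> norm x \<le> B"
    using compact_imp_bounded[OF K(1)] bounded_pos by blast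
  define n where "n = (norm x0 + B) / r"
  have n: "n > 0" using B r by (auto simp: n_def intro!: divide_pos_pos add_nonneg_pos)
  define \<psi> where "\<psi> y = \<phi> (x0 + n *\<^sub>R y) * \<phi> (x0 + n *\<^sub>R y)" for y
  have sm\<psi>: "smooth \<psi>"
    unfolding smooth_def
  proof
    fix k
    have "Ck_on k \<phi> UNIV" using sm by (simp add: smooth_def)
    then have a: "Ck_on k (\<lambda>y. \<phi> (x0 + n *\<^sub>R y)) UNIV" by (rule Ck_on_affine)
    show "Ck_on k \<psi> UNIV" unfolding \<psi>_def by (rule Ck_on_mult[OF a a])
  qed
  have supp: "norm y \<le> r" if "\<psi> y \<noteq> 0" for y
  proof -
    have "x0 + n *\<^sub>R y \<in> K" using that K(2) by (auto simp: \<psi>_def)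
    then have "norm (x0 + n *\<^sub>R y) \<le> B" by (rule B)
    then have "norm (n *\<^sub>R y) \<le> norm x0 + B"
      using norm_triangle_ineq4[of "x0 + n *\<^sub>R y" x0] by simp
    then have "n * norm y \<le> norm x0 + B" using n by simp
    then have "n * norm y \<le> n * r" using r by (simp add: n_def)
    then show ?thesis using n by simp
  qed
  have i: "integrable lborel \<psi>"
    by (rule continuous_compact_support_integrable[of _ "cball 0 r"]) (use smooth_continuous[OF sm\<psi>] supp in \<open>auto simp: dist_norm\<close>)
  have [measurable]: "\<psi> \<in> borel_measurable borel" using i by auto
  have pos: "(\<integral>y. \<psi> y \<partial>lborel) > 0"
  proof (rule ccontr)
    assume "\<not> ?thesis"
    moreover have "(\<integral>y. \<psi> y \<partial>lborel) \<ge> 0" by (rule integral_nonneg_AE) (simp add: \<psi>_def)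
    ultimately have "(\<integral>y. \<psi> y \<partial>lborel) = 0" by simp
    then have ae: "AE y in lborel. \<psi> y = 0"
      using i by (subst (asm) integral_nonneg_eq_0_iff_AE) (auto simp: \<psi>_def)
    have "open {y. \<psi> y \<noteq> 0}"
      using smooth_continuous[OF sm\<psi>] by (intro open_Collect_neq) auto
    moreover have "0 \<in> {y. \<psi> y \<noteq> 0}" using nz by (simp add: \<psi>_def)
    ultimately obtain d where d: "d > 0" "ball 0 d \<subseteq> {y. \<psi> y \<noteq> 0}"
      by (auto simp: open_contains_ball)
    have "AE y in lborel. y \<notin> ball (0::'a) d" using ae by eventually_elim (use d in auto)
    then have "emeasure lborel (ball (0::'a) d) = 0"
      by (subst (asm) AE_iff_measurable[of "ball 0 d"]) auto
    then have "emeasure lebesgue (ball (0::'a) d) = 0" by simp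
    moreover have "\<not> negligible (ball (0::'a) d)" using d(1) by (intro open_not_negligible) auto
    ultimately show False by (simp add: negligible_iff_emeasure0)
  qed
  show thesis
  proof (rule that[of "\<lambda>y. inverse (\<integral>y. \<psi> y \<partial>lborel) * \<psi> y"])
    show "smooth (\<lambda>y. inverse (\<integral>y. \<psi> y \<partial>lborel) * \<psi> y)"
      using sm\<psi> by (auto simp: smooth_def intro: Ck_on_mult Ck_on_const)
    show "inverse (\<integral>y. \<psi> y \<partial>lborel) * \<psi> y \<ge> 0" for y using pos by (auto simp: \<psi>_def)
  qed (use supp i pos in auto)
qed

section \<open>The chain rule for weak gradients\<close>

definition mollify :: "('a::euclidean_space \<Rightarrow> real) \<Rightarrow> ('a \<Rightarrow> real) \<Rightarrow> 'a \<Rightarrow> real"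
  where "mollify \<rho> U x = (\<integral>z. U z * \<rho> (x - z) \<partial>lborel)"

lemma abs_mult_le_bound: "\<bar>b\<bar> \<le> C \<Longrightarrow> \<bar>a * b\<bar> \<le> C * \<bar>a::real\<bar>"
  by (metis abs_ge_zero abs_mult mult.commute mult_left_mono)

lemma mollify_measurable:
  assumes [measurable]: "U \<in> borel_measurable borel" "\<rho> \<in> borel_measurable borel"
  shows "mollify \<rho> U \<in> borel_measurable borel"
  unfolding mollify_def[abs_def] by measurable

lemma mollify_integrand_integrable:
  fixes U \<rho> :: "'a::euclidean_space \<Rightarrow> real"
  assumes U: "integrable lborel U" and [measurable]: "\<rho> \<in> borel_measurable borel" and C: "\<And>y. \<bar>\<rho> y\<bar> \<le> C"
  shows "integrable lborel (\<lambda>z. U z * \<rho> (x - z))"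
proof (rule Bochner_Integration.integrable_bound[where f="\<lambda>z. C * U z"])
  have [measurable]: "U \<in> borel_measurable borel" using U by auto
  show "(\<lambda>z. U z * \<rho> (x - z)) \<in> borel_measurable lborel" by measurable
  have "C \<ge> 0" using C[of 0] by linarith
  then have "C * \<bar>U z\<bar> = \<bar>C * U z\<bar>" for z by (simp add: abs_mult)
  then show "AE z in lborel. norm (U z * \<rho> (x - z)) \<le> norm (C * U z)"
    using abs_mult_le_bound[OF C, of "U _"] by (metis (no_types, lifting) AE_I2 real_norm_def)
qed (use U in auto)

lemma mollify_bound:
  fixes U \<rho> :: "'a::euclidean_space \<Rightarrow> real"
  assumes U: "integrable lborel U" and [measurable]: "\<rho> \<in> borel_measurable borel" and C: "\<And>y. \<bar>\<rho> y\<bar> \<le> C"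
  shows "\<bar>mollify \<rho> U x\<bar> \<le> C * (\<integral>z. \<bar>U z\<bar> \<partial>lborel)"
proof -
  have "\<bar>mollify \<rho> U x\<bar> \<le> (\<integral>z. \<bar>U z * \<rho> (x - z)\<bar> \<partial>lborel)"
    unfolding mollify_def by (rule integral_abs_bound)
  also have "\<dots> \<le> (\<integral>z. C * \<bar>U z\<bar> \<partial>lborel)"
    using U C by (intro integral_mono integrable_abs mollify_integrand_integrable abs_mult_le_bound) auto
  finally show ?thesis by simp
qed

text \<open>The defining form moves the variable into the kernel, where it can be differentiated; this form moves it
into the function, where continuity of translations applies.\<close>

lemma mollify_alt:
  fixes U \<rho> :: "'a::euclidean_space \<Rightarrow> real"
  assumes [measurable]: "U \<in> borel_measurable borel" "\<rho> \<in> borel_measurable borel"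
  shows "mollify \<rho> U x = (\<integral>y. U (x - y) * \<rho> y \<partial>lborel)"
  unfolding mollify_def by (subst integral_lborel_reflect[symmetric, where x=x]) auto

text \<open>Since the kernel is a probability density, the error is an average over \<open>y\<close> of the \<open>L^1\<close> distances
between \<open>U\<close> and its translates by \<open>y\<close> (Fubini).\<close>

lemma mollify_L1:
  fixes U \<rho> :: "'a::euclidean_space \<Rightarrow> real"
  assumes U: "integrable lborel U" and \<rho>: "integrable lborel \<rho>" and C: "\<And>y. \<bar>\<rho> y\<bar> \<le> C"
    and nn: "\<And>y. \<rho> y \<ge> 0" and one: "(\<integral>y. \<rho> y \<partial>lborel) = 1"
    and e: "\<And>y. \<rho> y \<noteq> 0 \<Longrightarrow> (\<integral>x. \<bar>U (x - y) - U x\<bar> \<partial>lborel) \<le> e" "e \<ge> 0"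
  shows "integrable lborel (mollify \<rho> U)" "(\<integral>x. \<bar>mollify \<rho> U x - U x\<bar> \<partial>lborel) \<le> e"
proof -
  have [measurable]: "U \<in> borel_measurable borel" "\<rho> \<in> borel_measurable borel" using U \<rho> by auto
  have [measurable]: "mollify \<rho> U \<in> borel_measurable borel" by (rule mollify_measurable) auto
  have i: "integrable lborel (\<lambda>y. U (x - y) * \<rho> y)" for x
  proof -
    have "integrable (distr lborel borel (\<lambda>y. x - y)) (\<lambda>z. U z * \<rho> (x - z))"
      unfolding lborel_distr_reflect by (rule mollify_integrand_integrable[OF U _ C]) auto
    then show ?thesis by (subst (asm) integrable_distr_eq) auto
  qed
  have iy: "integrable lborel (\<lambda>x. U (x - y) - U x)" for y
    using U by (intro Bochner_Integration.integrable_diff) (simp_all add: integrable_lborel_shift)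
  have pt: "ennreal \<bar>mollify \<rho> U x - U x\<bar> \<le> (\<integral>\<^sup>+y. ennreal (\<bar>U (x - y) - U x\<bar> * \<rho> y) \<partial>lborel)" for x
  proof -
    have "mollify \<rho> U x - U x = (\<integral>y. U (x - y) * \<rho> y \<partial>lborel) - (\<integral>y. U x * \<rho> y \<partial>lborel)"
      using one by (simp add: mollify_alt)
    also have "\<dots> = (\<integral>y. (U (x - y) - U x) * \<rho> y \<partial>lborel)"
      using i \<rho> by (subst Bochner_Integration.integral_diff[symmetric]) (auto simp: left_diff_distrib)
    finally have eq: "mollify \<rho> U x - U x = (\<integral>y. (U (x - y) - U x) * \<rho> y \<partial>lborel)" .
    have "integrable lborel (\<lambda>y. (U (x - y) - U x) * \<rho> y)"
      using i \<rho> by (simp add: left_diff_distrib)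
    then have ia: "integrable lborel (\<lambda>y. \<bar>U (x - y) - U x\<bar> * \<rho> y)"
      using integrable_abs[of lborel "\<lambda>y. (U (x - y) - U x) * \<rho> y"] nn by (simp add: abs_mult)
    have "\<bar>mollify \<rho> U x - U x\<bar> \<le> (\<integral>y. \<bar>(U (x - y) - U x) * \<rho> y\<bar> \<partial>lborel)"
      unfolding eq by (rule integral_abs_bound)
    also have "\<dots> = (\<integral>y. \<bar>U (x - y) - U x\<bar> * \<rho> y \<partial>lborel)" using nn by (simp add: abs_mult)
    finally have "ennreal \<bar>mollify \<rho> U x - U x\<bar> \<le> ennreal (\<integral>y. \<bar>U (x - y) - U x\<bar> * \<rho> y \<partial>lborel)"
      by (rule ennreal_leI)
    also have "\<dots> = (\<integral>\<^sup>+y. ennreal (\<bar>U (x - y) - U x\<bar> * \<rho> y) \<partial>lborel)"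
      using ia nn by (intro nn_integral_eq_integral[symmetric]) auto
    finally show ?thesis .
  qed
  have "(\<integral>\<^sup>+x. ennreal \<bar>mollify \<rho> U x - U x\<bar> \<partial>lborel) \<le>
      (\<integral>\<^sup>+x. (\<integral>\<^sup>+y. ennreal (\<bar>U (x - y) - U x\<bar> * \<rho> y) \<partial>lborel) \<partial>lborel)"
    by (intro nn_integral_mono pt)
  also have "\<dots> = (\<integral>\<^sup>+y. (\<integral>\<^sup>+x. ennreal (\<bar>U (x - y) - U x\<bar> * \<rho> y) \<partial>lborel) \<partial>lborel)"
    by (rule lborel_pair.Fubini'[symmetric]) measurable
  also have "\<dots> \<le> (\<integral>\<^sup>+y. ennreal (e * \<rho> y) \<partial>lborel)"
  proof (rule nn_integral_mono)
    fix y
    have "(\<integral>\<^sup>+x. ennreal (\<bar>U (x - y) - U x\<bar> * \<rho> y) \<partial>lborel) = ennreal (\<integral>x. \<bar>U (x - y) - U x\<bar> * \<rho> y \<partial>lborel)"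
      using iy nn by (intro nn_integral_eq_integral) auto
    also have "\<dots> \<le> ennreal (e * \<rho> y)"
      using e(1)[of y] nn[of y] by (cases "\<rho> y = 0") (auto intro!: ennreal_leI mult_right_mono)
    finally show "(\<integral>\<^sup>+x. ennreal (\<bar>U (x - y) - U x\<bar> * \<rho> y) \<partial>lborel) \<le> ennreal (e * \<rho> y)" .
  qed
  also have "\<dots> = ennreal (\<integral>y. e * \<rho> y \<partial>lborel)"
    using \<rho> nn e(2) by (intro nn_integral_eq_integral) auto
  also have "\<dots> = ennreal e" using one by simp
  finally have le: "(\<integral>\<^sup>+x. ennreal \<bar>mollify \<rho> U x - U x\<bar> \<partial>lborel) \<le> ennreal e" .
  have id: "integrable lborel (\<lambda>x. mollify \<rho> U x - U x)"
    by (rule integrableI_bounded) (use le in \<open>auto simp: le_less_trans\<close>)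
  from Bochner_Integration.integrable_add[OF id U] show "integrable lborel (mollify \<rho> U)" by simp
  have "ennreal (\<integral>x. \<bar>mollify \<rho> U x - U x\<bar> \<partial>lborel) \<le> ennreal e"
    using le id by (subst nn_integral_eq_integral[symmetric]) auto
  then show "(\<integral>x. \<bar>mollify \<rho> U x - U x\<bar> \<partial>lborel) \<le> e" using e(2) by (simp add: ennreal_le_iff)
qed

text \<open>Integration by parts in the only form that is used: the difference quotients of \<open>\<Psi>\<close> have integral zero
by translation invariance, and they converge boundedly to \<open>Q\<close>.\<close>

lemma integral_directional_derivative_zero:
  fixes \<Psi> Q :: "'a::euclidean_space \<Rightarrow> real"
  assumes int: "integrable lborel \<Psi>" and b: "norm b = 1"
    and D: "\<And>x t. ((\<lambda>s. \<Psi> (x + s *\<^sub>R b)) has_real_derivative Q (x + t *\<^sub>R b)) (at t)"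
    and supp: "\<And>x. Q x \<noteq> 0 \<Longrightarrow> norm x \<le> R" and C: "\<And>x. \<bar>Q x\<bar> \<le> C"
  shows "(\<integral>x. Q x \<partial>lborel) = 0"
proof -
  define h where "h n = 1 / real (Suc n)" for n
  have h: "h n > 0" "h n \<le> 1" for n by (auto simp: h_def field_simps)
  have h0: "h \<longlonglongrightarrow> 0" unfolding h_def[abs_def] using LIMSEQ_inverse_real_of_nat by (simp add: inverse_eq_divide)
  define d where "d n x = (\<Psi> (x + h n *\<^sub>R b) - \<Psi> x) / h n" for n x
  have [measurable]: "\<Psi> \<in> borel_measurable borel" using int by auto
  have dm [measurable]: "d n \<in> borel_measurable borel" for n unfolding d_def[abs_def] by measurable
  have lim: "(\<lambda>n. d n x) \<longlonglongrightarrow> Q x" for x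
  proof -
    have "((\<lambda>k. (\<Psi> (x + (0 + k) *\<^sub>R b) - \<Psi> (x + 0 *\<^sub>R b)) / k) \<longlongrightarrow> Q (x + 0 *\<^sub>R b)) (at 0)"
      using D[of x 0] unfolding DERIV_def .
    moreover have "filterlim h (at 0) sequentially"
      using h0 h(1) by (auto simp: filterlim_at less_imp_neq[symmetric] intro!: always_eventually)
    ultimately have "((\<lambda>n. (\<Psi> (x + (0 + h n) *\<^sub>R b) - \<Psi> (x + 0 *\<^sub>R b)) / h n) \<longlongrightarrow> Q (x + 0 *\<^sub>R b)) sequentially"
      by (rule filterlim_compose)
    then show ?thesis by (simp add: d_def)
  qed
  have Qm [measurable]: "Q \<in> borel_measurable borel"
    by (rule borel_measurable_LIMSEQ_real[of borel d]) (use lim in auto)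
  have bound: "\<bar>d n x\<bar> \<le> C * indicator (cball 0 (R + 1)) x" for n x
  proof -
    obtain \<xi> where \<xi>: "0 < \<xi>" "\<xi> < h n" "\<Psi> (x + h n *\<^sub>R b) - \<Psi> (x + 0 *\<^sub>R b) = (h n - 0) * Q (x + \<xi> *\<^sub>R b)"
      using MVT2[of 0 "h n" "\<lambda>s. \<Psi> (x + s *\<^sub>R b)" "\<lambda>t. Q (x + t *\<^sub>R b)"] D h by blast
    then have eq: "d n x = Q (x + \<xi> *\<^sub>R b)" using h(1)[of n] by (simp add: d_def)
    show ?thesis
    proof (cases "Q (x + \<xi> *\<^sub>R b) = 0")
      case True
      then show ?thesis using C[of 0] eq by (auto simp: indicator_def)
    next
      case False
      from supp[OF this] have "norm (x + \<xi> *\<^sub>R b) \<le> R" .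
      then have "norm x \<le> R + norm (\<xi> *\<^sub>R b)" using norm_triangle_ineq4[of "x + \<xi> *\<^sub>R b" "\<xi> *\<^sub>R b"] by simp
      also have "norm (\<xi> *\<^sub>R b) \<le> 1" using \<xi> h(2)[of n] b by simp
      finally show ?thesis using C eq by (auto simp: indicator_def)
    qed
  qed
  have "(\<lambda>n. \<integral>x. d n x \<partial>lborel) \<longlonglongrightarrow> (\<integral>x. Q x \<partial>lborel)"
  proof (rule integral_dominated_convergence[where w="\<lambda>x. C * indicator (cball 0 (R + 1)) x"])
    show "integrable lborel (\<lambda>x. C * indicat_real (cball 0 (R + 1)) (x::'a))"
      using emeasure_lborel_cball_finite[of "0::'a" "R+1"]
      by (intro integrable_mult_right integrable_real_indicator) (auto simp: less_top)
  qed (use lim bound in auto)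
  moreover have "(\<integral>x. d n x \<partial>lborel) = 0" for n
  proof -
    have i: "integrable lborel (\<lambda>x. \<Psi> (x - (- (h n *\<^sub>R b))))" using int by (subst integrable_lborel_shift)
    have "(\<integral>x. d n x \<partial>lborel) = ((\<integral>x. \<Psi> (x - (- (h n *\<^sub>R b))) \<partial>lborel) - (\<integral>x. \<Psi> x \<partial>lborel)) / h n"
      using i int by (simp add: d_def)
    also have "(\<integral>x. \<Psi> (x - (- (h n *\<^sub>R b))) \<partial>lborel) = (\<integral>x. \<Psi> x \<partial>lborel)"
      by (rule integral_lborel_shift) simp
    finally show ?thesis by simp
  qed
  ultimately show ?thesis by (simp add: LIMSEQ_const_iff)
qed

lemma mollify_directional_derivative:
  fixes U \<rho> :: "'a::euclidean_space \<Rightarrow> real"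
  assumes U: "integrable lborel U" and sm: "smooth \<rho>" and b: "b \<in> Basis"
    and C: "\<And>y. \<bar>\<rho> y\<bar> \<le> C" "\<And>y. \<bar>frechet_derivative \<rho> (at y) b\<bar> \<le> C"
  shows "((\<lambda>s. mollify \<rho> U (x + s *\<^sub>R b)) has_real_derivative
    mollify (\<lambda>y. frechet_derivative \<rho> (at y) b) U (x + t *\<^sub>R b)) (at t)"
proof -
  let ?d = "\<lambda>y. frechet_derivative \<rho> (at y) b"
  have [measurable]: "\<rho> \<in> borel_measurable borel" "?d \<in> borel_measurable borel" "U \<in> borel_measurable borel"
    using smooth_continuous[OF sm] smooth_derivative_continuous[OF sm b] U
    by (auto intro: borel_measurable_continuous_onI)
  have dir: "((\<lambda>s. \<rho> (y + s *\<^sub>R b)) has_real_derivative ?d (y + t *\<^sub>R b)) (at t)" for y t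
    by (rule differentiable_imp_directional) (rule smooth_differentiable[OF sm])
  have i: "integrable lborel (\<lambda>z. U z * \<rho> (y - z))" for y
    by (rule mollify_integrand_integrable[OF U _ C(1)]) auto
  show ?thesis
    unfolding DERIV_def LIMSEQ_SEQ_conv[symmetric]
  proof (intro allI impI, elim conjE)
    fix h :: "nat \<Rightarrow> real" assume h: "\<forall>n. h n \<noteq> 0" "h \<longlonglongrightarrow> 0"
    let ?x = "x + t *\<^sub>R b"
    have "(\<lambda>n. \<integral>z. U z * ((\<rho> (?x - z + h n *\<^sub>R b) - \<rho> (?x - z)) / h n) \<partial>lborel) \<longlonglongrightarrow> (\<integral>z. U z * ?d (?x - z) \<partial>lborel)"
    proof (rule integral_dominated_convergence[where w="\<lambda>z. C * \<bar>U z\<bar>"])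
      show "AE z in lborel. (\<lambda>n. U z * ((\<rho> (?x - z + h n *\<^sub>R b) - \<rho> (?x - z)) / h n)) \<longlonglongrightarrow> U z * ?d (?x - z)"
      proof (rule AE_I2)
        fix z
        have "((\<lambda>k. (\<rho> (?x - z + (0 + k) *\<^sub>R b) - \<rho> (?x - z + 0 *\<^sub>R b)) / k) \<longlongrightarrow> ?d (?x - z + 0 *\<^sub>R b)) (at 0)"
          using dir[of "?x - z" 0] unfolding DERIV_def .
        moreover have "filterlim h (at 0) sequentially"
          using h by (auto simp: filterlim_at intro!: always_eventually)
        ultimately have "((\<lambda>n. (\<rho> (?x - z + (0 + h n) *\<^sub>R b) - \<rho> (?x - z + 0 *\<^sub>R b)) / h n) \<longlongrightarrow> ?d (?x - z + 0 *\<^sub>R b)) sequentially"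
          by (rule filterlim_compose)
        then have "(\<lambda>n. (\<rho> (?x - z + h n *\<^sub>R b) - \<rho> (?x - z)) / h n) \<longlonglongrightarrow> ?d (?x - z)" by simp
        then show "(\<lambda>n. U z * ((\<rho> (?x - z + h n *\<^sub>R b) - \<rho> (?x - z)) / h n)) \<longlonglongrightarrow> U z * ?d (?x - z)"
          by (rule tendsto_mult_left)
      qed
      have lip: "\<bar>(\<rho> (y + s *\<^sub>R b) - \<rho> y) / s\<bar> \<le> C" if s: "s \<noteq> 0" for y s
      proof -
        have "norm (\<rho> (y + s *\<^sub>R b) - \<rho> (y + 0 *\<^sub>R b)) \<le> C * norm (s - 0)"
        proof (rule field_differentiable_bound[where S=UNIV and f="\<lambda>s. \<rho> (y + s *\<^sub>R b)" and f'="\<lambda>t. ?d (y + t *\<^sub>R b)"])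
          show "((\<lambda>s. \<rho> (y + s *\<^sub>R b)) has_field_derivative ?d (y + z *\<^sub>R b)) (at z within UNIV)" for z
            using dir by simp
        qed (use C in auto)
        then show ?thesis using s by (simp add: abs_divide divide_le_eq)
      qed
      show "AE z in lborel. norm (U z * ((\<rho> (?x - z + h n *\<^sub>R b) - \<rho> (?x - z)) / h n)) \<le> C * \<bar>U z\<bar>" for n
      proof (rule AE_I2)
        fix z
        have "\<bar>U z\<bar> * \<bar>(\<rho> (?x - z + h n *\<^sub>R b) - \<rho> (?x - z)) / h n\<bar> \<le> \<bar>U z\<bar> * C"
          by (rule mult_left_mono[OF lip]) (use h in auto)
        then show "norm (U z * ((\<rho> (?x - z + h n *\<^sub>R b) - \<rho> (?x - z)) / h n)) \<le> C * \<bar>U z\<bar>"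
          by (simp only: real_norm_def abs_mult mult.commute)
      qed
    qed (use U in auto)
    moreover have "(\<integral>z. U z * ((\<rho> (?x - z + h n *\<^sub>R b) - \<rho> (?x - z)) / h n) \<partial>lborel) =
       (mollify \<rho> U (x + (t + h n) *\<^sub>R b) - mollify \<rho> U ?x) / h n" for n
    proof -
      have "mollify \<rho> U (x + (t + h n) *\<^sub>R b) - mollify \<rho> U ?x =
        (\<integral>z. U z * \<rho> (x + (t + h n) *\<^sub>R b - z) - U z * \<rho> (?x - z) \<partial>lborel)"
        unfolding mollify_def by (rule Bochner_Integration.integral_diff[symmetric]) (rule i)+
      also have "\<dots> / h n = (\<integral>z. (U z * \<rho> (x + (t + h n) *\<^sub>R b - z) - U z * \<rho> (?x - z)) / h n \<partial>lborel)"
        by simp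
      also have "\<dots> = (\<integral>z. U z * ((\<rho> (?x - z + h n *\<^sub>R b) - \<rho> (?x - z)) / h n) \<partial>lborel)"
        by (rule Bochner_Integration.integral_cong) (auto simp: algebra_simps diff_divide_distrib)
      finally show ?thesis by (rule sym)
    qed
    ultimately show "(\<lambda>n. (mollify \<rho> U (x + (t + h n) *\<^sub>R b) - mollify \<rho> U ?x) / h n) \<longlonglongrightarrow> mollify ?d U ?x"
      by (simp only: mollify_def[of ?d])
  qed
qed

lemma test_functions_smooth: "\<phi> \<in> test_functions S \<Longrightarrow> smooth \<phi>"
  by (simp add: test_functions_def smooth_def)

lemma test_functions_support:
  "\<psi> \<in> test_functions S \<Longrightarrow> \<exists>K. compact K \<and> K \<subseteq> S \<and> (\<forall>x. x \<notin> K \<longrightarrow> \<psi> x = 0)"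
  by (simp add: test_functions_def)

lemma translation_modulus:
  fixes U :: "'a::euclidean_space \<Rightarrow> real"
  assumes U: "integrable lborel U" and e: "e > 0"
  shows "\<exists>d>0. \<forall>y. norm y \<le> d \<longrightarrow> (\<integral>x. \<bar>U (x - y) - U x\<bar> \<partial>lborel) \<le> e"
proof (rule ccontr)
  assume neg: "\<not> ?thesis"
  have "\<exists>y. norm y \<le> 1 / real (Suc n) \<and> (\<integral>x. \<bar>U (x - y) - U x\<bar> \<partial>lborel) > e" for n
    using neg by (auto simp: not_le dest: spec[of _ "1 / real (Suc n)"])
  then obtain y where y: "\<And>n. norm (y n) \<le> 1 / real (Suc n)"
      "\<And>n. (\<integral>x. \<bar>U (x - y n) - U x\<bar> \<partial>lborel) > e" by metis
  have "y \<longlonglongrightarrow> 0"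
  proof (rule Lim_null_comparison)
    show "(\<lambda>n. 1 / real (Suc n)) \<longlonglongrightarrow> 0"
      using LIMSEQ_inverse_real_of_nat by (simp add: inverse_eq_divide)
  qed (use y in auto)
  from L1_translation_continuous[OF U this] have "eventually (\<lambda>n. (\<integral>x. \<bar>U (x - y n) - U x\<bar> \<partial>lborel) < e) sequentially"
    using e by (rule order_tendstoD(2))
  then show False using y(2) by (auto simp: eventually_sequentially not_less[symmetric] dest: less_asym)
qed

text \<open>The classical proof by mollification.  Near the support of \<open>\<phi>\<close> the mollified functions \<open>Uk\<close> have
the mollified \<open>V\<close> as directional derivative, because translates of the kernel are test functions in \<open>S\<close>.
For \<open>Uk\<close> the chain rule is elementary; integrating the derivative of \<open>F(Uk) \<phi>\<close> gives zero, and
the identity passes to the limit: the term with \<open>F\<close> because \<open>F\<close> is Lipschitz, the term with \<open>F'\<close>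
because along a subsequence \<open>Uk\<close> converges almost everywhere and \<open>F'\<close> is bounded and continuous.\<close>

lemma chain_rule_core:
  fixes U V :: "'a::euclidean_space \<Rightarrow> real" and F F' :: "real \<Rightarrow> real"
  assumes S: "open S" and U: "integrable lborel U" and V: "integrable lborel V" and b: "b \<in> Basis"
    and weak: "\<And>\<psi>. \<psi> \<in> test_functions S \<Longrightarrow>
      (\<integral>x. U x * frechet_derivative \<psi> (at x) b \<partial>lborel) = - (\<integral>x. V x * \<psi> x \<partial>lborel)"
    and F: "\<And>t. (F has_real_derivative F' t) (at t)" and F': "continuous_on UNIV F'" and C: "\<And>t. \<bar>F' t\<bar> \<le> C"
    and \<phi>: "\<phi> \<in> test_functions S"
  shows "(\<integral>x. F (U x) * frechet_derivative \<phi> (at x) b \<partial>lborel) = - (\<integral>x. F' (U x) * V x * \<phi> x \<partial>lborel)"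
proof (cases "\<forall>x. \<phi> x = 0")
  case True
  then have "\<phi> = (\<lambda>x. 0)" by auto
  then show ?thesis by simp
next
  case False
  then obtain x0 where x0: "\<phi> x0 \<noteq> 0" by auto
  have sm\<phi>: "smooth \<phi>" by (rule test_functions_smooth[OF \<phi>])
  obtain K where K: "compact K" "K \<subseteq> S" "\<And>x. x \<notin> K \<Longrightarrow> \<phi> x = 0"
    using \<phi> by (auto simp: test_functions_def)
  obtain \<delta>0 where \<delta>0: "\<delta>0 > 0" "(\<Union>x\<in>K. ball x \<delta>0) \<subseteq> S"
    using compact_subset_open_imp_ball_epsilon_subset[OF K(1) S K(2)] by blast
  \<comment> \<open>half the distance, so that closed balls stay inside \<open>S\<close>\<close>
  define \<delta> where "\<delta> = \<delta>0 / 2"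
  have \<delta>: "\<delta> > 0" "\<And>x. x \<in> K \<Longrightarrow> cball x \<delta> \<subseteq> S"
    using \<delta>0 by (force simp: \<delta>_def)+
  let ?d\<phi> = "\<lambda>x. frechet_derivative \<phi> (at x) b"
  have d\<phi>0: "?d\<phi> x = 0" if "x \<notin> K" for x
    by (rule derivative_zero_outside[of K]) (use K that compact_imp_closed in auto)
  have Um [measurable]: "U \<in> borel_measurable borel" "V \<in> borel_measurable borel" using U V by auto
  have \<phi>m [measurable]: "\<phi> \<in> borel_measurable borel" "?d\<phi> \<in> borel_measurable borel"
    using smooth_continuous[OF sm\<phi>] smooth_derivative_continuous[OF sm\<phi> b] by (auto intro: borel_measurable_continuous_onI)
  have Fc: "continuous_on UNIV F" using F by (meson DERIV_isCont continuous_at_imp_continuous_on)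
  have Fm [measurable]: "F \<in> borel_measurable borel" "F' \<in> borel_measurable borel"
    using Fc F' by (auto intro: borel_measurable_continuous_onI)
  obtain c where c: "c \<ge> 0" "\<And>x. \<bar>\<phi> x\<bar> \<le> c"
    using continuous_compact_support_bounded[OF smooth_continuous[OF sm\<phi>] K(1)] K(3) by blast
  obtain c' where c': "c' \<ge> 0" "\<And>x. \<bar>?d\<phi> x\<bar> \<le> c'"
    using continuous_compact_support_bounded[OF smooth_derivative_continuous[OF sm\<phi> b] K(1)] d\<phi>0 by blast
  have i\<phi>: "integrable lborel \<phi>" "integrable lborel ?d\<phi>"
    using continuous_compact_support_integrable[OF smooth_continuous[OF sm\<phi>] K(1)] K(3)
      continuous_compact_support_integrable[OF smooth_derivative_continuous[OF sm\<phi> b] K(1)] d\<phi>0 by auto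
  obtain R where R: "\<And>x. x \<in> K \<Longrightarrow> norm x \<le> R"
    using compact_imp_bounded[OF K(1)] by (auto simp: bounded_iff)
  have C0: "C \<ge> 0" using C[of 0] by linarith
  have lip: "\<bar>F s - F t\<bar> \<le> C * \<bar>s - t\<bar>" for s t
    using field_differentiable_bound[where S=UNIV and f=F and f'=F' and B=C, OF convex_UNIV] F C by auto
  have Fb: "\<bar>F s\<bar> \<le> \<bar>F 0\<bar> + C * \<bar>s\<bar>" for s using lip[of s 0] by auto
  have "\<exists>\<rho>::'a \<Rightarrow> real. smooth \<rho> \<and> (\<forall>y. \<rho> y \<ge> 0) \<and> (\<forall>y. \<rho> y \<noteq> 0 \<longrightarrow> norm y \<le> min \<delta> (1 / real (Suc n))) \<and>
      integrable lborel \<rho> \<and> (\<integral>y. \<rho> y \<partial>lborel) = 1" for n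
  proof -
    have "min \<delta> (1 / real (Suc n)) > 0" using \<delta> by simp
    from ex_mollifier[OF sm\<phi> K(1,3) x0 this] show ?thesis by metis
  qed
  then obtain \<rho> :: "nat \<Rightarrow> 'a \<Rightarrow> real" where \<rho>: "\<And>n. smooth (\<rho> n)" "\<And>n y. \<rho> n y \<ge> 0"
      "\<And>n y. \<rho> n y \<noteq> 0 \<Longrightarrow> norm y \<le> min \<delta> (1 / real (Suc n))"
      "\<And>n. integrable lborel (\<rho> n)" "\<And>n. (\<integral>y. \<rho> n y \<partial>lborel) = 1" by metis
  let ?d = "\<lambda>n y. frechet_derivative (\<rho> n) (at y) b"
  have supp\<rho>: "\<rho> n y = 0" if "y \<notin> cball 0 \<delta>" for n y
    using \<rho>(3)[of n y] that by (auto simp: dist_norm)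
  have suppd: "(?d n y) = 0" if "y \<notin> cball 0 \<delta>" for n y
    by (rule derivative_zero_outside[of "cball 0 \<delta>"]) (use supp\<rho> that in auto)
  have \<rho>m [measurable]: "\<rho> n \<in> borel_measurable borel" "?d n \<in> borel_measurable borel" for n
    using smooth_continuous[OF \<rho>(1)] smooth_derivative_continuous[OF \<rho>(1) b] by (auto intro: borel_measurable_continuous_onI)
  have "\<exists>c\<ge>0. \<forall>y. \<bar>\<rho> n y\<bar> \<le> c \<and> \<bar>?d n y\<bar> \<le> c" for n
  proof -
    obtain c1 where c1: "c1 \<ge> 0" "\<And>y. \<bar>\<rho> n y\<bar> \<le> c1"
      using continuous_compact_support_bounded[OF smooth_continuous[OF \<rho>(1)] compact_cball[of 0 \<delta>]] supp\<rho> by blast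
    obtain c2 where c2: "c2 \<ge> 0" "\<And>y. \<bar>?d n y\<bar> \<le> c2"
      using continuous_compact_support_bounded[OF smooth_derivative_continuous[OF \<rho>(1) b] compact_cball[of 0 \<delta>]] suppd by blast
    show ?thesis using c1 c2 by (intro exI[of _ "max c1 c2"]) (auto simp: le_max_iff_disj)
  qed
  then obtain cr where cr: "\<And>n. cr n \<ge> 0" "\<And>n y. \<bar>\<rho> n y\<bar> \<le> cr n" "\<And>n y. \<bar>?d n y\<bar> \<le> cr n" by metis
  define Uk where "Uk n = mollify (\<rho> n) U" for n
  define Vk where "Vk n = mollify (\<rho> n) V" for n
  define Wk where "Wk n = mollify (?d n) U" for n
  have Ukm [measurable]: "Uk n \<in> borel_measurable borel" "Vk n \<in> borel_measurable borel" "Wk n \<in> borel_measurable borel" for n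
    unfolding Uk_def Vk_def Wk_def by (intro mollify_measurable; measurable)+
  \<comment> \<open>the translated kernel is a test function in \<open>S\<close>, so the weak gradient may be moved onto it\<close>
  have WV: "Wk n x = Vk n x" if x: "x \<in> K" for n x
  proof -
    define \<psi> where "\<psi> z = \<rho> n (x + (-1) *\<^sub>R z)" for z
    have "\<psi> \<in> test_functions S"
      unfolding test_functions_def
    proof (intro CollectI conjI allI exI[of _ "cball x \<delta>"] impI)
      show "Ck_on k \<psi> UNIV" for k
        using \<rho>(1)[of n] unfolding \<psi>_def[abs_def] smooth_def by (intro Ck_on_affine) auto
      show "cball x \<delta> \<subseteq> S" by (rule \<delta>(2)[OF x])
      fix z assume "z \<notin> cball x \<delta>"
      then show "\<psi> z = 0" using supp\<rho>[of "x - z" n] by (auto simp: \<psi>_def dist_norm norm_minus_commute)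
    qed auto
    from weak[OF this] have "(\<integral>z. U z * frechet_derivative \<psi> (at z) b \<partial>lborel) = - (\<integral>z. V z * \<psi> z \<partial>lborel)" .
    moreover have "frechet_derivative \<psi> (at z) b = - ?d n (x - z)" for z
      unfolding \<psi>_def[abs_def] by (subst frechet_derivative_affine(2)) (auto intro: smooth_differentiable[OF \<rho>(1)])
    ultimately show ?thesis by (simp add: Wk_def Vk_def mollify_def \<psi>_def)
  qed
  define Q where "Q n x = F' (Uk n x) * Wk n x * \<phi> x + F (Uk n x) * ?d\<phi> x" for n x
  define NU where "NU = (\<integral>z. \<bar>U z\<bar> \<partial>lborel)"
  define NV where "NV = (\<integral>z. \<bar>V z\<bar> \<partial>lborel)"
  have NU0: "NU \<ge> 0" "NV \<ge> 0" by (simp_all add: NU_def NV_def)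
  have bU: "\<bar>Uk n x\<bar> \<le> cr n * NU" "\<bar>Wk n x\<bar> \<le> cr n * NU" "\<bar>Vk n x\<bar> \<le> cr n * NV" for n x
    unfolding Uk_def Wk_def Vk_def NU_def NV_def using cr U V by (intro mollify_bound; auto)+
  have bF: "\<bar>F (Uk n x)\<bar> \<le> \<bar>F 0\<bar> + C * (cr n * NU)" for n x
    using Fb[of "Uk n x"] mult_left_mono[OF bU(1)[of n x] C0] by linarith
  have Q0: "(\<integral>x. Q n x \<partial>lborel) = 0" for n
  proof (rule integral_directional_derivative_zero[where \<Psi>="\<lambda>x. F (Uk n x) * \<phi> x" and b=b and R=R])
    show "integrable lborel (\<lambda>x. F (Uk n x) * \<phi> x)"
    proof (rule Bochner_Integration.integrable_bound[where f="\<lambda>x. (\<bar>F 0\<bar> + C * (cr n * NU)) * \<bar>\<phi> x\<bar>"])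
      show "AE x in lborel. norm (F (Uk n x) * \<phi> x) \<le> norm ((\<bar>F 0\<bar> + C * (cr n * NU)) * \<bar>\<phi> x\<bar>)"
      proof (rule AE_I2)
        fix x
        have "\<bar>F (Uk n x)\<bar> * \<bar>\<phi> x\<bar> \<le> (\<bar>F 0\<bar> + C * (cr n * NU)) * \<bar>\<phi> x\<bar>"
          by (intro mult_right_mono bF) auto
        moreover have "\<bar>F 0\<bar> + C * (cr n * NU) \<ge> 0" using C0 cr(1) NU0 by simp
        ultimately show "norm (F (Uk n x) * \<phi> x) \<le> norm ((\<bar>F 0\<bar> + C * (cr n * NU)) * \<bar>\<phi> x\<bar>)"
          by (simp add: abs_mult)
      qed
    qed (use i\<phi> in auto)
    show "norm b = 1" using b by simp
    show "((\<lambda>s. F (Uk n (x + s *\<^sub>R b)) * \<phi> (x + s *\<^sub>R b)) has_real_derivative Q n (x + t *\<^sub>R b)) (at t)" for x t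
    proof -
      have "((\<lambda>s. Uk n (x + s *\<^sub>R b)) has_real_derivative Wk n (x + t *\<^sub>R b)) (at t)"
        unfolding Uk_def Wk_def by (rule mollify_directional_derivative[OF U \<rho>(1) b cr(2,3)])
      from DERIV_chain2[OF F this]
      have 1: "((\<lambda>s. F (Uk n (x + s *\<^sub>R b))) has_real_derivative F' (Uk n (x + t *\<^sub>R b)) * Wk n (x + t *\<^sub>R b)) (at t)" .
      have 2: "((\<lambda>s. \<phi> (x + s *\<^sub>R b)) has_real_derivative ?d\<phi> (x + t *\<^sub>R b)) (at t)"
        by (rule differentiable_imp_directional) (rule smooth_differentiable[OF sm\<phi>])
      show ?thesis using DERIV_mult[OF 1 2] by (simp add: Q_def mult.commute add.commute)
    qed
    show "norm x \<le> R" if "Q n x \<noteq> 0" for x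
      using that K(3)[of x] d\<phi>0[of x] R[of x] by (cases "x \<in> K") (auto simp: Q_def)
    show "\<bar>Q n x\<bar> \<le> C * (cr n * NU) * c + (\<bar>F 0\<bar> + C * (cr n * NU)) * c'" for x
    proof -
      have "\<bar>Q n x\<bar> \<le> \<bar>F' (Uk n x)\<bar> * \<bar>Wk n x\<bar> * \<bar>\<phi> x\<bar> + \<bar>F (Uk n x)\<bar> * \<bar>?d\<phi> x\<bar>"
        unfolding Q_def by (metis abs_mult abs_triangle_ineq)
      also have "\<dots> \<le> C * (cr n * NU) * c + (\<bar>F 0\<bar> + C * (cr n * NU)) * c'"
        using C0 c c' bU bF C cr(1)[of n] NU0 by (intro add_mono mult_mono) auto
      finally show ?thesis .
    qed
  qed
  have L1: "(\<lambda>n. \<integral>x. \<bar>mollify (\<rho> n) f x - f x\<bar> \<partial>lborel) \<longlonglongrightarrow> 0" "integrable lborel (mollify (\<rho> m) f)"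
    if f: "integrable lborel f" for f m
  proof -
    show "integrable lborel (mollify (\<rho> m) f)"
    proof (rule mollify_L1(1)[OF f \<rho>(4) cr(2) \<rho>(2) \<rho>(5)])
      show "(\<integral>x. \<bar>f (x - y) - f x\<bar> \<partial>lborel) \<le> 2 * (\<integral>x. \<bar>f x\<bar> \<partial>lborel)" for y
      proof -
        have [measurable]: "f \<in> borel_measurable borel" using f by auto
        have iz: "integrable lborel (\<lambda>x. f (x - y))" using f by (simp add: integrable_lborel_shift)
        have "(\<integral>x. \<bar>f (x - y) - f x\<bar> \<partial>lborel) \<le> (\<integral>x. \<bar>f (x - y)\<bar> + \<bar>f x\<bar> \<partial>lborel)"
          using f iz by (intro integral_mono) auto
        also have "\<dots> = (\<integral>x. \<bar>f (x - y)\<bar> \<partial>lborel) + (\<integral>x. \<bar>f x\<bar> \<partial>lborel)" using f iz by simp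
        also have "(\<integral>x. \<bar>f (x - y)\<bar> \<partial>lborel) = (\<integral>x. \<bar>f x\<bar> \<partial>lborel)" by (rule integral_lborel_shift) simp
        finally show ?thesis by simp
      qed
    qed simp
    show "(\<lambda>n. \<integral>x. \<bar>mollify (\<rho> n) f x - f x\<bar> \<partial>lborel) \<longlonglongrightarrow> 0"
    proof (rule LIMSEQ_I)
      fix e :: real assume "e > 0"
      then have e2: "e/2 > 0" by simp
      obtain d where d: "d > 0" "\<And>y. norm y \<le> d \<Longrightarrow> (\<integral>x. \<bar>f (x - y) - f x\<bar> \<partial>lborel) \<le> e/2"
        using translation_modulus[OF f e2] by blast
      obtain N where N: "1 / real (Suc N) < d" using d(1) by (metis nat_approx_posE)
      have "(\<integral>x. \<bar>mollify (\<rho> n) f x - f x\<bar> \<partial>lborel) \<le> e/2" if "n \<ge> N" for n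
      proof (rule mollify_L1(2)[OF f \<rho>(4) cr(2) \<rho>(2) \<rho>(5)])
        fix y assume "\<rho> n y \<noteq> 0"
        from \<rho>(3)[OF this] have "norm y \<le> 1 / real (Suc n)" by simp
        also have "\<dots> \<le> 1 / real (Suc N)" using that by (intro divide_left_mono) auto
        also have "\<dots> \<le> d" using N by simp
        finally show "(\<integral>x. \<bar>f (x - y) - f x\<bar> \<partial>lborel) \<le> e/2" by (rule d)
      qed (use e2 in simp)
      then show "\<exists>no. \<forall>n\<ge>no. norm ((\<integral>x. \<bar>mollify (\<rho> n) f x - f x\<bar> \<partial>lborel) - 0) < e"
        using \<open>e > 0\<close> by (intro exI[of _ N]) force
    qed
  qed
  have iUk: "integrable lborel (Uk n)" "integrable lborel (Vk n)" for n
    unfolding Uk_def Vk_def using L1(2) U V by auto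
  have cU: "(\<lambda>n. \<integral>x. \<bar>Uk n x - U x\<bar> \<partial>lborel) \<longlonglongrightarrow> 0" and cV: "(\<lambda>n. \<integral>x. \<bar>Vk n x - V x\<bar> \<partial>lborel) \<longlonglongrightarrow> 0"
    unfolding Uk_def Vk_def using L1(1) U V by auto
  obtain r :: "nat \<Rightarrow> nat" where r: "strict_mono r" "AE x in lborel. (\<lambda>n. Uk (r n) x - U x) \<longlonglongrightarrow> 0"
    using tendsto_L1_AE_subseq[of lborel "\<lambda>n x. Uk n x - U x"] cU iUk U by auto
  have iFU: "integrable lborel (\<lambda>x. F (f x) * ?d\<phi> x)" if f: "integrable lborel f" for f
  proof (rule Bochner_Integration.integrable_bound[where f="\<lambda>x. \<bar>F 0\<bar> * \<bar>?d\<phi> x\<bar> + C * c' * \<bar>f x\<bar>"])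
    have [measurable]: "f \<in> borel_measurable borel" using f by auto
    show "(\<lambda>x. F (f x) * ?d\<phi> x) \<in> borel_measurable lborel" by measurable
    show "AE x in lborel. norm (F (f x) * ?d\<phi> x) \<le> norm (\<bar>F 0\<bar> * \<bar>?d\<phi> x\<bar> + C * c' * \<bar>f x\<bar>)"
    proof (rule AE_I2)
      fix x
      have "\<bar>F (f x) * ?d\<phi> x\<bar> \<le> (\<bar>F 0\<bar> + C * \<bar>f x\<bar>) * \<bar>?d\<phi> x\<bar>"
        unfolding abs_mult by (intro mult_right_mono Fb) auto
      also have "\<dots> \<le> \<bar>F 0\<bar> * \<bar>?d\<phi> x\<bar> + (C * \<bar>f x\<bar>) * c'"
        unfolding distrib_right using C0 c' by (intro add_left_mono mult_left_mono) auto
      also have "\<dots> \<le> norm (\<bar>F 0\<bar> * \<bar>?d\<phi> x\<bar> + C * c' * \<bar>f x\<bar>)" by (simp add: ac_simps)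
      finally show "norm (F (f x) * ?d\<phi> x) \<le> norm (\<bar>F 0\<bar> * \<bar>?d\<phi> x\<bar> + C * c' * \<bar>f x\<bar>)" by simp
    qed
  qed (use f i\<phi> in auto)
  have iFV: "integrable lborel (\<lambda>x. h x * f x * \<phi> x)"
    if f: "integrable lborel f" and [measurable]: "h \<in> borel_measurable borel" and h: "\<And>x. \<bar>h x\<bar> \<le> D" for f h D
  proof (rule Bochner_Integration.integrable_bound[where f="\<lambda>x. D * c * \<bar>f x\<bar>"])
    have [measurable]: "f \<in> borel_measurable borel" using f by auto
    show "(\<lambda>x. h x * f x * \<phi> x) \<in> borel_measurable lborel" by measurable
    have "\<bar>h x * f x * \<phi> x\<bar> \<le> D * \<bar>f x\<bar> * c" for x
      unfolding abs_mult using c h order_trans[OF abs_ge_zero h] by (intro mult_mono) auto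
    then show "AE x in lborel. norm (h x * f x * \<phi> x) \<le> norm (D * c * \<bar>f x\<bar>)"
      using order_trans[OF abs_ge_zero h] c(1) by (auto simp: ac_simps abs_mult)
  qed (use f in auto)
  have lim1: "(\<lambda>n. \<integral>x. F (Uk n x) * ?d\<phi> x \<partial>lborel) \<longlonglongrightarrow> (\<integral>x. F (U x) * ?d\<phi> x \<partial>lborel)"
  proof (rule LIM_zero_cancel, rule Lim_null_comparison)
    show "eventually (\<lambda>n. norm ((\<integral>x. F (Uk n x) * ?d\<phi> x \<partial>lborel) - (\<integral>x. F (U x) * ?d\<phi> x \<partial>lborel)) \<le>
        C * c' * (\<integral>x. \<bar>Uk n x - U x\<bar> \<partial>lborel)) sequentially"
    proof (rule always_eventually, rule allI)
      fix n
      have "(\<integral>x. F (Uk n x) * ?d\<phi> x \<partial>lborel) - (\<integral>x. F (U x) * ?d\<phi> x \<partial>lborel) =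
          (\<integral>x. F (Uk n x) * ?d\<phi> x - F (U x) * ?d\<phi> x \<partial>lborel)"
        using iFU[OF iUk(1)] iFU[OF U] by simp
      also have "norm \<dots> \<le> (\<integral>x. norm (F (Uk n x) * ?d\<phi> x - F (U x) * ?d\<phi> x) \<partial>lborel)"
        by (rule integral_norm_bound)
      also have "\<dots> \<le> (\<integral>x. C * c' * \<bar>Uk n x - U x\<bar> \<partial>lborel)"
      proof (rule integral_mono)
        fix x
        have "\<bar>F (Uk n x) * ?d\<phi> x - F (U x) * ?d\<phi> x\<bar> \<le> C * \<bar>Uk n x - U x\<bar> * c'"
          unfolding left_diff_distrib[symmetric] abs_mult using lip c' C0 by (intro mult_mono) auto
        then show "norm (F (Uk n x) * ?d\<phi> x - F (U x) * ?d\<phi> x) \<le> C * c' * \<bar>Uk n x - U x\<bar>"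
          by (simp add: ac_simps)
      qed (use iFU[OF iUk(1)] iFU[OF U] iUk U in auto)
      finally show "norm ((\<integral>x. F (Uk n x) * ?d\<phi> x \<partial>lborel) - (\<integral>x. F (U x) * ?d\<phi> x \<partial>lborel)) \<le>
        C * c' * (\<integral>x. \<bar>Uk n x - U x\<bar> \<partial>lborel)" by simp
    qed
    show "(\<lambda>n. C * c' * (\<integral>x. \<bar>Uk n x - U x\<bar> \<partial>lborel)) \<longlonglongrightarrow> 0"
      using tendsto_mult_left[OF cU, of "C * c'"] by simp
  qed
  have lim2: "(\<lambda>n. \<integral>x. F' (Uk (r n) x) * V x * \<phi> x \<partial>lborel) \<longlonglongrightarrow> (\<integral>x. F' (U x) * V x * \<phi> x \<partial>lborel)"
  proof (rule integral_dominated_convergence[where w="\<lambda>x. C * c * \<bar>V x\<bar>"])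
    show "AE x in lborel. (\<lambda>n. F' (Uk (r n) x) * V x * \<phi> x) \<longlonglongrightarrow> F' (U x) * V x * \<phi> x"
      using r(2)
    proof eventually_elim
      case (elim x)
      then have "(\<lambda>n. Uk (r n) x) \<longlonglongrightarrow> U x" by (rule LIM_zero_cancel)
      then have "(\<lambda>n. F' (Uk (r n) x)) \<longlonglongrightarrow> F' (U x)"
        using F' by (auto intro: continuous_on_tendsto_compose[of UNIV F'])
      then show ?case by (intro tendsto_intros)
    qed
    have "\<bar>F' (Uk (r n) x) * V x * \<phi> x\<bar> \<le> C * \<bar>V x\<bar> * c" for n x
      unfolding abs_mult using c C C0 by (intro mult_mono) auto
    then show "AE x in lborel. norm (F' (Uk (r n) x) * V x * \<phi> x) \<le> C * c * \<bar>V x\<bar>" for n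
      by (auto simp: ac_simps)
  qed (use V in auto)
  have lim3: "(\<lambda>n. \<integral>x. F' (Uk n x) * (Vk n x - V x) * \<phi> x \<partial>lborel) \<longlonglongrightarrow> 0"
  proof (rule Lim_null_comparison)
    show "(\<lambda>n. C * c * (\<integral>x. \<bar>Vk n x - V x\<bar> \<partial>lborel)) \<longlonglongrightarrow> 0"
      using tendsto_mult_left[OF cV, of "C * c"] by simp
    show "eventually (\<lambda>n. norm (\<integral>x. F' (Uk n x) * (Vk n x - V x) * \<phi> x \<partial>lborel) \<le> C * c * (\<integral>x. \<bar>Vk n x - V x\<bar> \<partial>lborel)) sequentially"
    proof (rule always_eventually, rule allI)
      fix n
      have "norm (\<integral>x. F' (Uk n x) * (Vk n x - V x) * \<phi> x \<partial>lborel) \<le> (\<integral>x. norm (F' (Uk n x) * (Vk n x - V x) * \<phi> x) \<partial>lborel)"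
        by (rule integral_norm_bound)
      also have "\<dots> \<le> (\<integral>x. C * c * \<bar>Vk n x - V x\<bar> \<partial>lborel)"
      proof (rule integral_mono)
        show "integrable lborel (\<lambda>x. norm (F' (Uk n x) * (Vk n x - V x) * \<phi> x))"
          using iFV[of "\<lambda>x. Vk n x - V x" "\<lambda>x. F' (Uk n x)" C] iUk V C by auto
        fix x
        have "\<bar>F' (Uk n x) * (Vk n x - V x) * \<phi> x\<bar> \<le> C * \<bar>Vk n x - V x\<bar> * c"
          unfolding abs_mult using c C C0 by (intro mult_mono) auto
        then show "norm (F' (Uk n x) * (Vk n x - V x) * \<phi> x) \<le> C * c * \<bar>Vk n x - V x\<bar>"
          by (simp add: ac_simps)
      qed (use iUk V in auto)
      finally show "norm (\<integral>x. F' (Uk n x) * (Vk n x - V x) * \<phi> x \<partial>lborel) \<le> C * c * (\<integral>x. \<bar>Vk n x - V x\<bar> \<partial>lborel)"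
        by simp
    qed
  qed
  have split: "(\<integral>x. F' (Uk n x) * (Vk n x - V x) * \<phi> x \<partial>lborel) + (\<integral>x. F' (Uk n x) * V x * \<phi> x \<partial>lborel) +
      (\<integral>x. F (Uk n x) * ?d\<phi> x \<partial>lborel) = 0" for n
  proof -
    have i1: "integrable lborel (\<lambda>x. F' (Uk n x) * (Vk n x - V x) * \<phi> x)"
      using iFV[of "\<lambda>x. Vk n x - V x" "\<lambda>x. F' (Uk n x)" C] iUk V C by auto
    have i2: "integrable lborel (\<lambda>x. F' (Uk n x) * V x * \<phi> x)"
      using iFV[of V "\<lambda>x. F' (Uk n x)" C] V C by auto
    have "0 = (\<integral>x. Q n x \<partial>lborel)" by (simp add: Q0)
    also have "\<dots> = (\<integral>x. F' (Uk n x) * (Vk n x - V x) * \<phi> x + F' (Uk n x) * V x * \<phi> x + F (Uk n x) * ?d\<phi> x \<partial>lborel)"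
    proof (rule Bochner_Integration.integral_cong)
      fix x
      show "Q n x = F' (Uk n x) * (Vk n x - V x) * \<phi> x + F' (Uk n x) * V x * \<phi> x + F (Uk n x) * ?d\<phi> x"
        using WV[of x n] K(3)[of x] by (cases "x \<in> K") (auto simp: Q_def algebra_simps)
    qed simp
    also have "\<dots> = (\<integral>x. F' (Uk n x) * (Vk n x - V x) * \<phi> x \<partial>lborel) + (\<integral>x. F' (Uk n x) * V x * \<phi> x \<partial>lborel) +
      (\<integral>x. F (Uk n x) * ?d\<phi> x \<partial>lborel)"
      using i1 i2 iFU[OF iUk(1)] by simp
    finally show ?thesis by simp
  qed
  have "(\<lambda>n. (\<integral>x. F' (Uk (r n) x) * (Vk (r n) x - V x) * \<phi> x \<partial>lborel) + (\<integral>x. F' (Uk (r n) x) * V x * \<phi> x \<partial>lborel) +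
      (\<integral>x. F (Uk (r n) x) * ?d\<phi> x \<partial>lborel)) \<longlonglongrightarrow> 0 + (\<integral>x. F' (U x) * V x * \<phi> x \<partial>lborel) + (\<integral>x. F (U x) * ?d\<phi> x \<partial>lborel)"
    using LIMSEQ_subseq_LIMSEQ[OF lim3 r(1)] LIMSEQ_subseq_LIMSEQ[OF lim1 r(1)] lim2
    by (intro tendsto_add) (simp_all add: o_def)
  then have "0 + (\<integral>x. F' (U x) * V x * \<phi> x \<partial>lborel) + (\<integral>x. F (U x) * ?d\<phi> x \<partial>lborel) = 0"
    by (simp add: split LIMSEQ_const_iff)
  then show ?thesis by simp
qed

text \<open>Transfers integrals over \<open>S\<close> to the whole space with a Borel integrand, the setting of the mollifiers.\<close>

lemma integral_lebesgue_on_eq: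
  fixes f f' :: "'a::euclidean_space \<Rightarrow> real"
  assumes S: "S \<in> sets lebesgue" and "f \<in> borel_measurable (lebesgue_on S)" "f' \<in> borel_measurable borel"
    and "AE x in lebesgue. indicator S x * f x = f' x"
  shows "(\<integral>x. f x \<partial>lebesgue_on S) = (\<integral>x. f' x \<partial>lborel)"
proof -
  have "(\<integral>x. f x \<partial>lebesgue_on S) = (\<integral>x. indicator S x * f x \<partial>lebesgue)"
    using S by (subst integral_restrict_space) (auto simp: )
  also have "\<dots> = (\<integral>x. f' x \<partial>lebesgue)"
  proof (rule integral_cong_AE)
    show "(\<lambda>x. indicator S x * f x) \<in> borel_measurable lebesgue"
      using assms(2) S by (subst (asm) borel_measurable_restrict_space_iff) (auto simp: mult.commute)
    show "f' \<in> borel_measurable lebesgue" using assms(3) by (auto intro: measurable_completion)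
  qed fact
  also have "\<dots> = (\<integral>x. f' x \<partial>lborel)" by (rule integral_completion) (use assms in auto)
  finally show ?thesis .
qed

lemma ex_borel_extension:
  fixes u :: "'a::euclidean_space \<Rightarrow> real"
  assumes S: "S \<in> sets lebesgue" and u: "integrable (lebesgue_on S) u"
  obtains U where "integrable lborel U" "AE x in lebesgue. indicator S x * u x = U x"
proof -
  have "integrable lebesgue (\<lambda>x. indicator S x * u x)"
    using u S by (subst (asm) integrable_restrict_space) auto
  then show thesis using ex_borel_representative_integrable that by blast
qed

theorem has_weak_gradient_compose:
  fixes u :: "'a::euclidean_space \<Rightarrow> real" and F F' :: "real \<Rightarrow> real"
  assumes S: "open S" and u: "integrable (lebesgue_on S) u" and G: "integrable (lebesgue_on S) G"
    and w: "has_weak_gradient S u G"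
    and F: "\<And>t. (F has_real_derivative F' t) (at t)" and F': "continuous_on UNIV F'" and C: "\<And>t. \<bar>F' t\<bar> \<le> C"
  shows "has_weak_gradient S (\<lambda>x. F (u x)) (\<lambda>x. F' (u x) *\<^sub>R G x)"
  unfolding has_weak_gradient_def
proof (intro conjI ballI)
  have Sm: "S \<in> sets lebesgue" using S by auto
  have Fc: "continuous_on UNIV F" using F by (meson DERIV_isCont continuous_at_imp_continuous_on)
  have Fm [measurable]: "F \<in> borel_measurable borel" "F' \<in> borel_measurable borel"
    using Fc F' by (auto intro: borel_measurable_continuous_onI)
  have um [measurable]: "u \<in> borel_measurable (lebesgue_on S)" "G \<in> borel_measurable (lebesgue_on S)" using u G by auto
  have C0: "C \<ge> 0" using C[of 0] by linarith
  have lip: "\<bar>F s - F t\<bar> \<le> C * \<bar>s - t\<bar>" for s t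
    using field_differentiable_bound[where S=UNIV and f=F and f'=F' and B=C, OF convex_UNIV] F C by auto
  have Fb: "\<bar>F s\<bar> \<le> \<bar>F 0\<bar> + C * \<bar>s\<bar>" for s using lip[of s 0] by auto
  show "locally_integrable_on (\<lambda>x. F (u x)) S"
    unfolding locally_integrable_on_def
  proof (intro allI impI, elim conjE)
    fix K assume K: "compact K" "K \<subseteq> S"
    have uK: "integrable (lebesgue_on K) u" using w K by (auto simp: has_weak_gradient_def locally_integrable_on_def)
    have c: "integrable (lebesgue_on K) (\<lambda>x. \<bar>F 0\<bar>)"
      by (rule finite_measure.integrable_const[OF finite_measure_lebesgue_on[OF lmeasurable_compact[OF K(1)]]])
    show "integrable (lebesgue_on K) (\<lambda>x. F (u x))"
    proof (rule Bochner_Integration.integrable_bound[where f="\<lambda>x. \<bar>F 0\<bar> + C * \<bar>u x\<bar>"])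
      have "u \<in> borel_measurable (lebesgue_on K)" using uK by auto
      then show "(\<lambda>x. F (u x)) \<in> borel_measurable (lebesgue_on K)" by measurable
      show "AE x in lebesgue_on K. norm (F (u x)) \<le> norm (\<bar>F 0\<bar> + C * \<bar>u x\<bar>)" using Fb C0 by auto
    qed (use uK c in auto)
  qed
  show "locally_integrable_on (\<lambda>x. F' (u x) *\<^sub>R G x) S"
    unfolding locally_integrable_on_def
  proof (intro allI impI, elim conjE)
    fix K assume K: "compact K" "K \<subseteq> S"
    have uK: "integrable (lebesgue_on K) u" "integrable (lebesgue_on K) G"
      using w K by (auto simp: has_weak_gradient_def locally_integrable_on_def)
    then have [measurable]: "u \<in> borel_measurable (lebesgue_on K)" "G \<in> borel_measurable (lebesgue_on K)" by auto
    show "integrable (lebesgue_on K) (\<lambda>x. F' (u x) *\<^sub>R G x)"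
    proof (rule Bochner_Integration.integrable_bound[where f="\<lambda>x. C * norm (G x)"])
      show "AE x in lebesgue_on K. norm (F' (u x) *\<^sub>R G x) \<le> norm (C * norm (G x))"
        using C C0 by (auto simp: abs_mult intro!: mult_right_mono)
    qed (use uK in auto)
  qed
  fix \<phi> b assume \<phi>: "\<phi> \<in> test_functions S" and b: "b \<in> (Basis::'a set)"
  obtain U where U: "integrable lborel U" "AE x in lebesgue. indicator S x * u x = U x"
    using ex_borel_extension[OF Sm u] by blast
  have Gb: "integrable (lebesgue_on S) (\<lambda>x. G x \<bullet> b)" using G by auto
  obtain V where V: "integrable lborel V" "AE x in lebesgue. indicator S x * (G x \<bullet> b) = V x"
    using ex_borel_extension[OF Sm Gb] by blast
  have [measurable]: "U \<in> borel_measurable borel" "V \<in> borel_measurable borel" using U V by auto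
  have tm: "\<psi> \<in> borel_measurable borel" "(\<lambda>x. frechet_derivative \<psi> (at x) b) \<in> borel_measurable borel"
      "\<psi> \<in> borel_measurable (lebesgue_on S)" "(\<lambda>x. frechet_derivative \<psi> (at x) b) \<in> borel_measurable (lebesgue_on S)"
    if "\<psi> \<in> test_functions S" for \<psi>
  proof -
    show 1: "\<psi> \<in> borel_measurable borel" "(\<lambda>x. frechet_derivative \<psi> (at x) b) \<in> borel_measurable borel"
      using smooth_continuous[OF test_functions_smooth[OF that]] smooth_derivative_continuous[OF test_functions_smooth[OF that] b]
      by (auto intro: borel_measurable_continuous_onI)
    then show "\<psi> \<in> borel_measurable (lebesgue_on S)" "(\<lambda>x. frechet_derivative \<psi> (at x) b) \<in> borel_measurable (lebesgue_on S)"
      by (intro measurable_restrict_space1 measurable_completion; simp)+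
  qed
  have zero: "\<psi> x = 0" "frechet_derivative \<psi> (at x) b = 0" if t: "\<psi> \<in> test_functions S" "x \<notin> S" for \<psi> x
  proof -
    obtain K where K: "compact K" "K \<subseteq> S" "\<And>x. x \<notin> K \<Longrightarrow> \<psi> x = 0"
      using test_functions_support[OF t(1)] by metis
    then show "\<psi> x = 0" using t by auto
    show "frechet_derivative \<psi> (at x) b = 0"
      by (rule derivative_zero_outside[of K]) (use K t compact_imp_closed in auto)
  qed
  have weak: "(\<integral>x. U x * frechet_derivative \<psi> (at x) b \<partial>lborel) = - (\<integral>x. V x * \<psi> x \<partial>lborel)"
    if \<psi>: "\<psi> \<in> test_functions S" for \<psi>
  proof -
    note [measurable] = tm[OF \<psi>]
    have "(\<integral>x. u x * frechet_derivative \<psi> (at x) b \<partial>lebesgue_on S) = (\<integral>x. U x * frechet_derivative \<psi> (at x) b \<partial>lborel)"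
    proof (rule integral_lebesgue_on_eq[OF Sm])
      show "AE x in lebesgue. indicator S x * (u x * frechet_derivative \<psi> (at x) b) = U x * frechet_derivative \<psi> (at x) b"
        using U(2) by eventually_elim (simp add: mult.assoc[symmetric])
    qed measurable
    moreover have "(\<integral>x. (G x \<bullet> b) * \<psi> x \<partial>lebesgue_on S) = (\<integral>x. V x * \<psi> x \<partial>lborel)"
    proof (rule integral_lebesgue_on_eq[OF Sm])
      show "AE x in lebesgue. indicator S x * ((G x \<bullet> b) * \<psi> x) = V x * \<psi> x"
        using V(2) by eventually_elim (simp add: mult.assoc[symmetric])
    qed measurable
    ultimately show ?thesis using w \<psi> b by (auto simp: has_weak_gradient_def)
  qed
  note [measurable] = tm[OF \<phi>]
  have "(\<integral>x. F (u x) * frechet_derivative \<phi> (at x) b \<partial>lebesgue_on S) = (\<integral>x. F (U x) * frechet_derivative \<phi> (at x) b \<partial>lborel)"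
  proof (rule integral_lebesgue_on_eq[OF Sm])
    show "AE x in lebesgue. indicator S x * (F (u x) * frechet_derivative \<phi> (at x) b) = F (U x) * frechet_derivative \<phi> (at x) b"
      using U(2) by eventually_elim (use zero[OF \<phi>] in \<open>auto simp: indicator_def split: if_splits\<close>)
  qed measurable
  also have "\<dots> = - (\<integral>x. F' (U x) * V x * \<phi> x \<partial>lborel)"
    by (rule chain_rule_core[OF S U(1) V(1) b weak F F' C \<phi>])
  also have "(\<integral>x. F' (U x) * V x * \<phi> x \<partial>lborel) = (\<integral>x. (F' (u x) *\<^sub>R G x \<bullet> b) * \<phi> x \<partial>lebesgue_on S)"
  proof (rule integral_lebesgue_on_eq[OF Sm, symmetric])
    show "AE x in lebesgue. indicator S x * (((F' (u x) *\<^sub>R G x) \<bullet> b) * \<phi> x) = F' (U x) * V x * \<phi> x"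
      using U(2) V(2) by eventually_elim (use zero[OF \<phi>] in \<open>auto simp: indicator_def split: if_splits\<close>)
  qed measurable
  finally show "(\<integral>x. F (u x) * frechet_derivative \<phi> (at x) b \<partial>lebesgue_on S) =
    - (\<integral>x. ((F' (u x) *\<^sub>R G x) \<bullet> b) * \<phi> x \<partial>lebesgue_on S)" .
qed

section \<open>Monotonicity and uniform convexity of the p-th power of the norm\<close>

text \<open>The flux \<open>|v|^(p-2) v\<close> of the p-Laplacian, which is the gradient of \<open>|v|^p / p\<close>.\<close>

definition pflux :: "real \<Rightarrow> 'a::real_normed_vector \<Rightarrow> 'a"
  where "pflux p v = norm v powr (p - 2) *\<^sub>R v"

lemma norm_pflux: "norm (pflux p v) = norm v powr (p - 1)"
proof (cases "v = 0")
  case False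
  then have "norm v powr (p - 2) * norm v powr 1 = norm v powr (p - 1)"
    by (subst powr_add[symmetric]) auto
  then show ?thesis using False by (simp add: pflux_def)
qed (simp add: pflux_def)

lemma pflux_inner_self: "pflux p v \<bullet> v = norm v powr p"
proof (cases "v = 0")
  case False
  have "pflux p v \<bullet> v = norm v powr (p - 2) * norm v powr 2"
    using False by (simp add: pflux_def power2_norm_eq_inner[symmetric])
  also have "\<dots> = norm v powr p" by (subst powr_add[symmetric]) auto
  finally show ?thesis .
qed (simp add: pflux_def)

lemma pflux_inner_le: "\<bar>pflux p v \<bullet> w\<bar> \<le> norm v powr (p - 1) * norm w"
  using Cauchy_Schwarz_ineq2[of "pflux p v" w] by (simp add: norm_pflux)

lemma powr_pred_mult: "(x::real) \<ge> 0 \<Longrightarrow> p > 1 \<Longrightarrow> x powr (p - 1) * x = x powr p"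
  by (cases "x = 0") (auto simp: powr_diff)

text \<open>Convexity of \<open>|v|^p\<close>: the tangent at \<open>b\<close> lies below the function.  By Cauchy--Schwarz this is Young's
inequality for \<open>|a|\<close> and \<open>|b|^(p-1)\<close>.\<close>

lemma pflux_subgradient:
  assumes p: "p > 1"
  shows "norm b powr p + p * (pflux p b \<bullet> (a - b)) \<le> norm a powr p"
proof -
  let ?q = "p / (p - 1)"
  have "norm a * norm b powr (p - 1) \<le> norm a powr p / p + (norm b powr (p - 1)) powr ?q / ?q"
    by (rule Youngs_inequality) (use p in \<open>auto simp: field_simps\<close>)
  also have "(norm b powr (p - 1)) powr ?q = norm b powr p" using p by (simp add: powr_powr)
  finally have "p * (norm a * norm b powr (p - 1)) \<le> p * (norm a powr p / p + norm b powr p / ?q)"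
    using p by (intro mult_left_mono) auto
  also have "\<dots> = norm a powr p + (p - 1) * norm b powr p"
    using p by (simp add: field_simps)
  finally have 1: "p * (norm a * norm b powr (p - 1)) \<le> norm a powr p + (p - 1) * norm b powr p" .
  have "p * (pflux p b \<bullet> a) \<le> p * (norm b powr (p - 1) * norm a)"
    using p pflux_inner_le[of p b a] by (intro mult_left_mono) auto
  with 1 have "p * (pflux p b \<bullet> a) \<le> norm a powr p + (p - 1) * norm b powr p" by (simp add: mult.commute)
  then show ?thesis by (simp add: inner_diff_right pflux_inner_self algebra_simps)
qed

lemma pflux_monotone:
  assumes p: "p > 1"
  shows "(pflux p a - pflux p b) \<bullet> (a - b) \<ge> 0"
proof -
  have "p * (pflux p b \<bullet> (a - b)) + p * (pflux p a \<bullet> (b - a)) \<le> 0"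
    using pflux_subgradient[OF p, of b a] pflux_subgradient[OF p, of a b] by linarith
  then have "p * ((pflux p a - pflux p b) \<bullet> (a - b)) \<ge> 0"
    by (simp add: inner_diff_left inner_diff_right algebra_simps)
  then show ?thesis using p by (simp add: zero_le_mult_iff)
qed

lemma continuous_pflux:
  assumes p: "p > 1"
  shows "continuous_on UNIV (pflux p :: 'a::euclidean_space \<Rightarrow> 'a)"
proof (rule continuous_at_imp_continuous_on, rule ballI)
  fix v :: 'a
  show "isCont (pflux p) v"
  proof (cases "v = 0")
    case True
    have "((\<lambda>w. norm (pflux p (w::'a))) \<longlongrightarrow> 0) (at 0)"
    proof -
      have "((\<lambda>w::'a. norm w powr (p - 1)) \<longlongrightarrow> 0 powr (p - 1)) (at 0)"
        by (rule tendsto_powr2) (use p in \<open>auto intro!: tendsto_norm_zero always_eventually\<close>)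
      then show ?thesis by (simp add: norm_pflux)
    qed
    then have "(pflux p \<longlongrightarrow> (0::'a)) (at 0)" by (rule tendsto_norm_zero_cancel)
    moreover have "pflux p (0::'a) = 0" by (simp add: pflux_def)
    ultimately show ?thesis using True by (simp only: isCont_def)
  next
    case False
    then show ?thesis unfolding pflux_def[abs_def] by (intro continuous_intros) auto
  qed
qed

lemma pflux_measurable [measurable]:
  assumes "p > 1" "f \<in> borel_measurable M"
  shows "(\<lambda>x. pflux p (f x :: 'a::euclidean_space)) \<in> borel_measurable M"
  using assms(2) borel_measurable_continuous_onI[OF continuous_pflux[OF assms(1), where 'a='a]]
  by (rule measurable_compose)

text \<open>A weighted Young inequality without sharp constants, obtained by comparing \<open>y\<close> with \<open>\<eta> x\<close>.  Large
\<open>\<eta>\<close> makes the term with \<open>y\<close> small, small \<open>\<eta>\<close> the term with \<open>x\<close>; both uses occur.\<close>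

lemma crude_Young:
  assumes "x \<ge> 0" "y \<ge> 0" "\<eta> > 0" "p > (1::real)"
  shows "x * y powr (p - 1) \<le> \<eta> powr (p - 1) * x powr p + y powr p / \<eta>"
proof (cases "y \<le> \<eta> * x")
  case True
  then have "y powr (p - 1) \<le> (\<eta> * x) powr (p - 1)" using assms by (intro powr_mono2) auto
  then have "x * y powr (p - 1) \<le> x * (\<eta> * x) powr (p - 1)" using assms by (intro mult_left_mono) auto
  also have "\<dots> = \<eta> powr (p - 1) * x powr p"
    using assms by (simp add: powr_mult powr_pred_mult[symmetric])
  finally show ?thesis using assms by (simp add: add_increasing2)
next
  case False
  then have "x \<le> y / \<eta>" using assms by (simp add: field_simps)
  then have "x * y powr (p - 1) \<le> y / \<eta> * y powr (p - 1)" by (intro mult_right_mono) auto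
  also have "\<dots> = y powr p / \<eta>" using assms by (simp add: powr_pred_mult[symmetric])
  finally show ?thesis using assms by (simp add: add_increasing)
qed

lemma powr_midpoint_strict:
  fixes x y p :: real
  assumes "0 \<le> x" "x < y" "p > 1"
  shows "((x + y) / 2) powr p < (x powr p + y powr p) / 2"
proof -
  let ?m = "(x + y) / 2"
  have mvt: "\<exists>z. s < z \<and> z < t \<and> t powr p - s powr p = (t - s) * (p * z powr (p - 1))"
    if "0 \<le> s" "s < t" for s t
  proof -
    have d: "((\<lambda>z. z powr p) has_real_derivative p * z powr (p - 1)) (at z)" if "s < z" for z
      using has_real_derivative_powr[of z p] that \<open>0 \<le> s\<close> by simp
    have "\<exists>l z. s < z \<and> z < t \<and> DERIV (\<lambda>z. z powr p) z :> l \<and> t powr p - s powr p = (t - s) * l"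
    proof (rule MVT[OF that(2)])
      show "continuous_on {s..t} (\<lambda>z. z powr p)"
        using assms(3) that(1) by (intro continuous_on_powr' continuous_intros) auto
      show "(\<lambda>z. z powr p) differentiable (at z)" if "s < z" "z < t" for z
        using d[OF that(1)] real_differentiable_def by blast
    qed
    then show ?thesis using d DERIV_unique by blast
  qed
  obtain z1 where z1: "x < z1" "z1 < ?m" "?m powr p - x powr p = (?m - x) * (p * z1 powr (p - 1))"
    using mvt[of x ?m] assms by auto
  obtain z2 where z2: "?m < z2" "z2 < y" "y powr p - ?m powr p = (y - ?m) * (p * z2 powr (p - 1))"
    using mvt[of ?m y] assms by auto
  have "z1 powr (p - 1) < z2 powr (p - 1)"
    using assms z1 z2 by (intro powr_less_mono2) auto
  then have "(?m - x) * (p * z1 powr (p - 1)) < (?m - x) * (p * z2 powr (p - 1))"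
    using assms by (intro mult_strict_left_mono) auto
  moreover have "?m - x = y - ?m" by (simp add: field_simps)
  ultimately have "?m powr p - x powr p < y powr p - ?m powr p" using z1(3) z2(3) by (simp only:)
  then show ?thesis by simp
qed

text \<open>The defect of \<open>|v|^p\<close> from being affine at the midpoint of \<open>a\<close> and \<open>b\<close>.\<close>

definition pgap :: "real \<Rightarrow> 'a::real_normed_vector \<Rightarrow> 'a \<Rightarrow> real"
  where "pgap p a b = (norm a powr p + norm b powr p) / 2 - norm ((1/2) *\<^sub>R (a + b)) powr p"

lemma pgap_nonneg:
  fixes a b :: "'a::euclidean_space"
  assumes p: "p > 1"
  shows "pgap p a b \<ge> 0"
proof -
  let ?m = "(1/2) *\<^sub>R (a + b)"
  have "a - ?m = (1/2) *\<^sub>R (a + a) - ?m" "b - ?m = (1/2) *\<^sub>R (b + b) - ?m" by simp_all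
  then have "a - ?m = (1/2) *\<^sub>R (a - b)" "b - ?m = (1/2) *\<^sub>R (b - a)"
    by (simp_all only: scaleR_right_diff_distrib[symmetric]) simp_all
  then have "b - ?m = - (a - ?m)" by (simp only: scaleR_minus_right[symmetric] minus_diff_eq)
  then have eq: "pflux p ?m \<bullet> (b - ?m) = - (pflux p ?m \<bullet> (a - ?m))" by (simp only: inner_minus_right)
  have "norm ?m powr p + p * (pflux p ?m \<bullet> (a - ?m)) \<le> norm a powr p"
    "norm ?m powr p + p * (pflux p ?m \<bullet> (b - ?m)) \<le> norm b powr p"
    by (rule pflux_subgradient[OF p])+
  then show ?thesis unfolding pgap_def eq by simp
qed

text \<open>Equality in convexity forces \<open>|a| = |b|\<close> by strict convexity of the scalar power, then
\<open>|a + b| = |a| + |b|\<close>, and the parallelogram law gives \<open>a = b\<close>.\<close>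

lemma pgap_zero_imp_eq:
  fixes a b :: "'a::euclidean_space"
  assumes p: "p > 1" and z: "pgap p a b = 0"
  shows "a = b"
proof -
  let ?s = "norm a" and ?t = "norm b" and ?m = "norm ((1/2) *\<^sub>R (a + b))"
  have ms: "?m \<le> (?s + ?t) / 2" using norm_triangle_ineq[of a b] by simp
  then have mp: "?m powr p \<le> ((?s + ?t) / 2) powr p" using p by (intro powr_mono2) auto
  have "?s = ?t"
  proof (rule ccontr)
    assume "?s \<noteq> ?t"
    then have "((?s + ?t) / 2) powr p < (?s powr p + ?t powr p) / 2"
      using powr_midpoint_strict[of ?s ?t p] powr_midpoint_strict[of ?t ?s p] p
      by (cases "?s < ?t") (auto simp: add.commute)
    then show False using mp z by (simp add: pgap_def)
  qed
  then have "?m powr p = ?s powr p" using z by (simp add: pgap_def)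
  then have "?m = ?s"
    using powr_less_mono2[of p ?m ?s] powr_less_mono2[of p ?s ?m] p by (cases ?m ?s rule: linorder_cases) auto
  then have "norm (a + b) = 2 * ?s" by simp
  then have 1: "norm (a + b) ^ 2 = 4 * ?s ^ 2" by (simp add: power_mult_distrib)
  have "norm (a + b) ^ 2 + norm (a - b) ^ 2 = 2 * ?s ^ 2 + 2 * ?t ^ 2"
    by (simp add: power2_norm_eq_inner inner_simps inner_commute)
  with 1 \<open>?s = ?t\<close> have "norm (a - b) ^ 2 = 0" by simp
  then show ?thesis by simp
qed

lemma pgap_scale:
  fixes a b :: "'a::euclidean_space"
  assumes "r \<ge> 0"
  shows "pgap p (r *\<^sub>R a) (r *\<^sub>R b) = r powr p * pgap p a b"
proof -
  have "(1/2) *\<^sub>R (r *\<^sub>R a + r *\<^sub>R b) = r *\<^sub>R ((1/2) *\<^sub>R (a + b))" by (simp add: algebra_simps)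
  then have "norm ((1/2) *\<^sub>R (r *\<^sub>R a + r *\<^sub>R b)) = r * norm ((1/2) *\<^sub>R (a + b))"
    using assms by (simp only: norm_scaleR abs_of_nonneg)
  then show ?thesis using assms unfolding pgap_def by (simp only: norm_scaleR powr_mult abs_of_nonneg) (simp add: algebra_simps powr_mult)
qed

text \<open>All terms are homogeneous of degree \<open>p\<close>, so it suffices to look at the unit sphere of pairs.  Where the
first term on the right does not already dominate, \<open>a \<noteq> b\<close>; on this compact set the gap is bounded
below by a positive constant.  The argument covers every \<open>p > 1\<close> at once.\<close>

lemma p_uniform_convexity:
  assumes p: "p > 1" and e: "e > 0"
  shows "\<exists>C\<ge>0. \<forall>a b::'a::euclidean_space.
    norm (a - b) powr p \<le> e * (norm a powr p + norm b powr p) + C * pgap p a b"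
proof -
  define T where "T = sphere (0::'a \<times> 'a) 1 \<inter> {z. e * (norm (fst z) powr p + norm (snd z) powr p) \<le> norm (fst z - snd z) powr p}"
  have cont: "continuous_on UNIV (\<lambda>z::'a \<times> 'a. norm (f z) powr p)" if "continuous_on UNIV f" for f :: "'a \<times> 'a \<Rightarrow> 'a"
    using p that by (intro continuous_on_powr' continuous_intros) auto
  have "compact T" unfolding T_def
    by (intro compact_Int_closed closed_Collect_le continuous_intros cont) auto
  have "\<exists>C\<ge>0. \<forall>z\<in>T. norm (fst z - snd z) powr p \<le> C * pgap p (fst z) (snd z)"
  proof (cases "T = {}")
    case False
    have "continuous_on T (\<lambda>z. pgap p (fst z) (snd z))"
      unfolding pgap_def by (rule continuous_on_subset[of UNIV]) (intro continuous_intros cont, auto)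
    from continuous_attains_inf[OF \<open>compact T\<close> False this] obtain z0 where
      z0: "z0 \<in> T" "\<And>z. z \<in> T \<Longrightarrow> pgap p (fst z0) (snd z0) \<le> pgap p (fst z) (snd z)" by blast
    let ?d = "pgap p (fst z0) (snd z0)"
    have d: "?d > 0"
    proof (rule ccontr)
      assume "\<not> ?d > 0"
      then have "?d = 0" using pgap_nonneg[OF p, of "fst z0" "snd z0"] by simp
      then have eq: "fst z0 = snd z0" by (rule pgap_zero_imp_eq[OF p])
      have le: "e * (norm (fst z0) powr p + norm (snd z0) powr p) \<le> norm (fst z0 - snd z0) powr p"
        using z0(1) by (simp add: T_def)
      have "norm (fst z0 - snd z0) powr p = 0" using eq by simp
      with le e have "norm (fst z0) powr p + norm (snd z0) powr p \<le> 0" by (simp add: mult_le_0_iff)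
      then have "norm (fst z0) powr p = 0" "norm (snd z0) powr p = 0"
        by (smt (verit) powr_ge_zero)+
      then have "z0 = 0" by (simp add: prod_eq_iff)
      then show False using z0(1) by (simp add: T_def)
    qed
    show ?thesis
    proof (intro exI[of _ "2 powr p / ?d"] conjI ballI)
      show "2 powr p / ?d \<ge> 0" using d by simp
      fix z assume z: "z \<in> T"
      have nz: "norm z = 1" using z by (simp add: T_def)
      have "norm (fst z) \<le> 1" "norm (snd z) \<le> 1" using norm_fst_le[of "fst z" "snd z"] norm_snd_le[of "snd z" "fst z"] nz by auto
      then have "norm (fst z - snd z) \<le> 2" using norm_triangle_ineq4[of "fst z" "snd z"] by linarith
      then have "norm (fst z - snd z) powr p \<le> 2 powr p" using p by (intro powr_mono2) auto
      also have "\<dots> = 2 powr p / ?d * ?d" using d by simp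
      also have "\<dots> \<le> 2 powr p / ?d * pgap p (fst z) (snd z)" using z0(2)[OF z] d by (intro mult_left_mono) auto
      finally show "norm (fst z - snd z) powr p \<le> 2 powr p / ?d * pgap p (fst z) (snd z)" .
    qed
  qed auto
  then obtain C where C: "C \<ge> 0" "\<And>z. z \<in> T \<Longrightarrow> norm (fst z - snd z) powr p \<le> C * pgap p (fst z) (snd z)" by blast
  show ?thesis
  proof (intro exI[of _ C] conjI allI)
    fix a b :: 'a
    show "norm (a - b) powr p \<le> e * (norm a powr p + norm b powr p) + C * pgap p a b"
    proof (cases "(a, b) = 0")
      case True
      then show ?thesis by (simp add: pgap_def zero_prod_def)
    next
      case False
      define r where "r = norm (a, b)"
      have r: "r > 0" using False by (simp add: r_def)
      define a' b' where "a' = (1/r) *\<^sub>R a" and "b' = (1/r) *\<^sub>R b"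
      have ab: "a = r *\<^sub>R a'" "b = r *\<^sub>R b'" using r by (auto simp: a'_def b'_def)
      have "(a', b') = (1/r) *\<^sub>R (a, b)" by (simp add: a'_def b'_def)
      then have n1: "norm (a', b') = 1" using r by (simp only: norm_scaleR) (simp add: r_def)
      have "norm (a' - b') powr p \<le> e * (norm a' powr p + norm b' powr p) + C * pgap p a' b'"
      proof (cases "(a', b') \<in> T")
        case True
        from C(2)[OF this] show ?thesis using e by (simp add: add_increasing)
      next
        case False
        then have "norm (a' - b') powr p \<le> e * (norm a' powr p + norm b' powr p)"
          using n1 by (simp add: T_def)
        then show ?thesis using mult_nonneg_nonneg[OF C(1) pgap_nonneg[OF p, of a' b']] by linarith
      qed
      then have "r powr p * norm (a' - b') powr p \<le> r powr p * (e * (norm a' powr p + norm b' powr p) + C * pgap p a' b')"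
        by (intro mult_left_mono) auto
      moreover have "norm (a - b) powr p = r powr p * norm (a' - b') powr p"
        using r by (simp add: ab powr_mult flip: scaleR_diff_right)
      moreover have "norm a powr p = r powr p * norm a' powr p" "norm b powr p = r powr p * norm b' powr p"
        using r by (simp_all add: ab powr_mult)
      moreover have "pgap p a b = r powr p * pgap p a' b'" using r by (simp add: ab pgap_scale)
      ultimately show ?thesis by (simp add: algebra_simps)
    qed
  qed (rule C(1))
qed

section \<open>Sobolev functions on a bounded open set\<close>

locale sobolev_domain =
  fixes S :: "'a::euclidean_space set" and p :: real
  assumes open_S: "open S" and bounded_S: "bounded S" and p: "p > 1"
begin

abbreviation "L \<equiv> lebesgue_on S"

lemma S_sets: "S \<in> sets lebesgue" using open_S by auto

sublocale L: finite_measure L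
proof (rule finite_measure_lebesgue_on)
  show "S \<in> lmeasurable" using open_S bounded_S by (rule lmeasurable_open[rotated])
qed

lemma integrable_bounded_AE:
  fixes f :: "'a \<Rightarrow> 'b::{banach,second_countable_topology}"
  assumes "f \<in> borel_measurable L" "AE x in L. norm (f x) \<le> C"
  shows "integrable L f"
  using assms by (intro L.integrable_const_bound[of _ C]) auto

lemma norm_le_powr: "norm (y::'b::real_normed_vector) \<le> 1 + norm y powr p"
proof (cases "norm y \<le> 1")
  case True then show ?thesis by (simp add: add_increasing2)
next
  case False
  then have "norm y powr 1 \<le> norm y powr p" using p by (intro powr_mono) auto
  then show ?thesis using False by simp
qed

lemma Lp_measurable: "f \<in> Lp p S \<Longrightarrow> f \<in> borel_measurable L"
  by (simp add: Lp_def)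

lemma Lp_powr: "f \<in> Lp p S \<Longrightarrow> integrable L (\<lambda>x. norm (f x) powr p)"
  by (simp add: Lp_def)

lemma Lp_integrable:
  fixes f :: "'a \<Rightarrow> 'b::euclidean_space"
  assumes "f \<in> Lp p S"
  shows "integrable L f"
proof (rule Bochner_Integration.integrable_bound[where f="\<lambda>x. 1 + norm (f x) powr p"])
  show "AE x in L. norm (f x) \<le> norm (1 + norm (f x) powr p)"
    using norm_le_powr by (auto intro!: AE_I2 order_trans[OF norm_le_powr])
qed (use assms in \<open>auto simp: Lp_def\<close>)

lemma Lp_add: "f \<in> Lp p S \<Longrightarrow> h \<in> Lp p S \<Longrightarrow> (\<lambda>x. f x + h x) \<in> Lp p S"
  using p by (auto simp: Lp_def intro!: integrable_norm_powr_add)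

lemma Lp_scaleR: "f \<in> Lp p S \<Longrightarrow> (\<lambda>x. c *\<^sub>R f x) \<in> Lp p S"
  by (auto simp: Lp_def powr_mult)

lemma Lp_bound:
  fixes f :: "'a \<Rightarrow> 'b::euclidean_space" and h :: "'a \<Rightarrow> 'c::euclidean_space"
  assumes h: "h \<in> Lp p S" and f: "f \<in> borel_measurable L" and le: "AE x in L. norm (f x) \<le> C * norm (h x)" and C: "C \<ge> 0"
  shows "f \<in> Lp p S"
proof -
  have "integrable L (\<lambda>x. norm (f x) powr p)"
  proof (rule Bochner_Integration.integrable_bound[where f="\<lambda>x. C powr p * norm (h x) powr p"])
    show "AE x in L. norm (norm (f x) powr p) \<le> norm (C powr p * norm (h x) powr p)"
      using le
    proof eventually_elim
      case (elim x)
      then have "norm (f x) powr p \<le> (C * norm (h x)) powr p" using p by (intro powr_mono2) auto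
      then show ?case using C by (simp add: powr_mult)
    qed
  qed (use h f in \<open>auto simp: Lp_def\<close>)
  then show ?thesis using f by (simp add: Lp_def)
qed

lemma Lp_const: "(\<lambda>x. c) \<in> Lp p S"
  by (simp add: Lp_def)

lemma Lp_bounded:
  fixes f :: "'a \<Rightarrow> 'b::euclidean_space"
  assumes "f \<in> borel_measurable L" "AE x in L. norm (f x) \<le> C"
  shows "f \<in> Lp p S"
proof (rule Lp_bound[where h="\<lambda>x. 1::real" and C="max C 0"])
  show "AE x in L. norm (f x) \<le> max C 0 * norm (1::real)" using assms(2) by auto
qed (use assms Lp_const in auto)

lemma integrable_on_subset:
  fixes f :: "'a \<Rightarrow> 'b::euclidean_space"
  assumes "integrable L f" "compact K" "K \<subseteq> S"
  shows "integrable (lebesgue_on K) f"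
proof -
  have K: "K \<in> sets lebesgue" using assms(2) by (simp add: fmeasurableD lmeasurable_compact)
  have "integrable (restrict_space L K) f"
  proof (subst integrable_restrict_space)
    show KL: "K \<inter> space L \<in> sets L"
      using K S_sets assms(3) by (simp add: sets_restrict_space_iff Int_absorb2)
    then have "K \<in> sets L" using assms(3) by (simp add: Int_absorb2)
    then show "integrable L (\<lambda>x. indicat_real K x *\<^sub>R f x)"
      using assms(1) by (rule integrable_mult_indicator)
  qed
  moreover have "restrict_space L K = lebesgue_on K"
    using S_sets K assms(3) by (subst restrict_restrict_space) (auto simp: Int_absorb1)
  ultimately show ?thesis by simp
qed

lemma locally_integrable: "integrable L f \<Longrightarrow> locally_integrable_on f S"
  unfolding locally_integrable_on_def using integrable_on_subset by blast

lemma test_function_bounds: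
  assumes \<phi>: "\<phi> \<in> test_functions S" and b: "b \<in> Basis"
  obtains c where "c \<ge> 0" "\<And>x. \<bar>\<phi> x\<bar> \<le> c" "\<And>x. \<bar>frechet_derivative \<phi> (at x) b\<bar> \<le> c"
    "\<phi> \<in> borel_measurable L" "(\<lambda>x. frechet_derivative \<phi> (at x) b) \<in> borel_measurable L"
proof -
  note sm = test_functions_smooth[OF \<phi>]
  obtain K where K: "compact K" "K \<subseteq> S" "\<And>x. x \<notin> K \<Longrightarrow> \<phi> x = 0"
    using test_functions_support[OF \<phi>] by metis
  have d0: "frechet_derivative \<phi> (at x) b = 0" if "x \<notin> K" for x
    by (rule derivative_zero_outside[of K]) (use K that compact_imp_closed in auto)
  obtain c1 where c1: "c1 \<ge> 0" "\<And>x. \<bar>\<phi> x\<bar> \<le> c1"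
    using continuous_compact_support_bounded[OF smooth_continuous[OF sm] K(1)] K(3) by blast
  obtain c2 where c2: "c2 \<ge> 0" "\<And>x. \<bar>frechet_derivative \<phi> (at x) b\<bar> \<le> c2"
    using continuous_compact_support_bounded[OF smooth_derivative_continuous[OF sm b] K(1)] d0 by blast
  have m: "f \<in> borel_measurable L" if "continuous_on UNIV f" for f :: "'a \<Rightarrow> real"
    using borel_measurable_continuous_onI[OF that] by (intro measurable_restrict_space1 measurable_completion) simp
  show thesis
    by (rule that[of "max c1 c2"]) (use c1 c2 m smooth_continuous[OF sm] smooth_derivative_continuous[OF sm b] in \<open>auto simp: le_max_iff_disj\<close>)
qed

lemma integrable_mult_bounded:
  fixes f q :: "'a \<Rightarrow> real"
  assumes "integrable L f" "q \<in> borel_measurable L" "AE x in L. \<bar>q x\<bar> \<le> c"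
  shows "integrable L (\<lambda>x. f x * q x)"
proof (rule Bochner_Integration.integrable_bound[where f="\<lambda>x. c * f x"])
  show "AE x in L. norm (f x * q x) \<le> norm (c * f x)"
    using assms(3)
  proof eventually_elim
    case (elim x)
    have "\<bar>f x * q x\<bar> \<le> c * \<bar>f x\<bar>" by (rule abs_mult_le_bound[OF elim])
    also have "\<dots> \<le> \<bar>c * f x\<bar>" by (simp add: abs_mult mult_right_mono)
    finally show ?case by simp
  qed
qed (use assms in auto)

lemma W1p_gradientD:
  assumes "W1p_gradient p S u G"
  shows "u \<in> Lp p S" "G \<in> Lp p S" "has_weak_gradient S u G" "integrable L u" "integrable L G"
    "u \<in> borel_measurable L" "G \<in> borel_measurable L" "integrable L (\<lambda>x. norm (G x) powr p)"
  using assms Lp_integrable Lp_measurable Lp_powr by (auto simp: W1p_gradient_def)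

lemma W1p_gradientI:
  assumes u: "u \<in> Lp p S" and G: "G \<in> Lp p S"
    and "\<And>\<phi> b. \<phi> \<in> test_functions S \<Longrightarrow> b \<in> Basis \<Longrightarrow>
       (\<integral>x. u x * frechet_derivative \<phi> (at x) b \<partial>L) = - (\<integral>x. (G x \<bullet> b) * \<phi> x \<partial>L)"
  shows "W1p_gradient p S u G"
  using assms Lp_integrable[OF u] Lp_integrable[OF G]
  by (auto simp: W1p_gradient_def has_weak_gradient_def locally_integrable)

lemma W1p_gradient_test:
  assumes "W1p_gradient p S u G" "\<phi> \<in> test_functions S" "b \<in> Basis"
  shows "(\<integral>x. u x * frechet_derivative \<phi> (at x) b \<partial>L) = - (\<integral>x. (G x \<bullet> b) * \<phi> x \<partial>L)"
  using assms by (auto simp: W1p_gradient_def has_weak_gradient_def)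

lemma W1p_gradient_linear:
  assumes u: "W1p_gradient p S u G" and v: "W1p_gradient p S v H"
  shows "W1p_gradient p S (\<lambda>x. a * u x + b * v x) (\<lambda>x. a *\<^sub>R G x + b *\<^sub>R H x)"
proof (rule W1p_gradientI)
  show "(\<lambda>x. a * u x + b * v x) \<in> Lp p S" "(\<lambda>x. a *\<^sub>R G x + b *\<^sub>R H x) \<in> Lp p S"
    using Lp_add[OF Lp_scaleR[OF W1p_gradientD(1)[OF u], of a] Lp_scaleR[OF W1p_gradientD(1)[OF v], of b]]
      Lp_add[OF Lp_scaleR[OF W1p_gradientD(2)[OF u], of a] Lp_scaleR[OF W1p_gradientD(2)[OF v], of b]] by auto
  fix \<phi> e assume \<phi>: "\<phi> \<in> test_functions S" and e: "e \<in> (Basis :: 'a set)"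
  let ?d = "\<lambda>x. frechet_derivative \<phi> (at x) e"
  obtain c where c: "\<And>x. \<bar>\<phi> x\<bar> \<le> c" "\<And>x. \<bar>?d x\<bar> \<le> c" "\<phi> \<in> borel_measurable L" "?d \<in> borel_measurable L"
    using test_function_bounds[OF \<phi> e] by metis
  have i: "integrable L (\<lambda>x. w x * ?d x)" "integrable L (\<lambda>x. (W x \<bullet> e) * \<phi> x)" if "W1p_gradient p S w W" for w W
    using W1p_gradientD(4,5)[OF that] c by (auto intro!: integrable_mult_bounded)
  have "(\<integral>x. (a * u x + b * v x) * ?d x \<partial>L) = (\<integral>x. a * (u x * ?d x) + b * (v x * ?d x) \<partial>L)"
    by (simp add: algebra_simps)
  also have "\<dots> = a * (\<integral>x. u x * ?d x \<partial>L) + b * (\<integral>x. v x * ?d x \<partial>L)"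
    using i[OF u] i[OF v] by simp
  also have "\<dots> = - (a * (\<integral>x. (G x \<bullet> e) * \<phi> x \<partial>L) + b * (\<integral>x. (H x \<bullet> e) * \<phi> x \<partial>L))"
    by (simp add: W1p_gradient_test[OF u \<phi> e] W1p_gradient_test[OF v \<phi> e])
  also have "\<dots> = - (\<integral>x. a * ((G x \<bullet> e) * \<phi> x) + b * ((H x \<bullet> e) * \<phi> x) \<partial>L)"
    using i[OF u] i[OF v] by simp
  also have "\<dots> = - (\<integral>x. ((a *\<^sub>R G x + b *\<^sub>R H x) \<bullet> e) * \<phi> x \<partial>L)"
    by (simp add: algebra_simps)
  finally show "(\<integral>x. (a * u x + b * v x) * ?d x \<partial>L) = - (\<integral>x. ((a *\<^sub>R G x + b *\<^sub>R H x) \<bullet> e) * \<phi> x \<partial>L)" .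
qed

lemma W1p_gradient_diff:
  assumes "W1p_gradient p S u G" "W1p_gradient p S v H"
  shows "W1p_gradient p S (\<lambda>x. u x - v x) (\<lambda>x. G x - H x)"
  using W1p_gradient_linear[OF assms, of 1 "-1"] by simp

lemma W1p_gradient_zero: "W1p_gradient p S (\<lambda>x. 0) (\<lambda>x. 0)"
  by (rule W1p_gradientI) (auto simp: Lp_const)

lemma W1p_gradient_compose:
  assumes u: "W1p_gradient p S u G"
    and F: "\<And>t. (F has_real_derivative F' t) (at t)" and F': "continuous_on UNIV F'" and C: "\<And>t. \<bar>F' t\<bar> \<le> C"
  shows "W1p_gradient p S (\<lambda>x. F (u x)) (\<lambda>x. F' (u x) *\<^sub>R G x)"
proof -
  note D = W1p_gradientD[OF u]
  have C0: "C \<ge> 0" using C[of 0] by linarith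
  have Fc: "continuous_on UNIV F" using F by (meson DERIV_isCont continuous_at_imp_continuous_on)
  have Fm [measurable]: "F \<in> borel_measurable borel" "F' \<in> borel_measurable borel"
    using Fc F' by (auto intro: borel_measurable_continuous_onI)
  note [measurable] = D(6,7)
  have lip: "\<bar>F s - F t\<bar> \<le> C * \<bar>s - t\<bar>" for s t
    using field_differentiable_bound[where S=UNIV and f=F and f'=F' and B=C, OF convex_UNIV] F C by auto
  have "\<bar>F s - F 0\<bar> \<le> C * \<bar>s\<bar>" for s using lip[of s 0] by simp
  then have Fu: "(\<lambda>x. F (u x) - F 0) \<in> Lp p S"
    by (intro Lp_bound[OF D(1) _ _ C0]) auto
  from Lp_add[OF this Lp_const[of "F 0"]] have "(\<lambda>x. F (u x)) \<in> Lp p S" by simp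
  moreover have "(\<lambda>x. F' (u x) *\<^sub>R G x) \<in> Lp p S"
    using C by (intro Lp_bound[OF D(2) _ _ C0]) (auto intro!: mult_right_mono)
  ultimately show ?thesis
    using has_weak_gradient_compose[OF open_S D(4,5,3) F F' C] by (simp add: W1p_gradient_def)
qed

text \<open>By \<open>crude_Young\<close> with \<open>y = 1\<close>, the norm is at most a small constant, integrable over the finite
measure, plus a multiple of its \<open>q\<close>-th power.\<close>

lemma powr_conv_imp_L1_conv:
  fixes w :: "nat \<Rightarrow> 'a \<Rightarrow> 'b::{banach,second_countable_topology}"
  assumes q: "q > 1" and [measurable]: "\<And>n. w n \<in> borel_measurable L" and i: "\<And>n. integrable L (\<lambda>x. norm (w n x) powr q)"
    and lim: "(\<lambda>n. \<integral>x. norm (w n x) powr q \<partial>L) \<longlonglongrightarrow> 0"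
  shows "(\<lambda>n. \<integral>x. norm (w n x) \<partial>L) \<longlonglongrightarrow> 0" "integrable L (w n)"
proof -
  have pt: "norm y \<le> \<eta> powr (q - 1) * norm y powr q + 1 / \<eta>" if "\<eta> > 0" for \<eta> and y :: 'b
    using crude_Young[of "norm y" 1 \<eta> q] that q by simp
  have i1: "integrable L (w n)" for n
  proof (rule Bochner_Integration.integrable_bound[where f="\<lambda>x. 1 powr (q - 1) * norm (w n x) powr q + 1 / 1"])
    show "AE x in L. norm (w n x) \<le> norm (1 powr (q - 1) * norm (w n x) powr q + 1 / 1)"
      using pt[of 1] by (auto intro!: AE_I2 order_trans[OF pt[of 1]])
  qed (use i in auto)
  show "integrable L (w n)" by (rule i1)
  define V where "V = measure L S"
  show "(\<lambda>n. \<integral>x. norm (w n x) \<partial>L) \<longlonglongrightarrow> 0"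
  proof (rule LIMSEQ_I)
    fix e :: real assume e: "e > 0"
    define \<eta> where "\<eta> = 2 * (V + 1) / e"
    have V: "V \<ge> 0" by (simp add: V_def)
    have \<eta>: "\<eta> > 0" using e V by (simp add: \<eta>_def)
    have "(\<lambda>n. \<eta> powr (q - 1) * (\<integral>x. norm (w n x) powr q \<partial>L)) \<longlonglongrightarrow> 0"
      using tendsto_mult_left[OF lim, of "\<eta> powr (q - 1)"] by simp
    then have "eventually (\<lambda>n. \<eta> powr (q - 1) * (\<integral>x. norm (w n x) powr q \<partial>L) < e / 2) sequentially"
      using e by (intro order_tendstoD(2)) auto
    then obtain N where N: "\<And>n. n \<ge> N \<Longrightarrow> \<eta> powr (q - 1) * (\<integral>x. norm (w n x) powr q \<partial>L) < e / 2"
      by (auto simp: eventually_sequentially)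
    have "(\<integral>x. norm (w n x) \<partial>L) < e" if "n \<ge> N" for n
    proof -
      have "(\<integral>x. norm (w n x) \<partial>L) \<le> (\<integral>x. \<eta> powr (q - 1) * norm (w n x) powr q + 1 / \<eta> \<partial>L)"
        using i1 i pt[OF \<eta>] by (intro integral_mono) auto
      also have "\<dots> = \<eta> powr (q - 1) * (\<integral>x. norm (w n x) powr q \<partial>L) + V / \<eta>"
        using i by (simp add: V_def)
      also have "V / \<eta> \<le> e / 2" using V e by (simp add: \<eta>_def field_simps)
      finally show ?thesis using N[OF that] by linarith
    qed
    then show "\<exists>no. \<forall>n\<ge>no. norm ((\<integral>x. norm (w n x) \<partial>L) - 0) < e" by (intro exI[of _ N]) auto
  qed
qed

lemma integral_mult_tendsto:
  fixes f :: "nat \<Rightarrow> 'a \<Rightarrow> real"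
  assumes f: "\<And>n. integrable L (f n)" and f0: "integrable L f0" and q: "q \<in> borel_measurable L" "\<And>x. \<bar>q x\<bar> \<le> c"
    and lim: "(\<lambda>n. \<integral>x. \<bar>f n x - f0 x\<bar> \<partial>L) \<longlonglongrightarrow> 0"
  shows "(\<lambda>n. \<integral>x. f n x * q x \<partial>L) \<longlonglongrightarrow> (\<integral>x. f0 x * q x \<partial>L)"
proof (rule LIM_zero_cancel, rule Lim_null_comparison)
  show "(\<lambda>n. c * (\<integral>x. \<bar>f n x - f0 x\<bar> \<partial>L)) \<longlonglongrightarrow> 0"
    using tendsto_mult_left[OF lim, of c] by simp
  show "eventually (\<lambda>n. norm ((\<integral>x. f n x * q x \<partial>L) - (\<integral>x. f0 x * q x \<partial>L)) \<le> c * (\<integral>x. \<bar>f n x - f0 x\<bar> \<partial>L)) sequentially"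
  proof (rule always_eventually, rule allI)
    fix n
    have i: "integrable L (\<lambda>x. h x * q x)" if "integrable L h" for h
      using integrable_mult_bounded[OF that q(1)] q(2) by auto
    have "(\<integral>x. f n x * q x \<partial>L) - (\<integral>x. f0 x * q x \<partial>L) = (\<integral>x. f n x * q x - f0 x * q x \<partial>L)"
      using i[OF f] i[OF f0] by simp
    also have "norm \<dots> \<le> (\<integral>x. norm (f n x * q x - f0 x * q x) \<partial>L)" by (rule integral_norm_bound)
    also have "\<dots> \<le> (\<integral>x. c * \<bar>f n x - f0 x\<bar> \<partial>L)"
    proof (rule integral_mono)
      fix x
      show "norm (f n x * q x - f0 x * q x) \<le> c * \<bar>f n x - f0 x\<bar>"
        using abs_mult_le_bound[OF q(2), of "f n x - f0 x"] by (simp add: left_diff_distrib)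
    qed (use i[OF f] i[OF f0] f f0 in auto)
    finally show "norm ((\<integral>x. f n x * q x \<partial>L) - (\<integral>x. f0 x * q x \<partial>L)) \<le> c * (\<integral>x. \<bar>f n x - f0 x\<bar> \<partial>L)" by simp
  qed
qed

lemma W1p_gradient_closed:
  assumes un: "\<And>n. W1p_gradient p S (u n) (G n)" and u: "u0 \<in> Lp p S" and G: "G0 \<in> borel_measurable L"
    and limu: "(\<lambda>n. \<integral>x. \<bar>u n x - u0 x\<bar> \<partial>L) \<longlonglongrightarrow> 0"
    and iG: "\<And>n. integrable L (\<lambda>x. norm (G n x - G0 x) powr p)"
    and limG: "(\<lambda>n. \<integral>x. norm (G n x - G0 x) powr p \<partial>L) \<longlonglongrightarrow> 0"
  shows "W1p_gradient p S u0 G0"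
proof (rule W1p_gradientI)
  note D = W1p_gradientD[OF un]
  note [measurable] = D(6,7) G
  have "(\<lambda>x. G 0 x - G0 x) \<in> Lp p S" using iG by (simp add: Lp_def)
  from Lp_add[OF D(2) Lp_scaleR[OF this, of "-1"], of 0] show GL: "G0 \<in> Lp p S" by simp
  show "u0 \<in> Lp p S" by (rule u)
  fix \<phi> e assume \<phi>: "\<phi> \<in> test_functions S" and e: "e \<in> (Basis :: 'a set)"
  let ?d = "\<lambda>x. frechet_derivative \<phi> (at x) e"
  obtain c where c: "\<And>x. \<bar>\<phi> x\<bar> \<le> c" "\<And>x. \<bar>?d x\<bar> \<le> c" "\<phi> \<in> borel_measurable L" "?d \<in> borel_measurable L"
    using test_function_bounds[OF \<phi> e] by metis
  have G1: "(\<lambda>n. \<integral>x. norm (G n x - G0 x) \<partial>L) \<longlonglongrightarrow> 0" "integrable L (\<lambda>x. G n x - G0 x)" for n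
    by (rule powr_conv_imp_L1_conv[OF p, of "\<lambda>n x. G n x - G0 x"]; use iG limG in measurable)+
  have Ge: "(\<lambda>n. \<integral>x. \<bar>G n x \<bullet> e - G0 x \<bullet> e\<bar> \<partial>L) \<longlonglongrightarrow> 0"
  proof (rule tendsto_sandwich[OF _ _ tendsto_const G1(1)])
    show "eventually (\<lambda>n. (\<integral>x. \<bar>G n x \<bullet> e - G0 x \<bullet> e\<bar> \<partial>L) \<le> (\<integral>x. norm (G n x - G0 x) \<partial>L)) sequentially"
    proof (rule always_eventually, rule allI, rule integral_mono)
      fix n x
      show "\<bar>G n x \<bullet> e - G0 x \<bullet> e\<bar> \<le> norm (G n x - G0 x)"
        using Basis_le_norm[OF e, of "G n x - G0 x"] by (simp add: inner_diff_left)
    qed (use D(5) Lp_integrable[OF GL] in auto)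
  qed auto
  have "(\<lambda>n. \<integral>x. u n x * ?d x \<partial>L) \<longlonglongrightarrow> (\<integral>x. u0 x * ?d x \<partial>L)"
    using D(4) Lp_integrable[OF u] c limu by (intro integral_mult_tendsto) auto
  moreover have "(\<lambda>n. \<integral>x. (G n x \<bullet> e) * \<phi> x \<partial>L) \<longlonglongrightarrow> (\<integral>x. (G0 x \<bullet> e) * \<phi> x \<partial>L)"
    using D(5) Lp_integrable[OF GL] c Ge by (intro integral_mult_tendsto) auto
  then have "(\<lambda>n. \<integral>x. u n x * ?d x \<partial>L) \<longlonglongrightarrow> - (\<integral>x. (G0 x \<bullet> e) * \<phi> x \<partial>L)"
    unfolding W1p_gradient_test[OF un \<phi> e] by (rule tendsto_minus)
  ultimately show "(\<integral>x. u0 x * ?d x \<partial>L) = - (\<integral>x. (G0 x \<bullet> e) * \<phi> x \<partial>L)" by (rule LIMSEQ_unique)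
qed

text \<open>Convergence in the \<open>p\<close>-th mean, paired with the flux of a fixed gradient, which lies in the dual space.\<close>

lemma flux_tendsto_zero:
  fixes W :: "nat \<Rightarrow> 'a \<Rightarrow> 'a"
  assumes [measurable]: "G \<in> borel_measurable L" "\<And>n. W n \<in> borel_measurable L"
    and G: "integrable L (\<lambda>x. norm (G x) powr p)" and W: "\<And>n. integrable L (\<lambda>x. norm (W n x) powr p)"
    and lim: "(\<lambda>n. \<integral>x. norm (W n x) powr p \<partial>L) \<longlonglongrightarrow> 0"
  shows "(\<lambda>n. \<integral>x. norm (W n x) * norm (G x) powr (p - 1) \<partial>L) \<longlonglongrightarrow> 0"
    "integrable L (\<lambda>x. norm (W n x) * norm (G x) powr (p - 1))"
proof -
  let ?f = "\<lambda>n x. norm (W n x) * norm (G x) powr (p - 1)"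
  have pt: "?f n x \<le> \<eta> powr (p - 1) * norm (W n x) powr p + norm (G x) powr p / \<eta>" if "\<eta> > 0" for \<eta> n x
    by (rule crude_Young) (use that p in auto)
  have i1: "integrable L (?f n)" for n
  proof (rule Bochner_Integration.integrable_bound[where f="\<lambda>x. 1 powr (p - 1) * norm (W n x) powr p + norm (G x) powr p / 1"])
    show "AE x in L. norm (?f n x) \<le> norm (1 powr (p - 1) * norm (W n x) powr p + norm (G x) powr p / 1)"
      using pt[of 1 n] by (auto simp: abs_mult)
  qed (use W G in auto)
  show "integrable L (?f n)" by (rule i1)
  define V where "V = (\<integral>x. norm (G x) powr p \<partial>L)"
  show "(\<lambda>n. \<integral>x. ?f n x \<partial>L) \<longlonglongrightarrow> 0"
  proof (rule LIMSEQ_I)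
    fix e :: real assume e: "e > 0"
    define \<eta> where "\<eta> = 2 * (V + 1) / e"
    have V: "V \<ge> 0" by (simp add: V_def)
    have \<eta>: "\<eta> > 0" using e V by (simp add: \<eta>_def)
    have "(\<lambda>n. \<eta> powr (p - 1) * (\<integral>x. norm (W n x) powr p \<partial>L)) \<longlonglongrightarrow> 0"
      using tendsto_mult_left[OF lim, of "\<eta> powr (p - 1)"] by simp
    then have "eventually (\<lambda>n. \<eta> powr (p - 1) * (\<integral>x. norm (W n x) powr p \<partial>L) < e / 2) sequentially"
      using e by (intro order_tendstoD(2)) auto
    then obtain N where N: "\<And>n. n \<ge> N \<Longrightarrow> \<eta> powr (p - 1) * (\<integral>x. norm (W n x) powr p \<partial>L) < e / 2"
      by (auto simp: eventually_sequentially)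
    have "(\<integral>x. ?f n x \<partial>L) < e" if "n \<ge> N" for n
    proof -
      have "(\<integral>x. ?f n x \<partial>L) \<le> (\<integral>x. \<eta> powr (p - 1) * norm (W n x) powr p + norm (G x) powr p / \<eta> \<partial>L)"
        using i1 W G pt[OF \<eta>] by (intro integral_mono) auto
      also have "\<dots> = \<eta> powr (p - 1) * (\<integral>x. norm (W n x) powr p \<partial>L) + V / \<eta>"
        using W G by (simp add: V_def)
      also have "V / \<eta> \<le> e / 2" using V e by (simp add: \<eta>_def field_simps)
      finally show ?thesis using N[OF that] by linarith
    qed
    moreover have "(\<integral>x. ?f n x \<partial>L) \<ge> 0" for n by (intro Bochner_Integration.integral_nonneg) simp
    ultimately show "\<exists>no. \<forall>n\<ge>no. norm ((\<integral>x. ?f n x \<partial>L) - 0) < e" by (intro exI[of _ N]) auto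
  qed
qed

end

section \<open>Minimisation of the energy\<close>

text \<open>The deterministic problem for one weight \<open>g\<close>.  Test functions are all bounded Sobolev functions on \<open>S\<close>,
so the natural boundary condition is built into the weak formulation.\<close>

locale neumann_problem = sobolev_domain S p for S :: "'a::euclidean_space set" and p :: real +
  fixes g1 g2 :: real and g :: "'a \<Rightarrow> real"
  assumes g1: "0 < g1" and g12: "g1 \<le> g2" and g_meas [measurable]: "g \<in> borel_measurable (lebesgue_on S)"
    and g_bounds: "AE x in lebesgue_on S. g1 \<le> g x \<and> g x \<le> g2"
begin

lemma flux_bound:
  fixes G W :: "'a \<Rightarrow> 'a"
  shows "AE x in L. \<bar>g x * (pflux p (G x) \<bullet> W x)\<bar> \<le> g2 * (norm (W x) * norm (G x) powr (p - 1))"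
  using g_bounds
proof eventually_elim
  case (elim x)
  have "\<bar>g x * (pflux p (G x) \<bullet> W x)\<bar> = g x * \<bar>pflux p (G x) \<bullet> W x\<bar>" using elim g1 by (simp add: abs_mult)
  also have "\<dots> \<le> g2 * (norm (G x) powr (p - 1) * norm (W x))"
    using elim g1 pflux_inner_le by (intro mult_mono) auto
  finally show ?case by (simp add: mult.commute)
qed

lemma flux_integrable:
  fixes G W :: "'a \<Rightarrow> 'a"
  assumes [measurable]: "G \<in> borel_measurable L" "W \<in> borel_measurable L"
    and "integrable L (\<lambda>x. norm (G x) powr p)" "integrable L (\<lambda>x. norm (W x) powr p)"
  shows "integrable L (\<lambda>x. g x * (pflux p (G x) \<bullet> W x))"
proof (rule Bochner_Integration.integrable_bound[where f="\<lambda>x. g2 * (norm (W x) powr p + norm (G x) powr p)"])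
  show "AE x in L. norm (g x * (pflux p (G x) \<bullet> W x)) \<le> norm (g2 * (norm (W x) powr p + norm (G x) powr p))"
    using flux_bound[of G W] g_bounds
  proof eventually_elim
    case (elim x)
    have "norm (W x) * norm (G x) powr (p - 1) \<le> norm (W x) powr p + norm (G x) powr p"
      using crude_Young[of "norm (W x)" "norm (G x)" 1 p] p by simp
    then have "g2 * (norm (W x) * norm (G x) powr (p - 1)) \<le> g2 * (norm (W x) powr p + norm (G x) powr p)"
      using elim g1 by (intro mult_left_mono) auto
    then show ?case using elim by (simp add: abs_le_iff le_max_iff_disj)
  qed
  have [measurable]: "(\<lambda>x. pflux p (G x)) \<in> borel_measurable L" by (rule pflux_measurable[OF p assms(1)])
  show "(\<lambda>x. g x * (pflux p (G x) \<bullet> W x)) \<in> borel_measurable L" by measurable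
qed (use assms in auto)

lemma flux_integrable_W1p:
  assumes "W1p_gradient p S u G" "W1p_gradient p S v H"
  shows "integrable L (\<lambda>x. g x * (pflux p (G x) \<bullet> H x))"
  using assms by (intro flux_integrable W1p_gradientD)

definition energy :: "('a \<Rightarrow> real) \<Rightarrow> ('a \<Rightarrow> real) \<Rightarrow> ('a \<Rightarrow> 'a) \<Rightarrow> 'a \<Rightarrow> real"
  where "energy h u G x = g x / p * norm (G x) powr p + ((u x)\<^sup>2 / 2 - h x * u x)"

text \<open>The bound \<open>k\<close> is a convex constraint.  It keeps the minimising sequence bounded, so that convergence in
quadratic mean suffices for membership in the Sobolev space for every \<open>p\<close>.\<close>

definition admissible :: "real \<Rightarrow> ('a \<Rightarrow> real) \<Rightarrow> ('a \<Rightarrow> 'a) \<Rightarrow> bool"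
  where "admissible k u G \<longleftrightarrow> W1p_gradient p S u G \<and> (AE x in L. \<bar>u x\<bar> \<le> k)"

lemma weighted_powr_integrable:
  assumes "W1p_gradient p S u G"
  shows "integrable L (\<lambda>x. g x / p * norm (G x) powr p)"
proof (rule Bochner_Integration.integrable_bound[where f="\<lambda>x. g2 / p * norm (G x) powr p"])
  note [measurable] = W1p_gradientD(7)[OF assms]
  show "(\<lambda>x. g x / p * norm (G x) powr p) \<in> borel_measurable L" by measurable
  show "AE x in L. norm (g x / p * norm (G x) powr p) \<le> norm (g2 / p * norm (G x) powr p)"
    using g_bounds
  proof eventually_elim
    case (elim x)
    then show ?case using g1 p by (auto simp: abs_mult intro!: mult_right_mono divide_right_mono)
  qed
qed (use W1p_gradientD(8)[OF assms] in auto)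

lemma lower_order_integrable:
  assumes "admissible k u G" "h \<in> borel_measurable L" "AE x in L. \<bar>h x\<bar> \<le> m"
  shows "integrable L (\<lambda>x. (u x)\<^sup>2 / 2 - h x * u x)"
proof (rule integrable_bounded_AE)
  note [measurable] = assms(2)
  have [measurable]: "u \<in> borel_measurable L" using assms(1) W1p_gradientD(6) by (auto simp: admissible_def)
  show "(\<lambda>x. (u x)\<^sup>2 / 2 - h x * u x) \<in> borel_measurable L" by measurable
  have "AE x in L. \<bar>u x\<bar> \<le> k" using assms(1) by (simp add: admissible_def)
  then show "AE x in L. norm ((u x)\<^sup>2 / 2 - h x * u x) \<le> k\<^sup>2 / 2 + m * k"
    using assms(3)
  proof eventually_elim
    case (elim x)
    have "\<bar>h x * u x\<bar> \<le> m * k" unfolding abs_mult using elim by (intro mult_mono) auto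
    moreover have "(u x)\<^sup>2 \<le> k\<^sup>2" using elim by (simp add: abs_le_square_iff[symmetric])
    moreover have "0 \<le> (u x)\<^sup>2" by simp
    ultimately show ?case unfolding real_norm_def abs_le_iff by linarith
  qed
qed

lemma energy_integrable:
  assumes "admissible k u G" "h \<in> borel_measurable L" "AE x in L. \<bar>h x\<bar> \<le> m"
  shows "integrable L (energy h u G)"
  unfolding energy_def[abs_def]
  using weighted_powr_integrable[of u G] lower_order_integrable[OF assms] assms(1)
  by (auto simp: admissible_def)

lemma admissible_convex:
  assumes u: "admissible k u G" and v: "admissible k v H" and t: "0 \<le> t" "t \<le> 1"
  shows "admissible k (\<lambda>x. (1 - t) * u x + t * v x) (\<lambda>x. (1 - t) *\<^sub>R G x + t *\<^sub>R H x)"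
  unfolding admissible_def
proof
  show "W1p_gradient p S (\<lambda>x. (1 - t) * u x + t * v x) (\<lambda>x. (1 - t) *\<^sub>R G x + t *\<^sub>R H x)"
    using u v by (intro W1p_gradient_linear) (auto simp: admissible_def)
  have "AE x in L. \<bar>u x\<bar> \<le> k" "AE x in L. \<bar>v x\<bar> \<le> k" using u v by (auto simp: admissible_def)
  then show "AE x in L. \<bar>(1 - t) * u x + t * v x\<bar> \<le> k"
  proof eventually_elim
    case (elim x)
    have "\<bar>(1 - t) * u x + t * v x\<bar> \<le> (1 - t) * \<bar>u x\<bar> + t * \<bar>v x\<bar>"
      using t abs_triangle_ineq[of "(1 - t) * u x" "t * v x"] by (simp add: abs_mult)
    also have "\<dots> \<le> (1 - t) * k + t * k" using t elim by (intro add_mono mult_left_mono) auto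
    finally show ?case by (simp add: algebra_simps)
  qed
qed

text \<open>The energy of the midpoint falls short of the mean energy by exactly the two gaps that control the
distance of gradients and of functions.\<close>

lemma energy_midpoint:
  "(energy h u G x + energy h v H x) / 2 -
    energy h (\<lambda>x. (1 - 1/2) * u x + 1/2 * v x) (\<lambda>x. (1 - 1/2) *\<^sub>R G x + (1/2) *\<^sub>R H x) x =
   g x / p * pgap p (G x) (H x) + (u x - v x)\<^sup>2 / 8"
proof -
  have "(1 - 1/2) *\<^sub>R G x + (1/2) *\<^sub>R H x = (1/2) *\<^sub>R (G x + H x)" by (simp add: scaleR_right_distrib)
  then show ?thesis unfolding energy_def pgap_def by (simp add: algebra_simps power2_eq_square add_divide_distrib diff_divide_distrib)
qed

lemma energy_subgradient:
  assumes "0 \<le> g x"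
  shows "energy h u G x + (g x * (pflux p (G x) \<bullet> (H x - G x)) + (u x - h x) * (v x - u x)) \<le> energy h v H x"
proof -
  have "g x / p * (norm (G x) powr p + p * (pflux p (G x) \<bullet> (H x - G x))) \<le> g x / p * norm (H x) powr p"
    using assms p pflux_subgradient[OF p, of "G x" "H x"] by (intro mult_left_mono) auto
  then have 1: "g x / p * norm (G x) powr p + g x * (pflux p (G x) \<bullet> (H x - G x)) \<le> g x / p * norm (H x) powr p"
    using p by (simp add: distrib_left)
  have "0 \<le> (v x - u x)\<^sup>2" by simp
  then have "(u x)\<^sup>2 / 2 - h x * u x + (u x - h x) * (v x - u x) \<le> (v x)\<^sup>2 / 2 - h x * v x"
    by (simp add: power2_eq_square algebra_simps)
  with 1 show ?thesis unfolding energy_def by linarith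
qed

text \<open>For almost minimisers, \<open>energy_midpoint\<close> bounds both gaps by the excess over the infimum; uniform
convexity turns this into the Cauchy property in norm.  The limit is a minimiser because the
subgradient inequality at the limit gives lower semicontinuity under strong convergence.\<close>

lemma ex_minimiser:
  assumes h: "h \<in> borel_measurable L" "AE x in L. \<bar>h x\<bar> \<le> m" and k: "k \<ge> 0" and m: "m \<ge> 0"
  shows "\<exists>u G. admissible k u G \<and> (\<forall>v H. admissible k v H \<longrightarrow> (\<integral>x. energy h u G x \<partial>L) \<le> (\<integral>x. energy h v H x \<partial>L))"
proof -
  note [measurable] = h(1)
  define J where "J u G = (\<integral>x. energy h u G x \<partial>L)" for u G
  define A where "A = {J u G | u G. admissible k u G}"
  define \<mu> where "\<mu> = Inf A"
  define vol where "vol = measure L S"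
  have vol: "vol \<ge> 0" by (simp add: vol_def)
  note iE = energy_integrable[OF _ h]
  have lower: "g1 / p * (\<integral>x. norm (G x) powr p \<partial>L) - m * k * vol \<le> J u G" if a: "admissible k u G" for u G
  proof -
    have W: "W1p_gradient p S u G" and ub: "AE x in L. \<bar>u x\<bar> \<le> k" using a by (auto simp: admissible_def)
    have "(\<integral>x. g1 / p * norm (G x) powr p - m * k \<partial>L) \<le> J u G"
      unfolding J_def
    proof (rule integral_mono_AE)
      show "AE x in L. g1 / p * norm (G x) powr p - m * k \<le> energy h u G x"
        using ub h(2) g_bounds
      proof eventually_elim
        case (elim x)
        have "\<bar>h x * u x\<bar> \<le> m * k" unfolding abs_mult using elim by (intro mult_mono) auto
        moreover have "g1 / p * norm (G x) powr p \<le> g x / p * norm (G x) powr p"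
          using elim p by (intro mult_right_mono divide_right_mono) auto
        moreover have "0 \<le> (u x)\<^sup>2 / 2" by simp
        ultimately show ?case unfolding energy_def by linarith
      qed
    qed (use W1p_gradientD(8)[OF W] iE[OF a] in auto)
    then show ?thesis using W1p_gradientD(8)[OF W] by (simp add: vol_def mult_ac)
  qed
  have bb: "bdd_below A"
  proof (rule bdd_belowI)
    fix y assume "y \<in> A"
    then obtain u G where uG: "y = J u G" "admissible k u G" by (auto simp: A_def)
    have "0 \<le> g1 / p * (\<integral>x. norm (G x) powr p \<partial>L)" using g1 p by (intro mult_nonneg_nonneg) auto
    then show "- (m * k * vol) \<le> y" using lower[OF uG(2)] uG(1) by linarith
  qed
  have "admissible k (\<lambda>x. 0) (\<lambda>x. 0)" using W1p_gradient_zero k by (simp add: admissible_def)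
  then have ne: "A \<noteq> {}" by (auto simp: A_def)
  have \<mu>: "\<mu> \<le> J u G" if "admissible k u G" for u G
    unfolding \<mu>_def using bb that by (intro cInf_lower) (auto simp: A_def)
  have "\<exists>u G. admissible k u G \<and> J u G < \<mu> + 1 / real (Suc n)" for n
  proof -
    have "Inf A < \<mu> + 1 / real (Suc n)" by (simp add: \<mu>_def)
    then obtain y where "y \<in> A" "y < \<mu> + 1 / real (Suc n)" using cInf_lessD[OF ne] by blast
    then show ?thesis by (auto simp: A_def)
  qed
  then obtain u G where uG: "\<And>n. admissible k (u n) (G n)" "\<And>n. J (u n) (G n) < \<mu> + 1 / real (Suc n)" by metis
  have W: "W1p_gradient p S (u n) (G n)" and ub: "AE x in L. \<bar>u n x\<bar> \<le> k" for n
    using uG(1) by (auto simp: admissible_def)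
  note D = W1p_gradientD[OF W]
  note [measurable] = D(6,7)
  define \<tau> where "\<tau> n = 1 / real (Suc n)" for n
  have \<tau>0: "\<tau> \<longlonglongrightarrow> 0" unfolding \<tau>_def[abs_def] using LIMSEQ_inverse_real_of_nat by (simp add: inverse_eq_divide)
  have ud: "integrable L (\<lambda>x. (u n x - u l x)\<^sup>2)" for n l
  proof (rule integrable_bounded_AE)
    show "AE x in L. norm ((u n x - u l x)\<^sup>2) \<le> (2 * k)\<^sup>2"
      using ub[of n] ub[of l]
    proof eventually_elim
      case (elim x)
      then have "\<bar>u n x - u l x\<bar> \<le> 2 * k" by linarith
      moreover have "2 * k \<ge> 0" using k by simp
      ultimately have "(u n x - u l x)\<^sup>2 \<le> (2 * k)\<^sup>2" using power2_le_iff_abs_le by blast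
      then show ?case by simp
    qed
  qed measurable
  have pg: "integrable L (\<lambda>x. pgap p (G n x) (G l x))" for n l
  proof -
    have "integrable L (\<lambda>x. norm ((1/2) *\<^sub>R (G n x + G l x)) powr p)"
      using Lp_powr[OF Lp_scaleR[OF Lp_add[OF D(2) D(2)]]] .
    then show ?thesis unfolding pgap_def using D(8) by auto
  qed
  have mid: "(y + z) / 2 - w \<le> s / 2 + t / 2" if "\<mu> \<le> w" "y < \<mu> + s" "z < \<mu> + t" for w y z s t :: real
    using that by (simp add: field_simps)
  have gap: "g1 / p * (\<integral>x. pgap p (G n x) (G l x) \<partial>L) + (\<integral>x. (u n x - u l x)\<^sup>2 \<partial>L) / 8 \<le> \<tau> n / 2 + \<tau> l / 2" for n l
  proof -
    let ?w = "\<lambda>x. (1 - 1/2) * u n x + 1/2 * u l x" and ?W = "\<lambda>x. (1 - 1/2) *\<^sub>R G n x + (1/2) *\<^sub>R G l x"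
    have a: "admissible k ?w ?W" by (rule admissible_convex[OF uG(1) uG(1)]) auto
    have "(\<integral>x. g1 / p * pgap p (G n x) (G l x) + (u n x - u l x)\<^sup>2 / 8 \<partial>L) \<le>
       (\<integral>x. (energy h (u n) (G n) x + energy h (u l) (G l) x) / 2 - energy h ?w ?W x \<partial>L)"
    proof (rule integral_mono_AE)
      show "AE x in L. g1 / p * pgap p (G n x) (G l x) + (u n x - u l x)\<^sup>2 / 8 \<le>
          (energy h (u n) (G n) x + energy h (u l) (G l) x) / 2 - energy h ?w ?W x"
        using g_bounds
      proof eventually_elim
        case (elim x)
        have "g1 / p * pgap p (G n x) (G l x) \<le> g x / p * pgap p (G n x) (G l x)"
          using elim p by (intro mult_right_mono divide_right_mono pgap_nonneg) auto
        then show ?case unfolding energy_midpoint by simp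
      qed
    qed (use iE[OF uG(1)] iE[OF a] pg ud in auto)
    also have "\<dots> = (J (u n) (G n) + J (u l) (G l)) / 2 - J ?w ?W"
      using iE[OF uG(1)] iE[OF a] by (simp add: J_def)
    also have "\<dots> \<le> \<tau> n / 2 + \<tau> l / 2"
      by (rule mid[OF \<mu>[OF a] uG(2)[of n, folded \<tau>_def] uG(2)[of l, folded \<tau>_def]])
    finally show ?thesis using pg ud by simp
  qed
  have gap1: "(\<integral>x. pgap p (G n x) (G l x) \<partial>L) \<le> p / g1 * (\<tau> n + \<tau> l)" for n l
  proof -
    have "(\<integral>x. (u n x - u l x)\<^sup>2 \<partial>L) \<ge> 0" by (intro Bochner_Integration.integral_nonneg) simp
    moreover have "\<tau> n + \<tau> l \<ge> 0" by (simp add: \<tau>_def)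
    ultimately have "g1 / p * (\<integral>x. pgap p (G n x) (G l x) \<partial>L) \<le> \<tau> n + \<tau> l" using gap[of n l] by linarith
    then have "p / g1 * (g1 / p * (\<integral>x. pgap p (G n x) (G l x) \<partial>L)) \<le> p / g1 * (\<tau> n + \<tau> l)"
      using p g1 by (intro mult_left_mono) auto
    then show ?thesis using p g1 by simp
  qed
  have gap2: "(\<integral>x. (u n x - u l x)\<^sup>2 \<partial>L) \<le> 4 * (\<tau> n + \<tau> l)" for n l
  proof -
    have "(\<integral>x. pgap p (G n x) (G l x) \<partial>L) \<ge> 0" by (intro Bochner_Integration.integral_nonneg pgap_nonneg p)
    then have "g1 / p * (\<integral>x. pgap p (G n x) (G l x) \<partial>L) \<ge> 0" using p g1 by simp
    then show ?thesis using gap[of n l] by argo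
  qed
  define B where "B = p / g1 * (\<mu> + 1 + m * k * vol)"
  have B: "(\<integral>x. norm (G n x) powr p \<partial>L) \<le> B" for n
  proof -
    have "1 / real (Suc n) \<le> 1" by simp
    then have "g1 / p * (\<integral>x. norm (G n x) powr p \<partial>L) \<le> \<mu> + 1 + m * k * vol"
      using lower[OF uG(1), of n] uG(2)[of n] by linarith
    then have "p / g1 * (g1 / p * (\<integral>x. norm (G n x) powr p \<partial>L)) \<le> B"
      unfolding B_def using p g1 by (intro mult_left_mono) auto
    then show ?thesis using p g1 by simp
  qed
  have B0: "B \<ge> 0"
    using B[of 0] order_trans[of 0 "\<integral>x. norm (G 0 x) powr p \<partial>L" B] by (simp add: Bochner_Integration.integral_nonneg)
  have iGd: "integrable L (\<lambda>x. norm (G n x - G l x) powr p)" for n l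
    using p D(7,8) by (intro integrable_norm_powr_diff) auto
  have small: "\<exists>N. \<forall>n\<ge>N. \<tau> n < e" if "e > 0" for e
    using order_tendstoD(2)[OF \<tau>0 that] by (simp add: eventually_sequentially)
  obtain G0 where G0: "G0 \<in> borel_measurable L" "\<And>n. integrable L (\<lambda>x. norm (G n x - G0 x) powr p)"
     "(\<lambda>n. \<integral>x. norm (G n x - G0 x) powr p \<partial>L) \<longlonglongrightarrow> 0"
  proof (rule Lp_complete[of p G L])
    show "p > 0" using p by simp
    fix e :: real assume e: "e > 0"
    \<comment> \<open>\<open>\<epsilon>\<close> makes the bounded energies contribute at most \<open>e / 2\<close>, \<open>\<sigma>\<close> below the gaps\<close>
    define \<epsilon> where "\<epsilon> = e / (4 * (B + 1))"
    have \<epsilon>: "\<epsilon> > 0" using e B0 by (simp add: \<epsilon>_def)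
    obtain C where C: "C \<ge> 0" "\<And>a b::'a. norm (a - b) powr p \<le> \<epsilon> * (norm a powr p + norm b powr p) + C * pgap p a b"
      using p_uniform_convexity[OF p \<epsilon>, where 'a='a] by blast
    define \<sigma> where "\<sigma> = e / (4 * (C * (p / g1) + 1))"
    have Cp: "C * (p / g1) \<ge> 0" using C p g1 by simp
    then have \<sigma>: "\<sigma> > 0" using e by (simp add: \<sigma>_def)
    obtain N where N: "\<And>n. n \<ge> N \<Longrightarrow> \<tau> n < \<sigma>" using small[OF \<sigma>] by blast
    have "(\<integral>x. norm (G n x - G l x) powr p \<partial>L) < e" if "n \<ge> N" "l \<ge> N" for n l
    proof -
      have "(\<integral>x. norm (G n x - G l x) powr p \<partial>L) \<le>
        (\<integral>x. \<epsilon> * (norm (G n x) powr p + norm (G l x) powr p) + C * pgap p (G n x) (G l x) \<partial>L)"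
        by (rule integral_mono) (use iGd D(8) pg C in auto)
      also have "\<dots> = \<epsilon> * ((\<integral>x. norm (G n x) powr p \<partial>L) + (\<integral>x. norm (G l x) powr p \<partial>L)) + C * (\<integral>x. pgap p (G n x) (G l x) \<partial>L)"
        using D(8) pg by simp
      also have "\<dots> \<le> \<epsilon> * (B + B) + C * (p / g1 * (\<tau> n + \<tau> l))"
        using B \<epsilon> C gap1 by (intro add_mono mult_left_mono) auto
      also have "\<epsilon> * (B + B) \<le> e / 2"
      proof -
        have "\<epsilon> * (B + B) \<le> \<epsilon> * (2 * (B + 1))" using \<epsilon> by (intro mult_left_mono) auto
        also have "\<dots> = e / 2" using B0 by (simp add: \<epsilon>_def field_simps)
        finally show ?thesis .
      qed
      also have "C * (p / g1 * (\<tau> n + \<tau> l)) < e / 2"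
      proof -
        have "C * (p / g1 * (\<tau> n + \<tau> l)) = C * (p / g1) * (\<tau> n + \<tau> l)" by simp
        also have "\<dots> \<le> C * (p / g1) * (2 * \<sigma>)" using Cp N[OF that(1)] N[OF that(2)] by (intro mult_left_mono) auto
        also have "\<dots> < (C * (p / g1) + 1) * (2 * \<sigma>)" using \<sigma> by (intro mult_strict_right_mono) auto
        also have "\<dots> = e / 2"
        proof -
          have "(q + 1) * (2 * (e / (4 * (q + 1)))) = e / 2" if "q \<ge> 0" for q :: real
            using that by (simp add: field_simps)
          from this[OF Cp] show ?thesis by (simp only: \<sigma>_def)
        qed
        finally show ?thesis .
      qed
      finally show ?thesis by simp
    qed
    then show "\<exists>N. \<forall>n\<ge>N. \<forall>l\<ge>N. (\<integral>x. norm (G n x - G l x) powr p \<partial>L) < e" by blast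
  qed (use iGd D(7) in auto)
  have p2: "norm (y::real) powr 2 = y\<^sup>2" for y by simp
  obtain u0 where u0: "u0 \<in> borel_measurable L" "\<And>n. integrable L (\<lambda>x. norm (u n x - u0 x) powr 2)"
     "(\<lambda>n. \<integral>x. norm (u n x - u0 x) powr 2 \<partial>L) \<longlonglongrightarrow> 0"
  proof (rule Lp_complete[of 2 u L])
    fix e :: real assume e: "e > 0"
    then have "e / 8 > 0" by simp
    obtain N where N: "\<And>n. n \<ge> N \<Longrightarrow> \<tau> n < e / 8" using small[OF \<open>e / 8 > 0\<close>] by blast
    have "(\<integral>x. norm (u n x - u l x) powr 2 \<partial>L) < e" if "n \<ge> N" "l \<ge> N" for n l
      using gap2[of n l] N[OF that(1)] N[OF that(2)] unfolding p2 by argo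
    then show "\<exists>N. \<forall>n\<ge>N. \<forall>l\<ge>N. (\<integral>x. norm (u n x - u l x) powr 2 \<partial>L) < e" by blast
  next
    show "integrable L (\<lambda>x. norm (u n x - u l x) powr 2)" for n l unfolding p2 by (rule ud)
  qed (use D(6) in auto)
  note [measurable] = u0(1) G0(1)
  have u1: "(\<lambda>n. \<integral>x. norm (u n x - u0 x) \<partial>L) \<longlonglongrightarrow> 0"
    by (rule powr_conv_imp_L1_conv(1)[of 2 "\<lambda>n x. u n x - u0 x"]) (use u0(2,3) in auto)
  have iud: "integrable L (\<lambda>x. u n x - u0 x)" for n
    by (rule powr_conv_imp_L1_conv(2)[of 2 "\<lambda>n x. u n x - u0 x"]) (use u0(2,3) in auto)
  \<comment> \<open>the constraint is closed under almost everywhere convergence\<close>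
  have u0k: "AE x in L. \<bar>u0 x\<bar> \<le> k"
  proof -
    obtain r :: "nat \<Rightarrow> nat" where "strict_mono r" and r: "AE x in L. (\<lambda>n. u (r n) x - u0 x) \<longlonglongrightarrow> 0"
      using tendsto_L1_AE_subseq[of L "\<lambda>n x. u n x - u0 x", OF iud u1] by blast
    have "AE x in L. \<forall>n. \<bar>u n x\<bar> \<le> k" using ub by (simp add: AE_all_countable)
    with r show ?thesis
    proof eventually_elim
      case (elim x)
      have "(\<lambda>n. u (r n) x) \<longlonglongrightarrow> u0 x" using elim(1) by (rule LIM_zero_cancel)
      then have "(\<lambda>n. \<bar>u (r n) x\<bar>) \<longlonglongrightarrow> \<bar>u0 x\<bar>" by (rule tendsto_rabs)
      then show ?case by (rule LIMSEQ_le_const2) (use elim in auto)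
    qed
  qed
  have W0: "W1p_gradient p S u0 G0"
    by (rule W1p_gradient_closed[OF W Lp_bounded[of u0 k] G0(1) _ G0(2,3)]) (use u1 u0k in auto)
  have a0: "admissible k u0 G0" using W0 u0k by (simp add: admissible_def)
  have "J u0 G0 \<le> \<mu>"
  proof -
    let ?f = "\<lambda>n x. norm (G n x - G0 x) * norm (G0 x) powr (p - 1)"
    have f: "(\<lambda>n. \<integral>x. ?f n x \<partial>L) \<longlonglongrightarrow> 0" "\<And>n. integrable L (?f n)"
      by (rule flux_tendsto_zero[of G0 "\<lambda>n x. G n x - G0 x"]; use G0(2,3) W1p_gradientD(8)[OF W0] in measurable)+
    have le: "J u0 G0 \<le> J (u n) (G n) + (g2 * (\<integral>x. ?f n x \<partial>L) + (k + m) * (\<integral>x. norm (u n x - u0 x) \<partial>L))" for n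
    proof -
      have "J u0 G0 \<le> (\<integral>x. energy h (u n) (G n) x + (g2 * ?f n x + (k + m) * norm (u n x - u0 x)) \<partial>L)"
        unfolding J_def
      proof (rule integral_mono_AE)
        show "AE x in L. energy h u0 G0 x \<le> energy h (u n) (G n) x + (g2 * ?f n x + (k + m) * norm (u n x - u0 x))"
          using g_bounds flux_bound[of G0 "\<lambda>x. G n x - G0 x"] u0k h(2)
        proof eventually_elim
          case (elim x)
          have "\<bar>(u0 x - h x) * (u n x - u0 x)\<bar> \<le> (k + m) * norm (u n x - u0 x)"
            unfolding abs_mult real_norm_def using elim by (intro mult_right_mono) auto
          moreover have "energy h u0 G0 x + (g x * (pflux p (G0 x) \<bullet> (G n x - G0 x)) + (u0 x - h x) * (u n x - u0 x)) \<le> energy h (u n) (G n) x"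
            using elim g1 by (intro energy_subgradient) auto
          ultimately show ?case using elim by linarith
        qed
      qed (use iE[OF a0] iE[OF uG(1)] f(2) iud in auto)
      also have "\<dots> = J (u n) (G n) + (g2 * (\<integral>x. ?f n x \<partial>L) + (k + m) * (\<integral>x. norm (u n x - u0 x) \<partial>L))"
        using iE[OF uG(1)] f(2) iud by (simp add: J_def)
      finally show ?thesis .
    qed
    have "(\<lambda>n. \<mu> + \<tau> n + (g2 * (\<integral>x. ?f n x \<partial>L) + (k + m) * (\<integral>x. norm (u n x - u0 x) \<partial>L))) \<longlonglongrightarrow> \<mu> + 0 + (g2 * 0 + (k + m) * 0)"
      by (intro tendsto_intros \<tau>0 f(1) u1)
    then have "(\<lambda>n. \<mu> + \<tau> n + (g2 * (\<integral>x. ?f n x \<partial>L) + (k + m) * (\<integral>x. norm (u n x - u0 x) \<partial>L))) \<longlonglongrightarrow> \<mu>" by simp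
    then show ?thesis
    proof (rule LIMSEQ_le_const)
      show "\<exists>N. \<forall>n\<ge>N. J u0 G0 \<le> \<mu> + \<tau> n + (g2 * (\<integral>x. ?f n x \<partial>L) + (k + m) * (\<integral>x. norm (u n x - u0 x) \<partial>L))"
      proof (intro exI allI impI)
        fix n
        show "J u0 G0 \<le> \<mu> + \<tau> n + (g2 * (\<integral>x. ?f n x \<partial>L) + (k + m) * (\<integral>x. norm (u n x - u0 x) \<partial>L))"
          using le[of n] uG(2)[of n] unfolding \<tau>_def by linarith
      qed
    qed
  qed
  then have "\<forall>v H. admissible k v H \<longrightarrow> J u0 G0 \<le> J v H" using \<mu> order_trans by blast
  with a0 show ?thesis unfolding J_def by blast
qed

end

section \<open>Bounded weak solutions\<close>

text \<open>The square makes the kink of \<open>max 0\<close> at the origin differentiable.\<close>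

lemma has_real_derivative_max0_square:
  "((\<lambda>t. (max 0 t)\<^sup>2) has_real_derivative 2 * max 0 t) (at (t::real))"
proof (cases t "0::real" rule: linorder_cases)
  case less
  have "((\<lambda>t::real. 0) has_real_derivative 2 * max 0 t) (at t)" using less by simp
  then show ?thesis
    by (rule has_field_derivative_transform_within_open[where S="{..<0}"]) (use less in auto)
next
  case greater
  have "((\<lambda>t::real. t\<^sup>2) has_real_derivative 2 * max 0 t) (at t)"
    using greater by (auto intro!: derivative_eq_intros)
  then show ?thesis
    by (rule has_field_derivative_transform_within_open[where S="{0<..}"]) (use greater in auto)
next
  case equal
  have "((\<lambda>h. ((max 0 (0 + h))\<^sup>2 - (max 0 0)\<^sup>2) / h) \<longlongrightarrow> 0) (at (0::real))"
  proof (rule Lim_null_comparison)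
    show "eventually (\<lambda>h::real. norm (((max 0 (0 + h))\<^sup>2 - (max 0 0)\<^sup>2) / h) \<le> \<bar>h\<bar>) (at 0)"
      by (rule always_eventually) (auto simp: max_def power2_eq_square)
    show "((\<lambda>h::real. \<bar>h\<bar>) \<longlongrightarrow> 0) (at 0)" by (rule tendsto_rabs_zero) simp
  qed
  then show ?thesis using equal by (simp add: DERIV_def)
qed

text \<open>A bounded \<open>C^1\<close> substitute, with bounded derivative, for the positive part: the chain rule applies to it,
it vanishes exactly for \<open>t \<le> 0\<close>, and it does not exceed \<open>t\<close> otherwise.\<close>

definition soft_excess :: "real \<Rightarrow> real"
  where "soft_excess t = (max 0 t)\<^sup>2 / (1 + (max 0 t)\<^sup>2)"

definition soft_excess' :: "real \<Rightarrow> real"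
  where "soft_excess' t = 2 * max 0 t / (1 + (max 0 t)\<^sup>2)\<^sup>2"

lemma one_plus_square_pos: "1 + (t::real)\<^sup>2 > 0"
  by (simp add: add_pos_nonneg)

lemma soft_excess_deriv: "(soft_excess has_real_derivative soft_excess' t) (at t)"
proof -
  have "1 + (max 0 t)\<^sup>2 \<noteq> 0" using one_plus_square_pos[of "max 0 t"] by simp
  then have "((\<lambda>t. (max 0 t)\<^sup>2 / (1 + (max 0 t)\<^sup>2)) has_real_derivative
     ((2 * max 0 t) * (1 + (max 0 t)\<^sup>2) - (max 0 t)\<^sup>2 * (0 + 2 * max 0 t)) / ((1 + (max 0 t)\<^sup>2) * (1 + (max 0 t)\<^sup>2))) (at t)"
    by (intro DERIV_divide DERIV_add DERIV_const has_real_derivative_max0_square)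
  moreover have "((2 * max 0 t) * (1 + (max 0 t)\<^sup>2) - (max 0 t)\<^sup>2 * (0 + 2 * max 0 t)) / ((1 + (max 0 t)\<^sup>2) * (1 + (max 0 t)\<^sup>2)) = soft_excess' t"
    unfolding soft_excess'_def by (simp add: algebra_simps power2_eq_square)
  ultimately show ?thesis unfolding soft_excess_def[abs_def] by simp
qed

lemma soft_excess'_bounds: "0 \<le> soft_excess' t" "soft_excess' t \<le> 1"
proof -
  let ?s = "max 0 t" and ?q = "1 + (max 0 t)\<^sup>2"
  have q: "?q \<ge> 1" by simp
  show "0 \<le> soft_excess' t" unfolding soft_excess'_def by (intro divide_nonneg_nonneg) auto
  have "0 \<le> (1 - ?s)\<^sup>2" by simp
  then have "2 * ?s \<le> ?q" by (simp add: power2_eq_square algebra_simps)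
  also have "?q \<le> ?q\<^sup>2" using mult_left_mono[OF q, of ?q] by (simp add: power2_eq_square)
  finally have "2 * ?s \<le> ?q\<^sup>2" .
  moreover have "?q\<^sup>2 > 0" using q by (intro zero_less_power) linarith
  ultimately show "soft_excess' t \<le> 1" unfolding soft_excess'_def by (simp only: divide_le_eq_1) auto
qed

lemma soft_excess_props: "soft_excess t \<ge> 0" "t \<le> 0 \<Longrightarrow> soft_excess t = 0" "t > 0 \<Longrightarrow> soft_excess t > 0"
  "t > 0 \<Longrightarrow> soft_excess t \<le> t"
proof -
  show "soft_excess t \<ge> 0" unfolding soft_excess_def by (intro divide_nonneg_nonneg) auto
  show "t \<le> 0 \<Longrightarrow> soft_excess t = 0" by (simp add: soft_excess_def)
  assume t: "t > 0"
  then have m: "max 0 t = t" by simp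
  show "soft_excess t > 0" unfolding soft_excess_def m using t one_plus_square_pos[of t] by (intro divide_pos_pos) auto
  have "t * t \<le> t * (1 + t\<^sup>2)"
  proof (rule mult_left_mono)
    have "0 \<le> (1 - t)\<^sup>2" by simp
    then have "2 * t \<le> 1 + t\<^sup>2" by (simp add: power2_eq_square algebra_simps)
    then show "t \<le> 1 + t\<^sup>2" using t by linarith
  qed (use t in simp)
  then show "soft_excess t \<le> t" unfolding soft_excess_def m
    using one_plus_square_pos[of t] by (simp add: divide_le_eq power2_eq_square)
qed

text \<open>For \<open>m \<ge> 0\<close> this is odd in \<open>s\<close> and zero exactly for \<open>|s| \<le> m\<close>; both the upper and the lower bound of a solution are read
off from a single test function.\<close>

definition excess :: "real \<Rightarrow> real \<Rightarrow> real"
  where "excess m s = soft_excess (s - m) - soft_excess (- s - m)"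

definition excess' :: "real \<Rightarrow> real \<Rightarrow> real"
  where "excess' m s = soft_excess' (s - m) + soft_excess' (- s - m)"

lemma excess_deriv: "(excess m has_real_derivative excess' m s) (at s)"
proof -
  have 1: "((\<lambda>s. soft_excess (s - m)) has_real_derivative soft_excess' (s - m) * 1) (at s)"
    by (rule DERIV_chain2[OF soft_excess_deriv]) (auto intro!: derivative_eq_intros)
  have 2: "((\<lambda>s. soft_excess (- s - m)) has_real_derivative soft_excess' (- s - m) * (-1)) (at s)"
    by (rule DERIV_chain2[OF soft_excess_deriv]) (auto intro!: derivative_eq_intros)
  show ?thesis using DERIV_diff[OF 1 2] by (simp add: excess_def[abs_def] excess'_def)
qed

lemma excess'_cont: "continuous_on UNIV (excess' m)"
  unfolding excess'_def[abs_def] soft_excess'_def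
  by (intro continuous_intros ballI) (metis one_plus_square_pos less_irrefl power_not_zero)+

lemma excess'_bounds: "0 \<le> excess' m s" "\<bar>excess' m s\<bar> \<le> 2"
  using soft_excess'_bounds[of "s - m"] soft_excess'_bounds[of "- s - m"] by (auto simp: excess'_def)

lemma excess_props:
  assumes m: "m \<ge> 0"
  shows "\<bar>s - excess m s\<bar> \<le> \<bar>s\<bar>" "\<bar>t\<bar> \<le> m \<Longrightarrow> (s - t) * excess m s \<ge> 0"
    "\<bar>t\<bar> \<le> m \<Longrightarrow> (s - t) * excess m s = 0 \<Longrightarrow> \<bar>s\<bar> \<le> m"
proof -
  consider "s > m" | "s < - m" | "\<bar>s\<bar> \<le> m" by linarith
  then have *: "\<bar>s - excess m s\<bar> \<le> \<bar>s\<bar> \<and> (\<bar>t\<bar> \<le> m \<longrightarrow> (s - t) * excess m s \<ge> 0) \<and>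
    (\<bar>t\<bar> \<le> m \<longrightarrow> (s - t) * excess m s = 0 \<longrightarrow> \<bar>s\<bar> \<le> m)"
  proof cases
    case 1
    then have e: "excess m s = soft_excess (s - m)" using m soft_excess_props(2)[of "- s - m"] by (simp add: excess_def)
    have "0 < excess m s" "excess m s \<le> s - m" using 1 soft_excess_props(3,4)[of "s - m"] by (auto simp: e)
    then show ?thesis using 1 m by auto
  next
    case 2
    then have e: "excess m s = - soft_excess (- s - m)" using m soft_excess_props(2)[of "s - m"] by (simp add: excess_def)
    have "excess m s < 0" "excess m s \<ge> s + m" using 2 soft_excess_props(3,4)[of "- s - m"] by (auto simp: e)
    then show ?thesis using 2 m by (auto intro!: mult_nonpos_nonpos)
  next
    case 3
    then have "excess m s = 0" using soft_excess_props(2)[of "- s - m"] soft_excess_props(2)[of "s - m"] by (simp add: excess_def)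
    then show ?thesis using 3 by simp
  qed
  then show "\<bar>s - excess m s\<bar> \<le> \<bar>s\<bar>" "\<bar>t\<bar> \<le> m \<Longrightarrow> (s - t) * excess m s \<ge> 0"
    "\<bar>t\<bar> \<le> m \<Longrightarrow> (s - t) * excess m s = 0 \<Longrightarrow> \<bar>s\<bar> \<le> m" by blast+
qed

context neumann_problem
begin

lemma LinftyI: "u \<in> borel_measurable L \<Longrightarrow> AE x in L. \<bar>u x\<bar> \<le> k \<Longrightarrow> u \<in> Linfty S"
  by (auto simp: Linfty_def)

text \<open>Moving from the minimiser a distance \<open>t\<close> towards an admissible \<open>v\<close> does not decrease the energy.  By the
subgradient inequality at the moved point the increase is at most \<open>t\<close> times the first variation there;
dividing by \<open>t\<close> and letting \<open>t\<close> tend to zero gives the first variation at the minimiser.\<close>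

lemma variational_inequality:
  assumes h: "h \<in> borel_measurable L" "AE x in L. \<bar>h x\<bar> \<le> m" and u: "admissible k u G" and v: "admissible k v H"
    and min: "\<And>v H. admissible k v H \<Longrightarrow> (\<integral>x. energy h u G x \<partial>L) \<le> (\<integral>x. energy h v H x \<partial>L)"
  shows "0 \<le> (\<integral>x. g x * (pflux p (G x) \<bullet> (H x - G x)) + (u x - h x) * (v x - u x) \<partial>L)"
proof -
  note [measurable] = h(1)
  have Wu: "W1p_gradient p S u G" and Wv: "W1p_gradient p S v H"
    and ub: "AE x in L. \<bar>u x\<bar> \<le> k" and vb: "AE x in L. \<bar>v x\<bar> \<le> k"
    using u v by (auto simp: admissible_def)
  note Du = W1p_gradientD[OF Wu] and Dv = W1p_gradientD[OF Wv]
  note [measurable] = Du(6,7) Dv(6,7)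
  have Wd: "W1p_gradient p S (\<lambda>x. v x - u x) (\<lambda>x. H x - G x)" by (rule W1p_gradient_diff[OF Wv Wu])
  define t where "t n = 1 / real (Suc n)" for n
  have t: "0 < t n" "t n \<le> 1" for n by (auto simp: t_def field_simps)
  have t0: "t \<longlonglongrightarrow> 0" unfolding t_def[abs_def] using LIMSEQ_inverse_real_of_nat by (simp add: inverse_eq_divide)
  define wn where "wn n x = (1 - t n) * u x + t n * v x" for n x
  define Wn where "Wn n x = (1 - t n) *\<^sub>R G x + t n *\<^sub>R H x" for n x
  have a: "admissible k (wn n) (Wn n)" for n
    unfolding wn_def[abs_def] Wn_def[abs_def] using u v t[of n] by (intro admissible_convex) auto
  have WW: "W1p_gradient p S (wn n) (Wn n)" and wb: "AE x in L. \<bar>wn n x\<bar> \<le> k" for n using a by (auto simp: admissible_def)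
  note DW = W1p_gradientD[OF WW]
  note [measurable] = DW(6,7)
  define f where "f n x = g x * (pflux p (Wn n x) \<bullet> (H x - G x)) + (wn n x - h x) * (v x - u x)" for n x
  have bdd: "AE x in L. \<bar>(w x - h x) * (v x - u x)\<bar> \<le> (k + m) * (2 * k)" if "AE x in L. \<bar>w x\<bar> \<le> k" for w
    using that ub vb h(2)
  proof eventually_elim
    case (elim x)
    show ?case unfolding abs_mult by (rule mult_mono) (use elim in auto)
  qed
  have fi: "integrable L (f n)" for n
    unfolding f_def[abs_def]
  proof (rule Bochner_Integration.integrable_add)
    show "integrable L (\<lambda>x. g x * (pflux p (Wn n x) \<bullet> (H x - G x)))" by (rule flux_integrable_W1p[OF WW Wd])
    show "integrable L (\<lambda>x. (wn n x - h x) * (v x - u x))"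
      by (rule integrable_bounded_AE) (use bdd[OF wb] in auto)
  qed
  have pos: "0 \<le> (\<integral>x. f n x \<partial>L)" for n
  proof -
    have "(\<integral>x. energy h (wn n) (Wn n) x - t n * f n x \<partial>L) \<le> (\<integral>x. energy h u G x \<partial>L)"
    proof (rule integral_mono_AE)
      show "AE x in L. energy h (wn n) (Wn n) x - t n * f n x \<le> energy h u G x"
        using g_bounds
      proof eventually_elim
        case (elim x)
        have e1: "G x - Wn n x = - (t n *\<^sub>R (H x - G x))" by (simp add: Wn_def algebra_simps)
        have e2: "u x - wn n x = - (t n * (v x - u x))" by (simp add: wn_def algebra_simps)
        have "energy h (wn n) (Wn n) x + (g x * (pflux p (Wn n x) \<bullet> (G x - Wn n x)) + (wn n x - h x) * (u x - wn n x)) \<le> energy h u G x"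
          using elim g1 by (intro energy_subgradient) auto
        moreover have "g x * (pflux p (Wn n x) \<bullet> (G x - Wn n x)) + (wn n x - h x) * (u x - wn n x) = - (t n * f n x)"
          unfolding e1 e2 f_def by (simp add: algebra_simps)
        ultimately show ?case by linarith
      qed
    qed (use energy_integrable[OF a h] energy_integrable[OF u h] fi in auto)
    then have "(\<integral>x. energy h (wn n) (Wn n) x \<partial>L) - t n * (\<integral>x. f n x \<partial>L) \<le> (\<integral>x. energy h u G x \<partial>L)"
      using energy_integrable[OF a h] fi by simp
    then have "0 \<le> t n * (\<integral>x. f n x \<partial>L)" using min[OF a, of n] by linarith
    then show ?thesis using t(1)[of n] by (simp add: zero_le_mult_iff)
  qed
  \<comment> \<open>an integrable bound for all \<open>f n\<close>, from \<open>crude_Young\<close> and \<open>0 < t n \<le> 1\<close>\<close>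
  define bd where "bd x = g2 * (2 powr p * (norm (G x) powr p + norm (H x - G x) powr p) + norm (H x - G x) powr p) + (k + m) * (2 * k)" for x
  have "(\<lambda>n. \<integral>x. f n x \<partial>L) \<longlonglongrightarrow> (\<integral>x. g x * (pflux p (G x) \<bullet> (H x - G x)) + (u x - h x) * (v x - u x) \<partial>L)"
  proof (rule integral_dominated_convergence[where w=bd])
    show "AE x in L. (\<lambda>n. f n x) \<longlonglongrightarrow> g x * (pflux p (G x) \<bullet> (H x - G x)) + (u x - h x) * (v x - u x)"
    proof (rule AE_I2)
      fix x
      have w1: "(\<lambda>n. wn n x) \<longlonglongrightarrow> (1 - 0) * u x + 0 * v x" unfolding wn_def by (intro tendsto_intros t0)
      have W1: "(\<lambda>n. Wn n x) \<longlonglongrightarrow> (1 - 0) *\<^sub>R G x + 0 *\<^sub>R H x" unfolding Wn_def by (intro tendsto_intros t0)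
      have W2: "(\<lambda>n. pflux p (Wn n x)) \<longlonglongrightarrow> pflux p (G x)"
        by (rule continuous_on_tendsto_compose[OF continuous_pflux[OF p]]) (use W1 in auto)
      show "(\<lambda>n. f n x) \<longlonglongrightarrow> g x * (pflux p (G x) \<bullet> (H x - G x)) + (u x - h x) * (v x - u x)"
        unfolding f_def using w1 by (intro tendsto_intros W2) simp
    qed
    show "AE x in L. norm (f n x) \<le> bd x" for n
      using flux_bound[of "Wn n" "\<lambda>x. H x - G x"] bdd[OF wb[of n]] g_bounds
    proof eventually_elim
      case (elim x)
      let ?d = "H x - G x"
      have "norm ?d * norm (Wn n x) powr (p - 1) \<le> norm ?d powr p + norm (Wn n x) powr p"
        using crude_Young[of "norm ?d" "norm (Wn n x)" 1 p] p by simp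
      moreover have "norm (Wn n x) powr p \<le> 2 powr p * (norm (G x) powr p + norm ?d powr p)"
      proof -
        have eq: "Wn n x = G x + t n *\<^sub>R ?d" by (simp add: Wn_def algebra_simps)
        have "norm (Wn n x) powr p \<le> 2 powr p * (norm (G x) powr p + norm (t n *\<^sub>R ?d) powr p)"
          unfolding eq using p by (intro norm_add_powr_le) auto
        also have "norm (t n *\<^sub>R ?d) powr p \<le> norm ?d powr p"
        proof (rule powr_mono2)
          show "norm (t n *\<^sub>R ?d) \<le> norm ?d"
            using t[of n] mult_right_mono[of "t n" 1 "norm ?d"] by simp
        qed (use p in auto)
        finally show ?thesis by simp
      qed
      ultimately have "norm ?d * norm (Wn n x) powr (p - 1) \<le> 2 powr p * (norm (G x) powr p + norm ?d powr p) + norm ?d powr p"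
        by linarith
      then have "g2 * (norm ?d * norm (Wn n x) powr (p - 1)) \<le> g2 * (2 powr p * (norm (G x) powr p + norm ?d powr p) + norm ?d powr p)"
        using elim g1 by (intro mult_left_mono) auto
      then show ?case using elim unfolding f_def bd_def real_norm_def by linarith
    qed
    show "integrable L bd" unfolding bd_def[abs_def]
      using Du(8) W1p_gradientD(8)[OF Wd] by auto
    have [measurable]: "(\<lambda>x. pflux p (G x)) \<in> borel_measurable L" by (rule pflux_measurable[OF p Du(7)])
    show "(\<lambda>x. g x * (pflux p (G x) \<bullet> (H x - G x)) + (u x - h x) * (v x - u x)) \<in> borel_measurable L" by measurable
  qed (use fi in auto)
  then show ?thesis by (rule LIMSEQ_le_const) (use pos in auto)
qed

definition weak_solution :: "('a \<Rightarrow> real) \<Rightarrow> ('a \<Rightarrow> real) \<Rightarrow> ('a \<Rightarrow> 'a) \<Rightarrow> bool"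
  where "weak_solution f u G \<longleftrightarrow> W1p_gradient p S u G \<and>
    (\<forall>\<phi> \<Phi>. W1p_gradient p S \<phi> \<Phi> \<and> \<phi> \<in> Linfty S \<longrightarrow>
      (\<integral>x. g x * (pflux p (G x) \<bullet> \<Phi> x) \<partial>L) = (\<integral>x. f x * \<phi> x \<partial>L))"

lemma p_laplace_equation_iff: "p_laplace_equation p S g u f \<longleftrightarrow> (\<exists>G. weak_solution f u G)"
  unfolding p_laplace_equation_def weak_solution_def pflux_def ..

text \<open>Moving the minimiser \<open>u\<close> by the excess of \<open>u\<close> over \<open>m\<close> towards zero is admissible, and in the
variational inequality the gradient term and the lower order term then both have the wrong sign.  Hence
\<open>|u| \<le> m\<close>, which leaves room for variations \<open>\<plusminus>\<phi>/c\<close> in every bounded direction, and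
the inequality becomes an equation.\<close>

theorem ex_bounded_solution:
  assumes h: "h \<in> borel_measurable L" "AE x in L. \<bar>h x\<bar> \<le> m" and m: "m \<ge> 0"
  shows "\<exists>u G. weak_solution (\<lambda>x. h x - u x) u G \<and> (AE x in L. \<bar>u x\<bar> \<le> m)"
proof -
  note [measurable] = h(1)
  obtain u G where uG: "admissible (m + 1) u G"
     and min: "\<And>v H. admissible (m + 1) v H \<Longrightarrow> (\<integral>x. energy h u G x \<partial>L) \<le> (\<integral>x. energy h v H x \<partial>L)"
    using ex_minimiser[OF h, of "m + 1"] m by auto
  have W: "W1p_gradient p S u G" and ub: "AE x in L. \<bar>u x\<bar> \<le> m + 1" using uG by (auto simp: admissible_def)
  note D = W1p_gradientD[OF W]
  note [measurable] = D(6,7)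
  define R where "R \<phi> \<Phi> = (\<integral>x. g x * (pflux p (G x) \<bullet> \<Phi> x) + (u x - h x) * \<phi> x \<partial>L)" for \<phi> \<Phi>
  have VI: "0 \<le> R (\<lambda>x. v x - u x) (\<lambda>x. H x - G x)" if "admissible (m + 1) v H" for v H
    unfolding R_def using variational_inequality[OF h uG that min] .
  have um: "AE x in L. \<bar>u x\<bar> \<le> m"
  proof -
    let ?F = "excess m" and ?F' = "excess' m"
    have WF: "W1p_gradient p S (\<lambda>x. ?F (u x)) (\<lambda>x. ?F' (u x) *\<^sub>R G x)"
      by (rule W1p_gradient_compose[OF W excess_deriv excess'_cont excess'_bounds(2)])
    note DF = W1p_gradientD[OF WF]
    note [measurable] = DF(6,7)
    have "admissible (m + 1) (\<lambda>x. u x - ?F (u x)) (\<lambda>x. G x - ?F' (u x) *\<^sub>R G x)"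
      unfolding admissible_def
    proof
      show "AE x in L. \<bar>u x - ?F (u x)\<bar> \<le> m + 1"
        using ub by eventually_elim (rule order_trans[OF excess_props(1)[OF m]])
    qed (rule W1p_gradient_diff[OF W WF])
    from VI[OF this] have 1: "0 \<le> (\<integral>x. g x * (pflux p (G x) \<bullet> - (?F' (u x) *\<^sub>R G x)) + (u x - h x) * - ?F (u x) \<partial>L)"
      by (simp add: R_def)
    have iu: "integrable L (\<lambda>x. (u x - h x) * ?F (u x))"
    proof (rule integrable_bounded_AE)
      show "AE x in L. norm ((u x - h x) * ?F (u x)) \<le> (2 * m + 1) * (2 * (m + 1))"
        using ub h(2)
      proof eventually_elim
        case (elim x)
        have "\<bar>?F (u x)\<bar> \<le> 2 * (m + 1)" using excess_props(1)[OF m, of "u x"] abs_triangle_ineq4[of "u x" "u x - ?F (u x)"] elim by simp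
        then have "\<bar>u x - h x\<bar> * \<bar>?F (u x)\<bar> \<le> (2 * m + 1) * (2 * (m + 1))"
          using elim m by (intro mult_mono) auto
        then show ?case by (simp add: abs_mult)
      qed
    qed measurable
    have "0 \<le> (\<integral>x. - ((u x - h x) * ?F (u x)) \<partial>L)"
    proof (rule order_trans[OF 1], rule integral_mono_AE)
      have "integrable L (\<lambda>x. g x * (pflux p (G x) \<bullet> (?F' (u x) *\<^sub>R G x)))" by (rule flux_integrable_W1p[OF W WF])
      then show "integrable L (\<lambda>x. g x * (pflux p (G x) \<bullet> - (?F' (u x) *\<^sub>R G x)) + (u x - h x) * - ?F (u x))"
        using iu by simp
      show "AE x in L. g x * (pflux p (G x) \<bullet> - (?F' (u x) *\<^sub>R G x)) + (u x - h x) * - ?F (u x) \<le> - ((u x - h x) * ?F (u x))"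
        using g_bounds
      proof eventually_elim
        case (elim x)
        have "0 \<le> g x * (?F' (u x) * norm (G x) powr p)"
          using elim g1 excess'_bounds(1) by (intro mult_nonneg_nonneg) auto
        then show ?case by (simp add: pflux_inner_self)
      qed
    qed (use iu in auto)
    then have le: "(\<integral>x. (u x - h x) * ?F (u x) \<partial>L) \<le> 0" by simp
    have nn: "AE x in L. 0 \<le> (u x - h x) * ?F (u x)"
      using h(2) by eventually_elim (rule excess_props(2)[OF m])
    have "(\<integral>x. (u x - h x) * ?F (u x) \<partial>L) = 0"
      using le integral_nonneg_AE[OF nn] by simp
    then have "AE x in L. (u x - h x) * ?F (u x) = 0"
      using integral_nonneg_eq_0_iff_AE[OF iu nn] by simp
    then show ?thesis using h(2)
      by eventually_elim (rule excess_props(3)[OF m])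
  qed
  have "weak_solution (\<lambda>x. h x - u x) u G"
    unfolding weak_solution_def
  proof (intro conjI allI impI W, elim conjE)
    fix \<phi> \<Phi> assume \<phi>: "W1p_gradient p S \<phi> \<Phi>" and "\<phi> \<in> Linfty S"
    then obtain C where C: "AE x in L. \<bar>\<phi> x\<bar> \<le> C" by (auto simp: Linfty_def)
    define c where "c = max C 1"
    have c: "c > 0" by (simp add: c_def)
    have C: "AE x in L. \<bar>\<phi> x\<bar> \<le> c" using C by eventually_elim (simp add: c_def)
    note D\<phi> = W1p_gradientD[OF \<phi>]
    note [measurable] = D\<phi>(6,7)
    have i1: "integrable L (\<lambda>x. g x * (pflux p (G x) \<bullet> \<Phi> x))" by (rule flux_integrable_W1p[OF W \<phi>])
    have i2: "integrable L (\<lambda>x. (u x - h x) * \<phi> x)"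
    proof (rule integrable_bounded_AE)
      show "AE x in L. norm ((u x - h x) * \<phi> x) \<le> (2 * m) * c"
        using um h(2) C
      proof eventually_elim
        case (elim x)
        have "\<bar>u x - h x\<bar> * \<bar>\<phi> x\<bar> \<le> (2 * m) * c" using elim m by (intro mult_mono) auto
        then show ?case by (simp add: abs_mult)
      qed
    qed measurable
    \<comment> \<open>\<open>R\<close> is linear, and variations of size at most 1 are admissible in both directions\<close>
    have half: "0 \<le> s * R \<phi> \<Phi>" if s: "\<bar>s\<bar> = 1 / c" for s
    proof -
      have "admissible (m + 1) (\<lambda>x. 1 * u x + s * \<phi> x) (\<lambda>x. 1 *\<^sub>R G x + s *\<^sub>R \<Phi> x)"
        unfolding admissible_def
      proof
        show "AE x in L. \<bar>1 * u x + s * \<phi> x\<bar> \<le> m + 1"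
          using um C
        proof eventually_elim
          case (elim x)
          have "\<bar>s * \<phi> x\<bar> \<le> 1 / c * c" unfolding abs_mult s using elim c by (intro mult_left_mono) auto
          then have "\<bar>s * \<phi> x\<bar> \<le> 1" using c by simp
          then show ?case using elim by (simp only: mult_1)
        qed
      qed (rule W1p_gradient_linear[OF W \<phi>])
      from VI[OF this] have "0 \<le> (\<integral>x. g x * (pflux p (G x) \<bullet> (s *\<^sub>R \<Phi> x)) + (u x - h x) * (s * \<phi> x) \<partial>L)"
        by (simp add: R_def)
      also have "\<dots> = (\<integral>x. s * (g x * (pflux p (G x) \<bullet> \<Phi> x) + (u x - h x) * \<phi> x) \<partial>L)"
        by (simp add: algebra_simps)
      finally show ?thesis by (simp add: R_def)
    qed
    have "0 \<le> 1 / c * R \<phi> \<Phi>" "0 \<le> - (1 / c) * R \<phi> \<Phi>"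
      by (rule half; use c in simp)+
    then have "R \<phi> \<Phi> = 0" using c by (simp add: field_simps)
    then have "(\<integral>x. g x * (pflux p (G x) \<bullet> \<Phi> x) \<partial>L) + (\<integral>x. (u x - h x) * \<phi> x \<partial>L) = 0"
      using i1 i2 by (simp add: R_def)
    moreover have "(\<integral>x. (h x - u x) * \<phi> x \<partial>L) = - (\<integral>x. (u x - h x) * \<phi> x \<partial>L)"
      by (subst Bochner_Integration.integral_minus[symmetric]) (simp add: algebra_simps)
    ultimately show "(\<integral>x. g x * (pflux p (G x) \<bullet> \<Phi> x) \<partial>L) = (\<integral>x. (h x - u x) * \<phi> x \<partial>L)" by simp
  qed
  with um show ?thesis by blast
qed

end

section \<open>Accretivity in the space of integrable functions\<close>

text \<open>A \<open>C^1\<close> approximation of the sign, increasing and with bounded derivative.\<close>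

definition soft_sign :: "real \<Rightarrow> real \<Rightarrow> real"
  where "soft_sign e t = t / sqrt (t\<^sup>2 + e\<^sup>2)"

definition soft_sign' :: "real \<Rightarrow> real \<Rightarrow> real"
  where "soft_sign' e t = e\<^sup>2 / (sqrt (t\<^sup>2 + e\<^sup>2)) ^ 3"

context
  fixes e :: real
  assumes e: "e > 0"
begin

lemma soft_sign_root: "sqrt (t\<^sup>2 + e\<^sup>2) \<ge> e" "sqrt (t\<^sup>2 + e\<^sup>2) > 0" "sqrt (t\<^sup>2 + e\<^sup>2) \<ge> \<bar>t\<bar>" "sqrt (t\<^sup>2 + e\<^sup>2) \<le> \<bar>t\<bar> + e"
proof -
  show 1: "sqrt (t\<^sup>2 + e\<^sup>2) \<ge> e" using e by (intro real_le_rsqrt) auto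
  then show "sqrt (t\<^sup>2 + e\<^sup>2) > 0" using e by linarith
  show "sqrt (t\<^sup>2 + e\<^sup>2) \<ge> \<bar>t\<bar>" by (intro real_le_rsqrt) auto
  show "sqrt (t\<^sup>2 + e\<^sup>2) \<le> \<bar>t\<bar> + e"
    using e by (intro real_le_lsqrt) (auto simp: power2_sum)
qed

lemma soft_sign_deriv: "(soft_sign e has_real_derivative soft_sign' e t) (at t)"
proof -
  let ?q = "sqrt (t\<^sup>2 + e\<^sup>2)"
  have q: "?q > 0" by (rule soft_sign_root)
  have pos: "t\<^sup>2 + e\<^sup>2 > 0" using e by (simp add: add_nonneg_pos)
  have dq: "((\<lambda>t. sqrt (t\<^sup>2 + e\<^sup>2)) has_real_derivative t / ?q) (at t)"
    using pos by (auto intro!: derivative_eq_intros simp: field_simps)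
  have "((\<lambda>t. t / sqrt (t\<^sup>2 + e\<^sup>2)) has_real_derivative (1 * ?q - t * (t / ?q)) / (?q * ?q)) (at t)"
    using q by (intro DERIV_divide DERIV_ident dq) auto
  moreover have "(1 * ?q - t * (t / ?q)) / (?q * ?q) = soft_sign' e t"
  proof -
    have "1 * q - t * (t / q) = (q\<^sup>2 - t\<^sup>2) / q" if "q > 0" for q :: real
      using that by (simp add: field_simps power2_eq_square)
    from this[OF q] have "1 * ?q - t * (t / ?q) = (?q\<^sup>2 - t\<^sup>2) / ?q" .
    also have "?q\<^sup>2 - t\<^sup>2 = e\<^sup>2" using pos by simp
    finally show ?thesis unfolding soft_sign'_def by (simp add: power3_eq_cube)
  qed
  ultimately show ?thesis by (simp add: soft_sign_def[abs_def])
qed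

lemma soft_sign'_cont: "continuous_on UNIV (soft_sign' e)"
  unfolding soft_sign'_def[abs_def] using soft_sign_root(2) by (intro continuous_intros ballI) (auto simp: less_imp_neq[symmetric])

lemma soft_sign'_bounds: "0 \<le> soft_sign' e t" "\<bar>soft_sign' e t\<bar> \<le> 1 / e"
proof -
  let ?q = "sqrt (t\<^sup>2 + e\<^sup>2)"
  show nn: "0 \<le> soft_sign' e t" unfolding soft_sign'_def by (intro divide_nonneg_nonneg) auto
  have "e ^ 3 \<le> ?q ^ 3" using soft_sign_root(1) e by (intro power_mono) auto
  then have "e\<^sup>2 / ?q ^ 3 \<le> e\<^sup>2 / e ^ 3" using e soft_sign_root(2) by (intro divide_left_mono) auto
  also have "\<dots> = 1 / e" using e by (simp add: power2_eq_square power3_eq_cube)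
  finally show "\<bar>soft_sign' e t\<bar> \<le> 1 / e" using nn by (simp add: soft_sign'_def)
qed

lemma soft_sign_props: "\<bar>soft_sign e t\<bar> \<le> 1" "\<bar>t\<bar> - e \<le> t * soft_sign e t"
proof -
  let ?q = "sqrt (t\<^sup>2 + e\<^sup>2)"
  have q: "?q > 0" by (rule soft_sign_root)
  show "\<bar>soft_sign e t\<bar> \<le> 1" unfolding soft_sign_def using q soft_sign_root(3)[of t] by (simp add: divide_le_eq)
  have "(\<bar>t\<bar> - e) * ?q \<le> t * t"
  proof (cases "\<bar>t\<bar> \<le> e")
    case True
    then have "(\<bar>t\<bar> - e) * ?q \<le> 0" using q by (intro mult_nonpos_nonneg) auto
    also have "0 \<le> t * t" by simp
    finally show ?thesis .
  next
    case False
    then have "(\<bar>t\<bar> - e) * ?q \<le> (\<bar>t\<bar> - e) * (\<bar>t\<bar> + e)" using soft_sign_root(4)[of t] by (intro mult_left_mono) auto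
    also have "\<dots> = \<bar>t\<bar> * \<bar>t\<bar> - e * e" by (simp add: algebra_simps)
    also have "\<dots> \<le> t * t" by (simp add: abs_mult[symmetric])
    finally show ?thesis .
  qed
  then show "\<bar>t\<bar> - e \<le> t * soft_sign e t" unfolding soft_sign_def using q by (simp add: le_divide_eq)
qed

end

context neumann_problem
begin

lemma weak_solution_test:
  assumes "weak_solution f u G" "W1p_gradient p S \<phi> \<Phi>" "\<phi> \<in> Linfty S"
  shows "(\<integral>x. g x * (pflux p (G x) \<bullet> \<Phi> x) \<partial>L) = (\<integral>x. f x * \<phi> x \<partial>L)"
  using assms by (auto simp: weak_solution_def)

text \<open>The difference of the equations is tested with the soft sign of \<open>w = u1 - u2\<close>, whose gradient is a
nonnegative multiple of \<open>\<nabla>u1 - \<nabla>u2\<close>.  By monotonicity of the flux,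
\<open>\<integral> (f1 - f2) sign w \<ge> 0\<close>; adding a multiple of this to \<open>\<integral> w sign w\<close> and
bounding the sign by one gives the claim up to an error proportional to \<open>e\<close>.\<close>

lemma weak_solution_accretive:
  assumes s1: "weak_solution f1 u1 G1" and s2: "weak_solution f2 u2 G2"
    and f: "integrable L f1" "integrable L f2" and \<alpha>: "\<alpha> \<ge> 0"
  shows "(\<integral>x. \<bar>u1 x - u2 x\<bar> \<partial>L) \<le> (\<integral>x. \<bar>u1 x - u2 x + \<alpha> * (f1 x - f2 x)\<bar> \<partial>L)"
proof (rule field_le_epsilon)
  fix d :: real assume d: "d > 0"
  define V where "V = measure L S"
  have V: "V \<ge> 0" by (simp add: V_def)
  \<comment> \<open>the soft sign loses at most \<open>e\<close> at every point, hence at most \<open>d\<close> in total\<close>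
  define e where "e = d / (V + 1)"
  have e: "e > 0" using d V by (simp add: e_def)
  have W1: "W1p_gradient p S u1 G1" and W2: "W1p_gradient p S u2 G2"
    using s1 s2 by (auto simp: weak_solution_def)
  let ?w = "\<lambda>x. u1 x - u2 x" and ?W = "\<lambda>x. G1 x - G2 x"
  have W: "W1p_gradient p S ?w ?W" by (rule W1p_gradient_diff[OF W1 W2])
  note D = W1p_gradientD[OF W] and [measurable] = W1p_gradientD(6)[OF W1] W1p_gradientD(6)[OF W2]
  let ?F = "soft_sign e" and ?F' = "soft_sign' e"
  have WF: "W1p_gradient p S (\<lambda>x. ?F (?w x)) (\<lambda>x. ?F' (?w x) *\<^sub>R ?W x)"
    by (rule W1p_gradient_compose[OF W soft_sign_deriv[OF e] soft_sign'_cont[OF e] soft_sign'_bounds(2)[OF e]])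
  have Fm [measurable]: "(\<lambda>x. ?F (?w x)) \<in> borel_measurable L" by (rule W1p_gradientD(6)[OF WF])
  have FL: "(\<lambda>x. ?F (?w x)) \<in> Linfty S"
    by (rule LinftyI[of _ 1]) (use soft_sign_props(1)[OF e] in auto)
  have iF: "integrable L (\<lambda>x. q x * ?F (?w x))" if "integrable L q" for q
    using integrable_mult_bounded[OF that Fm] soft_sign_props(1)[OF e] by auto
  have i1: "integrable L (\<lambda>x. g x * (pflux p (G1 x) \<bullet> (?F' (?w x) *\<^sub>R ?W x)))"
    and i2: "integrable L (\<lambda>x. g x * (pflux p (G2 x) \<bullet> (?F' (?w x) *\<^sub>R ?W x)))"
    by (rule flux_integrable_W1p[OF W1 WF], rule flux_integrable_W1p[OF W2 WF])
  have "0 \<le> (\<integral>x. g x * (pflux p (G1 x) \<bullet> (?F' (?w x) *\<^sub>R ?W x)) - g x * (pflux p (G2 x) \<bullet> (?F' (?w x) *\<^sub>R ?W x)) \<partial>L)"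
  proof (rule integral_nonneg_AE)
    show "AE x in L. 0 \<le> g x * (pflux p (G1 x) \<bullet> (?F' (?w x) *\<^sub>R ?W x)) - g x * (pflux p (G2 x) \<bullet> (?F' (?w x) *\<^sub>R ?W x))"
      using g_bounds
    proof eventually_elim
      case (elim x)
      have "0 \<le> g x * (?F' (?w x) * ((pflux p (G1 x) - pflux p (G2 x)) \<bullet> ?W x))"
        using elim g1 soft_sign'_bounds(1)[OF e] pflux_monotone[OF p] by (intro mult_nonneg_nonneg) auto
      then show ?case by (simp add: inner_diff_left algebra_simps)
    qed
  qed
  also have "\<dots> = (\<integral>x. f1 x * ?F (?w x) \<partial>L) - (\<integral>x. f2 x * ?F (?w x) \<partial>L)"
    unfolding Bochner_Integration.integral_diff[OF i1 i2] weak_solution_test[OF s1 WF FL] weak_solution_test[OF s2 WF FL] ..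
  finally have pos: "0 \<le> (\<integral>x. f1 x * ?F (?w x) \<partial>L) - (\<integral>x. f2 x * ?F (?w x) \<partial>L)" .
  have iw: "integrable L ?w" by (rule D(4))
  have "(\<integral>x. \<bar>?w x\<bar> - e \<partial>L) \<le> (\<integral>x. ?w x * ?F (?w x) \<partial>L)"
    by (rule integral_mono) (use iw iF[OF iw] soft_sign_props(2)[OF e] in auto)
  then have "(\<integral>x. \<bar>?w x\<bar> \<partial>L) - e * V \<le> (\<integral>x. ?w x * ?F (?w x) \<partial>L)"
    using iw by (simp add: V_def mult.commute)
  also have "\<dots> \<le> (\<integral>x. ?w x * ?F (?w x) \<partial>L) + \<alpha> * ((\<integral>x. f1 x * ?F (?w x) \<partial>L) - (\<integral>x. f2 x * ?F (?w x) \<partial>L))"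
    using pos \<alpha> by simp
  also have "\<dots> = (\<integral>x. ?w x * ?F (?w x) + \<alpha> * (f1 x * ?F (?w x) - f2 x * ?F (?w x)) \<partial>L)"
    using iF[OF iw] iF[OF f(1)] iF[OF f(2)] by simp
  also have "\<dots> \<le> (\<integral>x. \<bar>?w x + \<alpha> * (f1 x - f2 x)\<bar> \<partial>L)"
  proof (rule integral_mono)
    fix x
    let ?z = "?w x + \<alpha> * (f1 x - f2 x)"
    have "?z * ?F (?w x) \<le> 1 * \<bar>?z\<bar>" using abs_mult_le_bound[OF soft_sign_props(1)[OF e, of "?w x"], of ?z] by (rule order_trans[OF abs_ge_self])
    then show "?w x * ?F (?w x) + \<alpha> * (f1 x * ?F (?w x) - f2 x * ?F (?w x)) \<le> \<bar>?z\<bar>"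
      by (simp add: algebra_simps)
  qed (use iF[OF iw] iF[OF f(1)] iF[OF f(2)] iw f in auto)
  finally have "(\<integral>x. \<bar>?w x\<bar> \<partial>L) \<le> (\<integral>x. \<bar>?w x + \<alpha> * (f1 x - f2 x)\<bar> \<partial>L) + e * V" by simp
  also have "e * V \<le> d" using d V by (simp add: e_def field_simps)
  finally show "(\<integral>x. \<bar>?w x\<bar> \<partial>L) \<le> (\<integral>x. \<bar>?w x + \<alpha> * (f1 x - f2 x)\<bar> \<partial>L) + d" by simp
qed

text \<open>The equation tested with its own solution; the bound does not depend on the weight.\<close>

lemma gradient_energy_bound:
  assumes s: "weak_solution (\<lambda>x. h x - u x) u G" and u: "AE x in L. \<bar>u x\<bar> \<le> m"
    and h: "h \<in> borel_measurable L" "AE x in L. \<bar>h x\<bar> \<le> m"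
  shows "g1 * (\<integral>x. norm (G x) powr p \<partial>L) \<le> 2 * m * m * measure L S"
proof -
  have W: "W1p_gradient p S u G" using s by (simp add: weak_solution_def)
  note D = W1p_gradientD[OF W] and [measurable] = W1p_gradientD(6)[OF W] h(1)
  have b: "AE x in L. \<bar>(h x - u x) * u x\<bar> \<le> 2 * m * m"
    using u h(2)
  proof eventually_elim
    case (elim x)
    show ?case unfolding abs_mult by (rule mult_mono) (use elim in auto)
  qed
  have "g1 * (\<integral>x. norm (G x) powr p \<partial>L) = (\<integral>x. g1 * norm (G x) powr p \<partial>L)" by simp
  also have "\<dots> \<le> (\<integral>x. g x * (pflux p (G x) \<bullet> G x) \<partial>L)"
  proof (rule integral_mono_AE)
    show "AE x in L. g1 * norm (G x) powr p \<le> g x * (pflux p (G x) \<bullet> G x)"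
      using g_bounds by eventually_elim (simp add: pflux_inner_self mult_right_mono)
  qed (use D(8) flux_integrable_W1p[OF W W] in auto)
  also have "\<dots> = (\<integral>x. (h x - u x) * u x \<partial>L)"
    using s LinftyI[OF D(6) u] by (auto simp: weak_solution_def)
  also have "\<dots> \<le> (\<integral>x. 2 * m * m \<partial>L)"
  proof (rule integral_mono_AE)
    show "integrable L (\<lambda>x. (h x - u x) * u x)"
      by (rule integrable_bounded_AE) (use b in auto)
    show "AE x in L. (h x - u x) * u x \<le> 2 * m * m" using b by eventually_elim simp
  qed simp
  finally show ?thesis by (simp add: mult_ac)
qed

end

section \<open>Dependence of the solution on the weight\<close>

context sobolev_domain
begin

text \<open>Dominated convergence for \<open>L^1\<close> convergent bounded sequences: the weight \<open>w\<close> is split at a level \<open>N\<close>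
into a bounded part and a part with small integral.\<close>

lemma weighted_L1_tendsto_zero:
  fixes a :: "nat \<Rightarrow> 'a \<Rightarrow> real"
  assumes a: "\<And>n. integrable L (a n)" "\<And>n. AE x in L. 0 \<le> a n x \<and> a n x \<le> C"
    and w: "integrable L w" "\<And>x. w x \<ge> 0" and lim: "(\<lambda>n. \<integral>x. a n x \<partial>L) \<longlonglongrightarrow> 0" and C: "C \<ge> 0"
  shows "(\<lambda>n. \<integral>x. a n x * w x \<partial>L) \<longlonglongrightarrow> 0"
proof (rule LIMSEQ_I)
  fix e :: real assume e: "e > 0"
  note [measurable] = borel_measurable_integrable[OF a(1)] borel_measurable_integrable[OF w(1)]
  have iaw: "integrable L (\<lambda>x. a n x * w x)" for n
  proof (rule Bochner_Integration.integrable_bound[where f="\<lambda>x. C * w x"])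
    show "AE x in L. norm (a n x * w x) \<le> norm (C * w x)"
      using a(2)[of n] by eventually_elim (use w(2) C in \<open>auto simp: abs_mult intro!: mult_right_mono\<close>)
  qed (use w in auto)
  have iN: "integrable L (\<lambda>x. w x - min (w x) (real N))" for N
    by (rule Bochner_Integration.integrable_bound[where f=w]) (use w in auto)
  have "(\<lambda>N. \<integral>x. w x - min (w x) (real N) \<partial>L) \<longlonglongrightarrow> (\<integral>x. 0 \<partial>L)"
  proof (rule integral_dominated_convergence[where w=w])
    show "AE x in L. (\<lambda>N. w x - min (w x) (real N)) \<longlonglongrightarrow> 0"
    proof (rule AE_I2)
      fix x
      obtain N0 where "w x \<le> real N0" using real_arch_simple by blast
      then have "eventually (\<lambda>N. w x - min (w x) (real N) = 0) sequentially"
        by (intro eventually_sequentiallyI[of N0]) auto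
      then show "(\<lambda>N. w x - min (w x) (real N)) \<longlonglongrightarrow> 0" by (rule tendsto_eventually)
    qed
  qed (use w in auto)
  then have "(\<lambda>N. C * (\<integral>x. w x - min (w x) (real N) \<partial>L)) \<longlonglongrightarrow> C * 0" by (intro tendsto_mult_left) simp
  then have "eventually (\<lambda>N. C * (\<integral>x. w x - min (w x) (real N) \<partial>L) < e / 2) sequentially"
    using e by (intro order_tendstoD(2)) auto
  then obtain N where N: "C * (\<integral>x. w x - min (w x) (real N) \<partial>L) < e / 2" by (auto simp: eventually_sequentially)
  have "(\<lambda>n. real N * (\<integral>x. a n x \<partial>L)) \<longlonglongrightarrow> real N * 0" by (intro tendsto_mult_left lim)
  then have "eventually (\<lambda>n. real N * (\<integral>x. a n x \<partial>L) < e / 2) sequentially"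
    using e by (intro order_tendstoD(2)) auto
  then obtain n0 where n0: "\<And>n. n \<ge> n0 \<Longrightarrow> real N * (\<integral>x. a n x \<partial>L) < e / 2" by (auto simp: eventually_sequentially)
  have "(\<integral>x. a n x * w x \<partial>L) < e" if "n \<ge> n0" for n
  proof -
    have "(\<integral>x. a n x * w x \<partial>L) \<le> (\<integral>x. real N * a n x + C * (w x - min (w x) (real N)) \<partial>L)"
    proof (rule integral_mono_AE)
      show "AE x in L. a n x * w x \<le> real N * a n x + C * (w x - min (w x) (real N))"
        using a(2)[of n]
      proof eventually_elim
        case (elim x)
        have "a n x * w x = a n x * min (w x) (real N) + a n x * (w x - min (w x) (real N))" by (simp add: algebra_simps)
        also have "\<dots> \<le> a n x * real N + C * (w x - min (w x) (real N))"
          using elim by (intro add_mono mult_left_mono mult_right_mono) auto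
        finally show ?case by (simp add: mult.commute)
      qed
    qed (use iaw iN a(1) in auto)
    also have "\<dots> = real N * (\<integral>x. a n x \<partial>L) + C * (\<integral>x. w x - min (w x) (real N) \<partial>L)"
      using iN a(1) by simp
    finally show ?thesis using N n0[OF that] by linarith
  qed
  moreover have "(\<integral>x. a n x * w x \<partial>L) \<ge> 0" for n
    by (rule integral_nonneg_AE) (use a(2)[of n] w(2) in auto)
  ultimately show "\<exists>no. \<forall>n\<ge>no. norm ((\<integral>x. a n x * w x \<partial>L) - 0) < e" by (intro exI[of _ n0]) auto
qed

end

context neumann_problem
begin

text \<open>Both equations are tested with \<open>u' - u\<close> and subtracted.  Monotonicity of the flux absorbs the gradients
except for \<open>(g - g') |\<nabla>u|^(p-2) \<nabla>u\<close> paired with the difference of the gradients.  The Young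
inequality splits this into a part with the unknown gradients, small by the choice of \<open>\<eta>\<close>, and a part
with the fixed gradient \<open>G\<close>, small when \<open>g'\<close> is close to \<open>g\<close>.\<close>

lemma weight_perturbation_estimate:
  assumes g': "neumann_problem S p g1 g2 g'"
    and s: "weak_solution (\<lambda>x. h x - u x) u G" and s': "neumann_problem.weak_solution S p g' (\<lambda>x. h x - u' x) u' G'"
    and u: "AE x in L. \<bar>u x\<bar> \<le> m" and u': "AE x in L. \<bar>u' x\<bar> \<le> m"
    and h: "h \<in> borel_measurable L" "AE x in L. \<bar>h x\<bar> \<le> m" and \<eta>: "\<eta> > 0"
  shows "(\<integral>x. (u' x - u x)\<^sup>2 \<partial>L) \<le>
    \<eta> powr (p - 1) * (g2 * (2 powr p * (2 * (2 * m * m * measure L S / g1)))) + (\<integral>x. \<bar>g' x - g x\<bar> * norm (G x) powr p \<partial>L) / \<eta>"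
proof -
  interpret P': neumann_problem S p g1 g2 g' by (rule g')
  have W: "W1p_gradient p S u G" and W': "W1p_gradient p S u' G'"
    using s s' by (auto simp: weak_solution_def P'.weak_solution_def)
  note D = W1p_gradientD[OF W] and D' = W1p_gradientD[OF W']
  note [measurable] = D(6,7) D'(6,7) h(1)
  have Wd: "W1p_gradient p S (\<lambda>x. u' x - u x) (\<lambda>x. G' x - G x)" by (rule W1p_gradient_diff[OF W' W])
  have ud: "AE x in L. \<bar>u' x - u x\<bar> \<le> 2 * m" using u u' by eventually_elim linarith
  have "(\<lambda>x. u' x - u x) \<in> Linfty S" by (rule LinftyI[OF _ ud]) measurable
  then have eq: "(\<integral>x. g x * (pflux p (G x) \<bullet> (G' x - G x)) \<partial>L) = (\<integral>x. (h x - u x) * (u' x - u x) \<partial>L)"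
    and eq': "(\<integral>x. g' x * (pflux p (G' x) \<bullet> (G' x - G x)) \<partial>L) = (\<integral>x. (h x - u' x) * (u' x - u x) \<partial>L)"
    using s s' Wd by (auto simp: weak_solution_def P'.weak_solution_def)
  have bi: "integrable L (\<lambda>x. (h x - v x) * (u' x - u x))" if [measurable]: "v \<in> borel_measurable L" and v: "AE x in L. \<bar>v x\<bar> \<le> m" for v
  proof (rule integrable_bounded_AE)
    show "AE x in L. norm ((h x - v x) * (u' x - u x)) \<le> (2 * m) * (2 * m)"
      using v ud h(2)
    proof eventually_elim
      case (elim x)
      show ?case unfolding real_norm_def abs_mult by (rule mult_mono) (use elim in auto)
    qed
  qed measurable
  have i1: "integrable L (\<lambda>x. g x * (pflux p (G x) \<bullet> (G' x - G x)))" by (rule flux_integrable_W1p[OF W Wd])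
  have i2: "integrable L (\<lambda>x. g' x * (pflux p (G' x) \<bullet> (G' x - G x)))" by (rule P'.flux_integrable_W1p[OF W' Wd])
  have Gp: "integrable L (\<lambda>x. norm (G x) powr p)" "integrable L (\<lambda>x. norm (G' x - G x) powr p)"
    using D(8) W1p_gradientD(8)[OF Wd] by auto
  have gd: "AE x in L. 0 \<le> \<bar>g' x - g x\<bar> \<and> \<bar>g' x - g x\<bar> \<le> g2"
    using g_bounds P'.g_bounds by eventually_elim (use g1 in auto)
  have gd1: "AE x in L. \<bar>\<bar>g' x - g x\<bar>\<bar> \<le> g2" using gd by eventually_elim simp
  have g2n: "integrable L (\<lambda>x. norm (G x) powr p * \<bar>g' x - g x\<bar>)" "integrable L (\<lambda>x. norm (G' x - G x) powr p * \<bar>g' x - g x\<bar>)"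
    by (rule integrable_mult_bounded[OF Gp(1) _ gd1], measurable, rule integrable_mult_bounded[OF Gp(2) _ gd1], measurable)
  have "(\<integral>x. (u' x - u x)\<^sup>2 \<partial>L) = (\<integral>x. (h x - u x) * (u' x - u x) - (h x - u' x) * (u' x - u x) \<partial>L)"
    by (simp add: algebra_simps power2_eq_square)
  also have "\<dots> = (\<integral>x. g x * (pflux p (G x) \<bullet> (G' x - G x)) - g' x * (pflux p (G' x) \<bullet> (G' x - G x)) \<partial>L)"
    using bi[OF D(6) u] bi[OF D'(6) u'] i1 i2 by (simp add: eq eq')
  also have "\<dots> \<le> (\<integral>x. \<eta> powr (p - 1) * (norm (G' x - G x) powr p * \<bar>g' x - g x\<bar>) + norm (G x) powr p * \<bar>g' x - g x\<bar> / \<eta> \<partial>L)"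
  proof (rule integral_mono_AE)
    show "AE x in L. g x * (pflux p (G x) \<bullet> (G' x - G x)) - g' x * (pflux p (G' x) \<bullet> (G' x - G x)) \<le>
      \<eta> powr (p - 1) * (norm (G' x - G x) powr p * \<bar>g' x - g x\<bar>) + norm (G x) powr p * \<bar>g' x - g x\<bar> / \<eta>"
      using P'.g_bounds
    proof eventually_elim
      case (elim x)
      let ?d = "G' x - G x"
      have "0 \<le> g' x * ((pflux p (G' x) - pflux p (G x)) \<bullet> ?d)"
        using elim g1 pflux_monotone[OF p] by (intro mult_nonneg_nonneg) auto
      then have "g x * (pflux p (G x) \<bullet> ?d) - g' x * (pflux p (G' x) \<bullet> ?d) \<le> (g x - g' x) * (pflux p (G x) \<bullet> ?d)"
        by (simp add: inner_diff_left algebra_simps)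
      also have "\<dots> \<le> \<bar>g x - g' x\<bar> * \<bar>pflux p (G x) \<bullet> ?d\<bar>" unfolding abs_mult[symmetric] by (rule abs_ge_self)
      also have "\<dots> \<le> \<bar>g' x - g x\<bar> * (norm ?d * norm (G x) powr (p - 1))"
        using pflux_inner_le[of p "G x" ?d] by (intro mult_mono) (auto simp: mult.commute)
      also have "\<dots> \<le> \<bar>g' x - g x\<bar> * (\<eta> powr (p - 1) * norm ?d powr p + norm (G x) powr p / \<eta>)"
        by (intro mult_left_mono crude_Young) (use \<eta> p in auto)
      also have "\<dots> = \<eta> powr (p - 1) * (norm ?d powr p * \<bar>g' x - g x\<bar>) + norm (G x) powr p * \<bar>g' x - g x\<bar> / \<eta>"
        by (simp add: algebra_simps)
      finally show ?case .
    qed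
  qed (use i1 i2 g2n in auto)
  also have "\<dots> = \<eta> powr (p - 1) * (\<integral>x. norm (G' x - G x) powr p * \<bar>g' x - g x\<bar> \<partial>L) + (\<integral>x. norm (G x) powr p * \<bar>g' x - g x\<bar> \<partial>L) / \<eta>"
    using g2n by simp
  finally have A: "(\<integral>x. (u' x - u x)\<^sup>2 \<partial>L) \<le> \<eta> powr (p - 1) * (\<integral>x. norm (G' x - G x) powr p * \<bar>g' x - g x\<bar> \<partial>L) + (\<integral>x. norm (G x) powr p * \<bar>g' x - g x\<bar> \<partial>L) / \<eta>" .
  have B: "(\<integral>x. norm (G' x - G x) powr p * \<bar>g' x - g x\<bar> \<partial>L) \<le> g2 * (2 powr p * (2 * (2 * m * m * measure L S / g1)))"
  proof -
    have "(\<integral>x. norm (G' x - G x) powr p * \<bar>g' x - g x\<bar> \<partial>L) \<le> (\<integral>x. g2 * (2 powr p * (norm (G' x) powr p + norm (G x) powr p)) \<partial>L)"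
    proof (rule integral_mono_AE)
      show "AE x in L. norm (G' x - G x) powr p * \<bar>g' x - g x\<bar> \<le> g2 * (2 powr p * (norm (G' x) powr p + norm (G x) powr p))"
        using gd
      proof eventually_elim
        case (elim x)
        have "norm (G' x - G x) powr p \<le> 2 powr p * (norm (G' x) powr p + norm (G x) powr p)"
          using norm_add_powr_le[of p "G' x" "- G x"] p by simp
        then have "norm (G' x - G x) powr p * \<bar>g' x - g x\<bar> \<le> (2 powr p * (norm (G' x) powr p + norm (G x) powr p)) * g2"
          using elim by (intro mult_mono) auto
        then show ?case by (simp add: mult.commute)
      qed
    qed (use g2n D(8) D'(8) in auto)
    also have "\<dots> = g2 * (2 powr p * ((\<integral>x. norm (G' x) powr p \<partial>L) + (\<integral>x. norm (G x) powr p \<partial>L)))"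
      using D(8) D'(8) by simp
    also have "\<dots> \<le> g2 * (2 powr p * (2 * (2 * m * m * measure L S / g1)))"
    proof -
      have "(\<integral>x. norm (G x) powr p \<partial>L) \<le> 2 * m * m * measure L S / g1"
        using gradient_energy_bound[OF s u h] g1 by (simp add: le_divide_eq mult.commute)
      moreover have "(\<integral>x. norm (G' x) powr p \<partial>L) \<le> 2 * m * m * measure L S / g1"
        using P'.gradient_energy_bound[OF s' u' h] g1 by (simp add: le_divide_eq mult.commute)
      ultimately have "(\<integral>x. norm (G' x) powr p \<partial>L) + (\<integral>x. norm (G x) powr p \<partial>L) \<le> 2 * (2 * m * m * measure L S / g1)"
        by (simp only: mult_2 add_mono)
      moreover have "g2 \<ge> 0" using g1 g12 by linarith
      ultimately show ?thesis by (intro mult_left_mono) auto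
    qed
    finally show ?thesis .
  qed
  show ?thesis
    using order_trans[OF A add_right_mono[OF mult_left_mono[OF B]]] by (simp add: mult.commute)
qed

end

context sobolev_domain
begin

lemma solutions_tendsto:
  assumes P: "neumann_problem S p g1 g2 g" and Pn: "\<And>n. neumann_problem S p g1 g2 (gn n)"
    and s: "neumann_problem.weak_solution S p g (\<lambda>x. h x - u x) u G"
    and sn: "\<And>n. neumann_problem.weak_solution S p (gn n) (\<lambda>x. h x - un n x) (un n) (Gn n)"
    and u: "AE x in L. \<bar>u x\<bar> \<le> m" and un: "\<And>n. AE x in L. \<bar>un n x\<bar> \<le> m"
    and h: "h \<in> borel_measurable L" "AE x in L. \<bar>h x\<bar> \<le> m"
    and m: "m \<ge> 0"
    and lim: "(\<lambda>n. \<integral>x. \<bar>gn n x - g x\<bar> \<partial>L) \<longlonglongrightarrow> 0"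
  shows "(\<lambda>n. \<integral>x. \<bar>un n x - u x\<bar> \<partial>L) \<longlonglongrightarrow> 0"
proof -
  interpret P: neumann_problem S p g1 g2 g by (rule P)
  have W: "W1p_gradient p S u G" using s by (simp add: P.weak_solution_def)
  have Wn: "W1p_gradient p S (un n) (Gn n)" for n
    using sn[of n] by (simp add: neumann_problem.weak_solution_def[OF Pn])
  note [measurable] = W1p_gradientD(6)[OF W] W1p_gradientD(6)[OF Wn] P.g_meas neumann_problem.g_meas[OF Pn]
  define c where "c = g2 * (2 powr p * (2 * (2 * m * m * measure L S / g1)))"
  have c: "c \<ge> 0" unfolding c_def using P.g1 P.g12 m by (intro mult_nonneg_nonneg divide_nonneg_nonneg) auto
  have gd: "AE x in L. 0 \<le> \<bar>gn n x - g x\<bar> \<and> \<bar>gn n x - g x\<bar> \<le> g2" for n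
    using P.g_bounds neumann_problem.g_bounds[OF Pn[of n]] by eventually_elim (use P.g1 in auto)
  define K where "K n = (\<integral>x. \<bar>gn n x - g x\<bar> * norm (G x) powr p \<partial>L)" for n
  have K0: "K \<longlonglongrightarrow> 0" unfolding K_def[abs_def]
  proof (rule weighted_L1_tendsto_zero[OF _ gd W1p_gradientD(8)[OF W] _ lim])
    show "integrable L (\<lambda>x. \<bar>gn n x - g x\<bar>)" for n
      by (rule integrable_bounded_AE[where C=g2]) (use gd[of n] in auto)
    show "g2 \<ge> 0" using P.g1 P.g12 by linarith
  qed auto
  have est: "(\<integral>x. (un n x - u x)\<^sup>2 \<partial>L) \<le> \<eta> powr (p - 1) * c + K n / \<eta>" if "\<eta> > 0" for n \<eta>
    unfolding c_def K_def by (rule P.weight_perturbation_estimate[OF Pn s sn u un h that])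
  have sq: "(\<lambda>n. \<integral>x. (un n x - u x)\<^sup>2 \<partial>L) \<longlonglongrightarrow> 0"
  proof (rule LIMSEQ_I)
    fix e :: real assume e: "e > 0"
    define \<theta> where "\<theta> = e / (2 * (c + 1))"
    have \<theta>: "\<theta> > 0" using e c by (simp add: \<theta>_def)
    \<comment> \<open>chosen so that \<open>\<eta> powr (p - 1) = \<theta>\<close>\<close>
    define \<eta> where "\<eta> = \<theta> powr (1 / (p - 1))"
    have \<eta>: "\<eta> > 0" using \<theta> by (simp add: \<eta>_def)
    have "\<eta> powr (p - 1) = \<theta>" unfolding \<eta>_def using p \<theta> by (simp add: powr_powr)
    moreover have "\<theta> * c \<le> e / 2" using e c by (simp add: \<theta>_def field_simps)
    ultimately have le: "\<eta> powr (p - 1) * c \<le> e / 2" by (simp only:)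
    have "(\<lambda>n. K n / \<eta>) \<longlonglongrightarrow> 0 / \<eta>" using \<eta> by (intro tendsto_divide K0 tendsto_const) auto
    then have "eventually (\<lambda>n. K n / \<eta> < e / 2) sequentially" using e by (intro order_tendstoD(2)) auto
    then obtain N where N: "\<And>n. n \<ge> N \<Longrightarrow> K n / \<eta> < e / 2" by (auto simp: eventually_sequentially)
    have "(\<integral>x. (un n x - u x)\<^sup>2 \<partial>L) < e" if "n \<ge> N" for n
      using est[OF \<eta>, of n] le N[OF that] by linarith
    moreover have "(\<integral>x. (un n x - u x)\<^sup>2 \<partial>L) \<ge> 0" for n by (intro Bochner_Integration.integral_nonneg) simp
    ultimately show "\<exists>no. \<forall>n\<ge>no. norm ((\<integral>x. (un n x - u x)\<^sup>2 \<partial>L) - 0) < e" by (intro exI[of _ N]) auto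
  qed
  have "(\<lambda>n. \<integral>x. norm (un n x - u x) \<partial>L) \<longlonglongrightarrow> 0"
  proof (rule powr_conv_imp_L1_conv(1)[of 2 "\<lambda>n x. un n x - u x"])
    show "integrable L (\<lambda>x. norm (un n x - u x) powr 2)" for n
    proof (rule integrable_bounded_AE)
      show "AE x in L. norm (norm (un n x - u x) powr 2) \<le> (2 * m)\<^sup>2"
        using un[of n] u
      proof eventually_elim
        case (elim x)
        then have "\<bar>un n x - u x\<bar> \<le> 2 * m" "2 * m \<ge> 0" by linarith+
        then have "(un n x - u x)\<^sup>2 \<le> (2 * m)\<^sup>2" using power2_le_iff_abs_le by blast
        then show ?case by simp
      qed
    qed measurable
    show "(\<lambda>n. \<integral>x. norm (un n x - u x) powr 2 \<partial>L) \<longlonglongrightarrow> 0" using sq by simp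
  qed auto
  then show ?thesis by simp
qed

lemma W1p_gradient_cong:
  assumes u: "W1p_gradient p S u G" and v: "v \<in> borel_measurable L" "AE x in L. u x = v x"
  shows "W1p_gradient p S v G"
proof (rule W1p_gradientI)
  note D = W1p_gradientD[OF u]
  note [measurable] = D(6) v(1)
  show "v \<in> Lp p S"
    by (rule Lp_bound[OF D(1) v(1), of 1]) (use v(2) in \<open>auto elim: eventually_mono\<close>)
  show "G \<in> Lp p S" by (rule D(2))
  fix \<phi> b assume \<phi>: "\<phi> \<in> test_functions S" and b: "b \<in> (Basis :: 'a set)"
  obtain c where [measurable]: "(\<lambda>x. frechet_derivative \<phi> (at x) b) \<in> borel_measurable L"
    using test_function_bounds[OF \<phi> b] by metis
  have "(\<integral>x. v x * frechet_derivative \<phi> (at x) b \<partial>L) = (\<integral>x. u x * frechet_derivative \<phi> (at x) b \<partial>L)"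
    by (rule integral_cong_AE) (use v(2) in \<open>auto elim: eventually_mono\<close>)
  then show "(\<integral>x. v x * frechet_derivative \<phi> (at x) b \<partial>L) = - (\<integral>x. (G x \<bullet> b) * \<phi> x \<partial>L)"
    using W1p_gradient_test[OF u \<phi> b] by simp
qed

end

context neumann_problem
begin

lemma weak_solution_cong:
  assumes s: "weak_solution f u G" and u: "u' \<in> borel_measurable L" "AE x in L. u x = u' x"
    and f: "f \<in> borel_measurable L" "f' \<in> borel_measurable L" "AE x in L. f x = f' x"
  shows "weak_solution f' u' G"
  unfolding weak_solution_def
proof (intro conjI allI impI)
  show "W1p_gradient p S u' G"
    using s by (intro W1p_gradient_cong[OF _ u]) (simp add: weak_solution_def)
  fix \<phi> \<Phi> assume "W1p_gradient p S \<phi> \<Phi> \<and> \<phi> \<in> Linfty S"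
  then have \<phi>: "W1p_gradient p S \<phi> \<Phi>" "\<phi> \<in> Linfty S" by auto
  note [measurable] = W1p_gradientD(6)[OF \<phi>(1)] f(1,2)
  have "(\<integral>x. f' x * \<phi> x \<partial>L) = (\<integral>x. f x * \<phi> x \<partial>L)"
    by (rule integral_cong_AE) (use f(3) in \<open>auto elim: eventually_mono\<close>)
  then show "(\<integral>x. g x * (pflux p (G x) \<bullet> \<Phi> x) \<partial>L) = (\<integral>x. f' x * \<phi> x \<partial>L)"
    using weak_solution_test[OF s \<phi>] by simp
qed

end

section \<open>Truncation and restriction of integrable functions\<close>

text \<open>Superposition with a nonexpansive function that fixes zero acts on \<open>L^1\<close> and is itself nonexpansive.
Truncation of the values and restriction to a set are the two instances.\<close>

lemma nonexpansive_integrable: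
  fixes \<tau> :: "'a::euclidean_space \<Rightarrow> real \<Rightarrow> real"
  assumes "\<And>f. f \<in> borel_measurable lebesgue \<Longrightarrow> (\<lambda>x. \<tau> x (f x)) \<in> borel_measurable lebesgue"
    and "\<And>x s t. \<bar>\<tau> x s - \<tau> x t\<bar> \<le> \<bar>s - t\<bar>" "\<And>x. \<tau> x 0 = 0"
  shows "integrable lebesgue (\<lambda>x. \<tau> x (rep_L1 u x))"
  by (rule Bochner_Integration.integrable_bound[where f="rep_L1 u"])
    (use assms(2)[of _ _ 0] assms(3) in \<open>auto intro!: assms(1)\<close>)

lemma nonexpansive_L1_continuous:
  fixes \<tau> :: "'a::euclidean_space \<Rightarrow> real \<Rightarrow> real"
  assumes m: "\<And>f. f \<in> borel_measurable lebesgue \<Longrightarrow> (\<lambda>x. \<tau> x (f x)) \<in> borel_measurable lebesgue"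
    and l: "\<And>x s t. \<bar>\<tau> x s - \<tau> x t\<bar> \<le> \<bar>s - t\<bar>" "\<And>x. \<tau> x 0 = 0"
  shows "continuous_on UNIV (\<lambda>u. abs_L1 (\<lambda>x. \<tau> x (rep_L1 u x)))"
proof -
  have i: "integrable lebesgue (\<lambda>x. \<tau> x (rep_L1 u x))" for u
    by (rule nonexpansive_integrable) (erule m | rule l)+
  have "norm (abs_L1 (\<lambda>x. \<tau> x (rep_L1 u x)) - abs_L1 (\<lambda>x. \<tau> x (rep_L1 v x))) \<le> norm (u - v)" for u v
  proof -
    have "norm (abs_L1 (\<lambda>x. \<tau> x (rep_L1 u x)) - abs_L1 (\<lambda>x. \<tau> x (rep_L1 v x))) =
        (\<integral>x. \<bar>\<tau> x (rep_L1 u x) - \<tau> x (rep_L1 v x)\<bar> \<partial>lebesgue)"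
      unfolding norm_diff_abs_L1[OF i]
    proof (rule integral_cong_AE)
      show "AE x in lebesgue. \<bar>rep_L1 (abs_L1 (\<lambda>x. \<tau> x (rep_L1 u x))) x - \<tau> x (rep_L1 v x)\<bar> = \<bar>\<tau> x (rep_L1 u x) - \<tau> x (rep_L1 v x)\<bar>"
        using rep_abs_L1[OF i[of u]] by eventually_elim simp
    qed (use borel_measurable_integrable[OF i] in auto)
    also have "\<dots> \<le> (\<integral>x. \<bar>rep_L1 u x - rep_L1 v x\<bar> \<partial>lebesgue)"
      by (rule integral_mono) (use i l in auto)
    finally show ?thesis by (simp add: norm_diff_L1)
  qed
  then have "1-lipschitz_on UNIV (\<lambda>u. abs_L1 (\<lambda>x. \<tau> x (rep_L1 u x)))"
    by (auto simp: lipschitz_on_def dist_norm)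
  then show ?thesis by (rule lipschitz_on_continuous_on)
qed

definition truncate :: "real \<Rightarrow> real \<Rightarrow> real" where "truncate k s = max (- k) (min k s)"

definition truncate_L1 :: "real \<Rightarrow> 'a::euclidean_space lebesgue_L1 \<Rightarrow> 'a lebesgue_L1"
  where "truncate_L1 k u = abs_L1 (\<lambda>x. truncate k (rep_L1 u x))"

lemma truncate_props:
  assumes "k \<ge> 0"
  shows "\<bar>truncate k s - truncate k t\<bar> \<le> \<bar>s - t\<bar>" "truncate k 0 = 0" "\<bar>truncate k s\<bar> \<le> k" "\<bar>s - truncate k s\<bar> \<le> \<bar>s\<bar>"
    "\<bar>s\<bar> \<le> k \<Longrightarrow> truncate k s = s"
  using assms by (auto simp: truncate_def max_def min_def)

lemma truncate_measurable [measurable]: "truncate k \<in> borel_measurable borel"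
  unfolding truncate_def[abs_def] by measurable

lemma truncate_L1_continuous: "k \<ge> 0 \<Longrightarrow> continuous_on UNIV (truncate_L1 k)"
  unfolding truncate_L1_def[abs_def]
  by (rule nonexpansive_L1_continuous) (use truncate_props in auto)

lemma truncate_integrable: "k \<ge> 0 \<Longrightarrow> integrable lebesgue (\<lambda>x. truncate k (rep_L1 u x))"
  by (rule nonexpansive_integrable) (use truncate_props in auto)

lemma rep_truncate_L1: "k \<ge> 0 \<Longrightarrow> AE x in lebesgue. rep_L1 (truncate_L1 k u) x = truncate k (rep_L1 u x)"
  unfolding truncate_L1_def by (rule rep_abs_L1[OF truncate_integrable])

lemma norm_diff_truncate_L1: "k \<ge> 0 \<Longrightarrow> norm (u - truncate_L1 k u) = (\<integral>x. \<bar>rep_L1 u x - truncate k (rep_L1 u x)\<bar> \<partial>lebesgue)"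
  unfolding truncate_L1_def by (rule norm_diff_abs_L1[OF truncate_integrable])

lemma truncate_L1_tendsto: "(\<lambda>n. norm (u - truncate_L1 (real n) u)) \<longlonglongrightarrow> 0"
proof -
  have "(\<lambda>n. \<integral>x. \<bar>rep_L1 u x - truncate (real n) (rep_L1 u x)\<bar> \<partial>lebesgue) \<longlonglongrightarrow> (\<integral>x. 0 \<partial>(lebesgue :: 'a measure))"
  proof (rule integral_dominated_convergence[where w="\<lambda>x. \<bar>rep_L1 u x\<bar>"])
    show "AE x in lebesgue. (\<lambda>n. \<bar>rep_L1 u x - truncate (real n) (rep_L1 u x)\<bar>) \<longlonglongrightarrow> 0"
    proof (rule AE_I2)
      fix x
      obtain N where "\<bar>rep_L1 u x\<bar> \<le> real N" using real_arch_simple by blast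
      then have "eventually (\<lambda>n. \<bar>rep_L1 u x - truncate (real n) (rep_L1 u x)\<bar> = 0) sequentially"
        by (intro eventually_sequentiallyI[of N]) (simp add: truncate_props(5))
      then show "(\<lambda>n. \<bar>rep_L1 u x - truncate (real n) (rep_L1 u x)\<bar>) \<longlonglongrightarrow> 0" by (rule tendsto_eventually)
    qed
  qed (use truncate_props(4) in auto)
  then show ?thesis by (simp add: norm_diff_truncate_L1)
qed

lemma norm_diff_truncate_L1_le: "norm (u - truncate_L1 (real n) u) \<le> norm u"
  unfolding norm_L1[of u]
  by (subst norm_diff_truncate_L1, simp, rule integral_mono) (use truncate_integrable[of "real n" u] truncate_props(4) in auto)

lemma L1_subspace: "subspace (L1 S)"
  unfolding subspace_def L1_def
proof (intro conjI ballI allI CollectI)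
  show "AE x in lebesgue. x \<notin> S \<longrightarrow> rep_L1 0 x = 0" using rep_L1_zero by eventually_elim simp
next
  fix u v :: "'a lebesgue_L1"
  assume "u \<in> {u. AE x in lebesgue. x \<notin> S \<longrightarrow> rep_L1 u x = 0}" "v \<in> {u. AE x in lebesgue. x \<notin> S \<longrightarrow> rep_L1 u x = 0}"
  then have "AE x in lebesgue. x \<notin> S \<longrightarrow> rep_L1 u x = 0" "AE x in lebesgue. x \<notin> S \<longrightarrow> rep_L1 v x = 0" by auto
  then show "AE x in lebesgue. x \<notin> S \<longrightarrow> rep_L1 (u + v) x = 0"
    using rep_L1_add[of u v] by eventually_elim simp
next
  fix c and u :: "'a lebesgue_L1"
  assume "u \<in> {u. AE x in lebesgue. x \<notin> S \<longrightarrow> rep_L1 u x = 0}"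
  then have "AE x in lebesgue. x \<notin> S \<longrightarrow> rep_L1 u x = 0" by auto
  then show "AE x in lebesgue. x \<notin> S \<longrightarrow> rep_L1 (c *\<^sub>R u) x = 0"
    using rep_L1_scaleR[of c u] by eventually_elim simp
qed

text \<open>It is the set of fixed points of a continuous map, the restriction to \<open>S\<close>.\<close>

lemma L1_closed:
  assumes S: "S \<in> sets lebesgue"
  shows "closed (L1 S)"
proof -
  let ?\<tau> = "\<lambda>x s. indicat_real S x * s"
  have m: "(\<lambda>x. ?\<tau> x (f x)) \<in> borel_measurable lebesgue" if "f \<in> borel_measurable lebesgue" for f
    using S that by measurable
  have l: "\<bar>?\<tau> x s - ?\<tau> x t\<bar> \<le> \<bar>s - t\<bar>" "?\<tau> x 0 = 0" for x s t by (auto simp: indicator_def)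
  have c: "continuous_on UNIV (\<lambda>u. abs_L1 (\<lambda>x. ?\<tau> x (rep_L1 u x)))"
    by (rule nonexpansive_L1_continuous[of ?\<tau>]) (erule m | rule l)+
  have i: "integrable lebesgue (\<lambda>x. ?\<tau> x (rep_L1 u x))" for u
    by (rule nonexpansive_integrable[of ?\<tau>]) (erule m | rule l)+
  have "L1 S = {u. abs_L1 (\<lambda>x. ?\<tau> x (rep_L1 u x)) = u}"
  proof (rule Collect_cong[of "\<lambda>u. AE x in lebesgue. x \<notin> S \<longrightarrow> rep_L1 u x = 0", folded L1_def], rule iffI)
    fix u assume "AE x in lebesgue. x \<notin> S \<longrightarrow> rep_L1 u x = 0"
    then show "abs_L1 (\<lambda>x. ?\<tau> x (rep_L1 u x)) = u"
      unfolding L1_eq_iff using rep_abs_L1[OF i[of u]] by eventually_elim (auto simp: indicator_def)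
  next
    fix u assume "abs_L1 (\<lambda>x. ?\<tau> x (rep_L1 u x)) = u"
    then have "AE x in lebesgue. rep_L1 u x = ?\<tau> x (rep_L1 u x)"
      using rep_abs_L1[OF i[of u]] by simp
    then show "AE x in lebesgue. x \<notin> S \<longrightarrow> rep_L1 u x = 0" by eventually_elim (auto simp: indicator_def)
  qed
  moreover have "closed {u. abs_L1 (\<lambda>x. ?\<tau> x (rep_L1 u x)) = u}"
    using c by (intro closed_Collect_eq continuous_on_id) auto
  ultimately show ?thesis by simp
qed

section \<open>The resolvent\<close>

context sobolev_domain
begin

lemma AE_L: "AE x in lebesgue. P x \<Longrightarrow> AE x in L. P x"
  using S_sets by (simp add: AE_restrict_space_iff) (erule eventually_mono, simp)

lemma rep_L1_L [measurable]: "rep_L1 u \<in> borel_measurable L"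
  by (rule measurable_restrict_space1) (rule rep_L1_measurable)

lemma rep_L1_integrable_L: "integrable L (rep_L1 u)"
proof -
  have "integrable lebesgue (\<lambda>x. indicat_real S x *\<^sub>R rep_L1 u x)"
    by (rule integrable_mult_indicator[OF S_sets rep_L1_integrable])
  then show ?thesis using S_sets by (subst integrable_restrict_space) simp_all
qed

lemma norm_diff_L1_on:
  assumes "u \<in> L1 S" "v \<in> L1 S"
  shows "norm (u - v) = (\<integral>x. \<bar>rep_L1 u x - rep_L1 v x\<bar> \<partial>L)"
proof -
  have "AE x in lebesgue. x \<notin> S \<longrightarrow> rep_L1 u x = 0" "AE x in lebesgue. x \<notin> S \<longrightarrow> rep_L1 v x = 0"
    using assms by (auto simp: L1_def)
  then have ae: "AE x in lebesgue. \<bar>rep_L1 u x - rep_L1 v x\<bar> = indicator S x *\<^sub>R \<bar>rep_L1 u x - rep_L1 v x\<bar>"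
    by eventually_elim (auto simp: indicator_def)
  have "norm (u - v) = (\<integral>x. indicator S x *\<^sub>R \<bar>rep_L1 u x - rep_L1 v x\<bar> \<partial>lebesgue)"
    unfolding norm_diff_L1
    by (intro integral_cong_AE ae borel_measurable_abs borel_measurable_diff borel_measurable_scaleR
        borel_measurable_indicator rep_L1_measurable S_sets)
  also have "\<dots> = (\<integral>x. \<bar>rep_L1 u x - rep_L1 v x\<bar> \<partial>L)" using S_sets by (subst integral_restrict_space) auto
  finally show ?thesis .
qed

end

locale neumann_data = sobolev_domain S p for S :: "'a::euclidean_space set" and p :: real +
  fixes g1 g2 :: real
  assumes g1: "0 < g1" and g12: "g1 \<le> g2"
begin

lemma neumann_of_L1: "\<gamma> \<in> L1_between g1 g2 S \<Longrightarrow> neumann_problem S p g1 g2 (rep_L1 \<gamma>)"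
  using g1 g12 by unfold_locales (auto simp: L1_between_def)

lemma p_laplace_accretive_L1:
  assumes \<gamma>: "\<gamma> \<in> L1_between g1 g2 S" and L1: "u \<in> L1 S" "v \<in> L1 S" "f \<in> L1 S" "f' \<in> L1 S"
    and u: "p_laplace_equation p S (rep_L1 \<gamma>) (rep_L1 u) (rep_L1 f)"
    and v: "p_laplace_equation p S (rep_L1 \<gamma>) (rep_L1 v) (rep_L1 f')" and \<alpha>: "\<alpha> \<ge> 0"
  shows "norm (u - v) \<le> norm (u - v + \<alpha> *\<^sub>R (f - f'))"
proof -
  interpret P: neumann_problem S p g1 g2 "rep_L1 \<gamma>" by (rule neumann_of_L1[OF \<gamma>])
  obtain G H where s: "P.weak_solution (rep_L1 f) (rep_L1 u) G" "P.weak_solution (rep_L1 f') (rep_L1 v) H"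
    using u v by (auto simp: P.p_laplace_equation_iff)
  have "norm (u - v) \<le> (\<integral>x. \<bar>rep_L1 u x - rep_L1 v x + \<alpha> * (rep_L1 f x - rep_L1 f' x)\<bar> \<partial>L)"
    unfolding norm_diff_L1_on[OF L1(1,2)]
    by (rule P.weak_solution_accretive[OF s rep_L1_integrable_L rep_L1_integrable_L \<alpha>])
  also have "\<dots> = (\<integral>x. \<bar>rep_L1 (u + \<alpha> *\<^sub>R f) x - rep_L1 (v + \<alpha> *\<^sub>R f') x\<bar> \<partial>L)"
  proof (rule integral_cong_AE)
    show "AE x in L. \<bar>rep_L1 u x - rep_L1 v x + \<alpha> * (rep_L1 f x - rep_L1 f' x)\<bar> = \<bar>rep_L1 (u + \<alpha> *\<^sub>R f) x - rep_L1 (v + \<alpha> *\<^sub>R f') x\<bar>"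
      using AE_L[OF rep_L1_add[of u "\<alpha> *\<^sub>R f"]] AE_L[OF rep_L1_add[of v "\<alpha> *\<^sub>R f'"]]
        AE_L[OF rep_L1_scaleR[of \<alpha> f]] AE_L[OF rep_L1_scaleR[of \<alpha> f']]
      by eventually_elim (simp add: algebra_simps)
  qed measurable
  also have "\<dots> = norm (u + \<alpha> *\<^sub>R f - (v + \<alpha> *\<^sub>R f'))"
    using L1 by (intro norm_diff_L1_on[symmetric] subspace_add[OF L1_subspace] subspace_scale[OF L1_subspace]) auto
  finally show ?thesis by (simp add: algebra_simps)
qed

text \<open>The weak equation \<open>v + A v = \<eta>\<close> on the level of classes of functions, for the weight \<open>\<gamma>\<close>.\<close>

definition is_solution :: "'a lebesgue_L1 \<Rightarrow> 'a lebesgue_L1 \<Rightarrow> 'a lebesgue_L1 \<Rightarrow> bool"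
  where "is_solution \<gamma> \<eta> v \<longleftrightarrow> v \<in> L1 S \<and> rep_L1 v \<in> Linfty S \<and>
    p_laplace_equation p S (rep_L1 \<gamma>) (rep_L1 v) (rep_L1 (\<eta> - v))"

lemma ex_solution_L1:
  assumes \<gamma>: "\<gamma> \<in> L1_between g1 g2 S" and \<eta>: "AE x in L. \<bar>rep_L1 \<eta> x\<bar> \<le> m" and m: "m \<ge> 0"
  shows "\<exists>v G. is_solution \<gamma> \<eta> v \<and> (AE x in L. \<bar>rep_L1 v x\<bar> \<le> m) \<and>
    neumann_problem.weak_solution S p (rep_L1 \<gamma>) (\<lambda>x. rep_L1 \<eta> x - rep_L1 v x) (rep_L1 v) G"
proof -
  interpret P: neumann_problem S p g1 g2 "rep_L1 \<gamma>" by (rule neumann_of_L1[OF \<gamma>])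
  obtain u G where u: "P.weak_solution (\<lambda>x. rep_L1 \<eta> x - u x) u G" "AE x in L. \<bar>u x\<bar> \<le> m"
    using P.ex_bounded_solution[OF _ \<eta> m] by auto
  have "W1p_gradient p S u G" using u by (simp add: P.weak_solution_def)
  note D = W1p_gradientD[OF this] and [measurable] = W1p_gradientD(6)[OF this]
  have i: "integrable lebesgue (\<lambda>x. indicat_real S x * u x)"
    using D(4) S_sets by (subst (asm) integrable_restrict_space) auto
  define v where "v = abs_L1 (\<lambda>x. indicat_real S x * u x)"
  have rv: "AE x in lebesgue. rep_L1 v x = indicat_real S x * u x" unfolding v_def by (rule rep_abs_L1[OF i])
  have vS: "v \<in> L1 S" unfolding L1_def using rv by (auto elim!: eventually_mono)
  have "AE x in lebesgue. x \<in> S \<longrightarrow> u x = rep_L1 v x" using rv by eventually_elim auto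
  then have vu: "AE x in L. u x = rep_L1 v x" using S_sets by (simp add: AE_restrict_space_iff)
  have vm: "AE x in L. \<bar>rep_L1 v x\<bar> \<le> m" using u(2) vu by eventually_elim simp
  have s: "P.weak_solution (\<lambda>x. rep_L1 \<eta> x - rep_L1 v x) (rep_L1 v) G"
    by (rule P.weak_solution_cong[OF u(1) _ vu]) (use vu in \<open>auto elim: eventually_mono\<close>)
  have "P.weak_solution (rep_L1 (\<eta> - v)) (rep_L1 v) G"
    by (rule P.weak_solution_cong[OF s]) (use AE_L[OF rep_L1_diff[of \<eta> v]] in \<open>auto elim: eventually_mono\<close>)
  then have "is_solution \<gamma> \<eta> v"
    unfolding is_solution_def P.p_laplace_equation_iff using vS vm P.LinftyI[of "rep_L1 v"] by auto
  then show ?thesis using vm s by blast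
qed

lemma is_solution_contraction:
  assumes \<gamma>: "\<gamma> \<in> L1_between g1 g2 S" and "\<eta> \<in> L1 S" "\<eta>' \<in> L1 S" "is_solution \<gamma> \<eta> v" "is_solution \<gamma> \<eta>' v'"
  shows "norm (v - v') \<le> norm (\<eta> - \<eta>')"
proof -
  have "norm (v - v') \<le> norm (v - v' + 1 *\<^sub>R ((\<eta> - v) - (\<eta>' - v')))"
    using assms by (intro p_laplace_accretive_L1[OF \<gamma>] subspace_diff[OF L1_subspace]) (auto simp: is_solution_def)
  then show ?thesis by simp
qed

text \<open>Solutions exist by \<open>ex_solution_L1\<close> and are unique by \<open>is_solution_contraction\<close>, so on
\<open>solvable_data\<close> the choice is no choice.\<close>

definition resolvent :: "'a lebesgue_L1 \<times> 'a lebesgue_L1 \<Rightarrow> 'a lebesgue_L1"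
  where "resolvent z = (SOME v. is_solution (fst z) (snd z) v)"

definition solvable_data :: "('a lebesgue_L1 \<times> 'a lebesgue_L1) set"
  where "solvable_data = L1_between g1 g2 S \<times> {\<eta> \<in> L1 S. rep_L1 \<eta> \<in> Linfty S}"

lemma Linfty_bound:
  assumes "f \<in> Linfty S"
  obtains m where "m \<ge> 0" "AE x in L. \<bar>f x\<bar> \<le> m"
proof -
  obtain C where "AE x in L. \<bar>f x\<bar> \<le> C" using assms by (auto simp: Linfty_def)
  then have "AE x in L. \<bar>f x\<bar> \<le> max C 0" by eventually_elim simp
  then show thesis using that[of "max C 0"] by simp
qed

lemma resolvent_is_solution:
  assumes "(\<gamma>, \<eta>) \<in> solvable_data"
  shows "is_solution \<gamma> \<eta> (resolvent (\<gamma>, \<eta>))"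
proof -
  have \<gamma>: "\<gamma> \<in> L1_between g1 g2 S" and "rep_L1 \<eta> \<in> Linfty S" using assms by (auto simp: solvable_data_def)
  then obtain m where "m \<ge> 0" "AE x in L. \<bar>rep_L1 \<eta> x\<bar> \<le> m" using Linfty_bound by blast
  with ex_solution_L1[OF \<gamma>] have "\<exists>v. is_solution \<gamma> \<eta> v" by blast
  then show ?thesis unfolding resolvent_def by (simp add: someI_ex)
qed

lemma resolvent_unique:
  assumes "(\<gamma>, \<eta>) \<in> solvable_data" "is_solution \<gamma> \<eta> v"
  shows "resolvent (\<gamma>, \<eta>) = v"
  using is_solution_contraction[of \<gamma> \<eta> \<eta> "resolvent (\<gamma>, \<eta>)" v] resolvent_is_solution[OF assms(1)] assms
  by (auto simp: solvable_data_def)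

text \<open>The datum is changed first, at the cost of its distance in \<open>L^1\<close> uniformly in the weight; then the weight
is changed for a fixed datum, whose bound \<open>m\<close> is shared by all solutions.\<close>

lemma resolvent_continuous: "continuous_on solvable_data resolvent"
  unfolding continuous_on_sequentially
proof (intro allI ballI impI, elim conjE)
  fix z z0 assume z0: "z0 \<in> solvable_data" and z: "\<forall>n. z n \<in> solvable_data" and lim: "z \<longlonglongrightarrow> z0"
  define \<gamma> \<eta> \<gamma>n \<eta>n where "\<gamma> = fst z0" and "\<eta> = snd z0" and "\<gamma>n n = fst (z n)" and "\<eta>n n = snd (z n)" for n
  have zs: "z0 = (\<gamma>, \<eta>)" "z n = (\<gamma>n n, \<eta>n n)" for n by (auto simp: \<gamma>_def \<eta>_def \<gamma>n_def \<eta>n_def)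
  have d0: "(\<gamma>, \<eta>) \<in> solvable_data" and dn: "(\<gamma>n n, \<eta>n n) \<in> solvable_data" "(\<gamma>n n, \<eta>) \<in> solvable_data" for n
    using z0 z unfolding zs by (auto simp: solvable_data_def)
  have \<gamma>b: "\<gamma> \<in> L1_between g1 g2 S" "\<gamma>n n \<in> L1_between g1 g2 S" and \<eta>L: "\<eta> \<in> L1 S" "\<eta>n n \<in> L1 S" for n
    using d0 dn by (auto simp: solvable_data_def)
  have lim1: "\<gamma>n \<longlonglongrightarrow> \<gamma>" and lim2: "\<eta>n \<longlonglongrightarrow> \<eta>"
    unfolding \<gamma>_def \<eta>_def \<gamma>n_def \<eta>n_def using lim by (auto intro: tendsto_intros)
  have "rep_L1 \<eta> \<in> Linfty S" using d0 by (auto simp: solvable_data_def)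
  then obtain m where m: "m \<ge> 0" "AE x in L. \<bar>rep_L1 \<eta> x\<bar> \<le> m" using Linfty_bound by blast
  obtain v G where v: "is_solution \<gamma> \<eta> v" "AE x in L. \<bar>rep_L1 v x\<bar> \<le> m"
    "neumann_problem.weak_solution S p (rep_L1 \<gamma>) (\<lambda>x. rep_L1 \<eta> x - rep_L1 v x) (rep_L1 v) G"
    using ex_solution_L1[OF \<gamma>b(1) m(2,1)] by blast
  have "\<forall>n. \<exists>v G. is_solution (\<gamma>n n) \<eta> v \<and> (AE x in L. \<bar>rep_L1 v x\<bar> \<le> m) \<and>
    neumann_problem.weak_solution S p (rep_L1 (\<gamma>n n)) (\<lambda>x. rep_L1 \<eta> x - rep_L1 v x) (rep_L1 v) G"
    using ex_solution_L1[OF \<gamma>b(2) m(2,1)] by blast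
  then obtain vn Gn where vn: "\<And>n. is_solution (\<gamma>n n) \<eta> (vn n)" "\<And>n. AE x in L. \<bar>rep_L1 (vn n) x\<bar> \<le> m"
    "\<And>n. neumann_problem.weak_solution S p (rep_L1 (\<gamma>n n)) (\<lambda>x. rep_L1 \<eta> x - rep_L1 (vn n) x) (rep_L1 (vn n)) (Gn n)"
    by metis
  have "(\<lambda>n. norm (\<gamma>n n - \<gamma>)) \<longlonglongrightarrow> 0" using lim1 by (simp add: LIM_zero_iff tendsto_norm_zero_iff)
  moreover have "norm (\<gamma>n n - \<gamma>) = (\<integral>x. \<bar>rep_L1 (\<gamma>n n) x - rep_L1 \<gamma> x\<bar> \<partial>L)" for n
    using \<gamma>b by (intro norm_diff_L1_on) (auto simp: L1_between_def)
  ultimately have limg: "(\<lambda>n. \<integral>x. \<bar>rep_L1 (\<gamma>n n) x - rep_L1 \<gamma> x\<bar> \<partial>L) \<longlonglongrightarrow> 0" by simp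
  have "(\<lambda>n. \<integral>x. \<bar>rep_L1 (vn n) x - rep_L1 v x\<bar> \<partial>L) \<longlonglongrightarrow> 0"
    by (rule solutions_tendsto[OF neumann_of_L1[OF \<gamma>b(1)] neumann_of_L1[OF \<gamma>b(2)] v(3) vn(3) v(2) vn(2) rep_L1_L m(2,1) limg])
  moreover have "norm (vn n - v) = (\<integral>x. \<bar>rep_L1 (vn n) x - rep_L1 v x\<bar> \<partial>L)" for n
    using v(1) vn(1) by (intro norm_diff_L1_on) (auto simp: is_solution_def)
  ultimately have limv: "(\<lambda>n. norm (vn n - v)) \<longlonglongrightarrow> 0" by simp
  have "(\<lambda>n. norm (\<eta>n n - \<eta>)) \<longlonglongrightarrow> 0" using lim2 by (simp add: LIM_zero_iff tendsto_norm_zero_iff)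
  from tendsto_add[OF this limv] have lims: "(\<lambda>n. norm (\<eta>n n - \<eta>) + norm (vn n - v)) \<longlonglongrightarrow> 0" by simp
  have "(\<lambda>n. resolvent (z n) - resolvent z0) \<longlonglongrightarrow> 0"
  proof (rule Lim_null_comparison[OF _ lims], rule always_eventually, rule allI)
    fix n
    have e0: "resolvent z0 = v" unfolding zs by (rule resolvent_unique[OF d0 v(1)])
    have "norm (resolvent (z n) - vn n) \<le> norm (\<eta>n n - \<eta>)"
      unfolding zs by (rule is_solution_contraction[OF \<gamma>b(2) \<eta>L(2,1) resolvent_is_solution[OF dn(1)] vn(1)])
    then show "norm (resolvent (z n) - resolvent z0) \<le> norm (\<eta>n n - \<eta>) + norm (vn n - v)"
      unfolding e0 using norm_triangle_ineq[of "resolvent (z n) - vn n" "vn n - v"] by simp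
  qed
  then show "(resolvent \<circ> z) \<longlonglongrightarrow> resolvent z0" by (simp add: LIM_zero_iff o_def)
qed

lemma zero_is_solution: "\<gamma> \<in> L1_between g1 g2 S \<Longrightarrow> is_solution \<gamma> 0 0"
proof -
  assume \<gamma>: "\<gamma> \<in> L1_between g1 g2 S"
  have "AE x in L. \<bar>rep_L1 0 x\<bar> \<le> 0" using AE_L[OF rep_L1_zero] by eventually_elim simp
  from ex_solution_L1[OF \<gamma> this] obtain v where v: "is_solution \<gamma> 0 v" "AE x in L. \<bar>rep_L1 v x\<bar> \<le> 0" by auto
  have "norm (v - 0) = (\<integral>x. \<bar>rep_L1 v x - rep_L1 0 x\<bar> \<partial>L)"
    using v subspace_0[OF L1_subspace] by (intro norm_diff_L1_on) (auto simp: is_solution_def)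
  also have "\<dots> = (\<integral>x. 0 \<partial>L)"
    by (rule integral_cong_AE) (use v(2) AE_L[OF rep_L1_zero] in \<open>auto elim: eventually_elim2\<close>)
  finally have "v = 0" by simp
  with v show ?thesis by simp
qed

lemma norm_resolvent_le:
  assumes "(\<gamma>, \<eta>) \<in> solvable_data"
  shows "norm (resolvent (\<gamma>, \<eta>)) \<le> norm \<eta>"
  using is_solution_contraction[of \<gamma> \<eta> 0, OF _ _ subspace_0[OF L1_subspace] resolvent_is_solution[OF assms] zero_is_solution] assms
  by (simp add: solvable_data_def)

end

section \<open>Closures of accretive operators\<close>

lemma bochner_L1_integrable:
  fixes f :: "'w \<Rightarrow> 'b::{banach,second_countable_topology}"
  assumes "f \<in> bochner_L1 M X"
  shows "integrable M f" "f \<in> borel_measurable M" "\<And>\<omega>. \<omega> \<in> space M \<Longrightarrow> f \<omega> \<in> X"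
  using assms by (auto simp: bochner_L1_def integrable_norm_iff)

lemma bochner_L1I:
  fixes f :: "'w \<Rightarrow> 'b::{banach,second_countable_topology}"
  assumes "integrable M f" "\<And>\<omega>. \<omega> \<in> space M \<Longrightarrow> f \<omega> \<in> X"
  shows "f \<in> bochner_L1 M X"
  using assms by (auto simp: bochner_L1_def)

lemma bochner_norm_add_le:
  fixes f h :: "'w \<Rightarrow> 'b::{banach,second_countable_topology}"
  assumes "integrable M f" "integrable M h"
  shows "bochner_norm M (\<lambda>\<omega>. f \<omega> + h \<omega>) \<le> bochner_norm M f + bochner_norm M h"
proof -
  have "bochner_norm M (\<lambda>\<omega>. f \<omega> + h \<omega>) \<le> (\<integral>\<omega>. norm (f \<omega>) + norm (h \<omega>) \<partial>M)"
    unfolding bochner_norm_def using assms by (intro integral_mono) (auto simp: norm_triangle_ineq)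
  also have "\<dots> = bochner_norm M f + bochner_norm M h"
    unfolding bochner_norm_def using assms by (intro Bochner_Integration.integral_add) auto
  finally show ?thesis .
qed

lemma bochner_norm_scaleR: "bochner_norm M (\<lambda>\<omega>. c *\<^sub>R f \<omega>) = \<bar>c\<bar> * bochner_norm M f"
  by (simp add: bochner_norm_def)

lemma bochner_norm_minus_commute: "bochner_norm M (\<lambda>\<omega>. f \<omega> - h \<omega>) = bochner_norm M (\<lambda>\<omega>. h \<omega> - f \<omega>)"
  by (simp add: bochner_norm_def norm_minus_commute)

text \<open>Accretivity is an inequality between continuous functions of the pairs, so it survives the passage to
limits of pairs.\<close>

lemma accretive_operator_closure:
  fixes B :: "(('w \<Rightarrow> 'b::{banach,second_countable_topology}) \<times> ('w \<Rightarrow> 'b)) set"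
  assumes B: "accretive M B" "B \<subseteq> bochner_L1 M X \<times> bochner_L1 M X"
  shows "accretive M (operator_closure M X B)"
  unfolding accretive_def
proof (clarify)
  fix f f' h h' :: "'w \<Rightarrow> 'b" and \<alpha> :: real
  assume f: "(f, f') \<in> operator_closure M X B" and h: "(h, h') \<in> operator_closure M X B" and \<alpha>: "\<alpha> > 0"
  let ?N = "bochner_norm M"
  show "?N (\<lambda>\<omega>. f \<omega> - h \<omega>) \<le> ?N (\<lambda>\<omega>. f \<omega> - h \<omega> + \<alpha> *\<^sub>R (f' \<omega> - h' \<omega>))"
  proof (rule field_le_epsilon)
    fix d :: real assume d: "d > 0"
    \<comment> \<open>four unscaled and two \<open>\<alpha>\<close>-scaled errors occur below\<close>
    define e where "e = d / (4 + 2 * \<alpha>)"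
    have e: "e > 0" using d \<alpha> by (simp add: e_def)
    obtain f1 f1' where f1: "(f1, f1') \<in> B" "?N (\<lambda>\<omega>. f \<omega> - f1 \<omega>) < e" "?N (\<lambda>\<omega>. f' \<omega> - f1' \<omega>) < e"
      using f e unfolding operator_closure_def by blast
    obtain h1 h1' where h1: "(h1, h1') \<in> B" "?N (\<lambda>\<omega>. h \<omega> - h1 \<omega>) < e" "?N (\<lambda>\<omega>. h' \<omega> - h1' \<omega>) < e"
      using h e unfolding operator_closure_def by blast
    have i: "integrable M f" "integrable M f'" "integrable M h" "integrable M h'"
      using f h by (auto simp: operator_closure_def dest: bochner_L1_integrable(1))
    have i1: "integrable M f1" "integrable M f1'" "integrable M h1" "integrable M h1'"
      using f1(1) h1(1) B(2) by (auto dest: bochner_L1_integrable(1))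
    have "?N (\<lambda>\<omega>. f \<omega> - h \<omega>) = ?N (\<lambda>\<omega>. (f \<omega> - f1 \<omega>) + ((f1 \<omega> - h1 \<omega>) + (h1 \<omega> - h \<omega>)))" by (simp add: algebra_simps)
    also have "\<dots> \<le> ?N (\<lambda>\<omega>. f \<omega> - f1 \<omega>) + ?N (\<lambda>\<omega>. (f1 \<omega> - h1 \<omega>) + (h1 \<omega> - h \<omega>))"
      using i i1 by (intro bochner_norm_add_le) auto
    also have "?N (\<lambda>\<omega>. (f1 \<omega> - h1 \<omega>) + (h1 \<omega> - h \<omega>)) \<le> ?N (\<lambda>\<omega>. f1 \<omega> - h1 \<omega>) + ?N (\<lambda>\<omega>. h1 \<omega> - h \<omega>)"
      using i i1 by (intro bochner_norm_add_le) auto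
    finally have 1: "?N (\<lambda>\<omega>. f \<omega> - h \<omega>) \<le> ?N (\<lambda>\<omega>. f1 \<omega> - h1 \<omega>) + 2 * e"
      using f1(2) h1(2) by (simp add: bochner_norm_minus_commute[of M h1 h])
    have 2: "?N (\<lambda>\<omega>. f1 \<omega> - h1 \<omega>) \<le> ?N (\<lambda>\<omega>. f1 \<omega> - h1 \<omega> + \<alpha> *\<^sub>R (f1' \<omega> - h1' \<omega>))"
      using B(1) f1(1) h1(1) \<alpha> unfolding accretive_def by blast
    let ?L = "\<lambda>\<omega>. f \<omega> - h \<omega> + \<alpha> *\<^sub>R (f' \<omega> - h' \<omega>)"
    let ?R1 = "\<lambda>\<omega>. f1 \<omega> - f \<omega>" and ?R2 = "\<lambda>\<omega>. h \<omega> - h1 \<omega>"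
      and ?R3 = "\<lambda>\<omega>. \<alpha> *\<^sub>R (f1' \<omega> - f' \<omega>)" and ?R4 = "\<lambda>\<omega>. \<alpha> *\<^sub>R (h' \<omega> - h1' \<omega>)"
    have "?N (\<lambda>\<omega>. f1 \<omega> - h1 \<omega> + \<alpha> *\<^sub>R (f1' \<omega> - h1' \<omega>)) = ?N (\<lambda>\<omega>. ?L \<omega> + (?R1 \<omega> + (?R2 \<omega> + (?R3 \<omega> + ?R4 \<omega>))))"
      by (simp add: algebra_simps)
    also have "\<dots> \<le> ?N ?L + ?N (\<lambda>\<omega>. ?R1 \<omega> + (?R2 \<omega> + (?R3 \<omega> + ?R4 \<omega>)))"
      using i i1 by (intro bochner_norm_add_le) auto
    also have "?N (\<lambda>\<omega>. ?R1 \<omega> + (?R2 \<omega> + (?R3 \<omega> + ?R4 \<omega>))) \<le> ?N ?R1 + ?N (\<lambda>\<omega>. ?R2 \<omega> + (?R3 \<omega> + ?R4 \<omega>))"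
      using i i1 by (intro bochner_norm_add_le) auto
    also have "?N (\<lambda>\<omega>. ?R2 \<omega> + (?R3 \<omega> + ?R4 \<omega>)) \<le> ?N ?R2 + ?N (\<lambda>\<omega>. ?R3 \<omega> + ?R4 \<omega>)"
      using i i1 by (intro bochner_norm_add_le) auto
    also have "?N (\<lambda>\<omega>. ?R3 \<omega> + ?R4 \<omega>) \<le> ?N ?R3 + ?N ?R4"
      using i i1 by (intro bochner_norm_add_le) auto
    finally have 3: "?N (\<lambda>\<omega>. f1 \<omega> - h1 \<omega> + \<alpha> *\<^sub>R (f1' \<omega> - h1' \<omega>)) \<le> ?N ?L + (?N ?R1 + (?N ?R2 + (?N ?R3 + ?N ?R4)))" by simp
    have R3: "?N ?R3 \<le> \<alpha> * e" using f1(3) \<alpha> unfolding bochner_norm_scaleR by (simp add: bochner_norm_minus_commute[of M f1' f'])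
    have R4: "?N ?R4 \<le> \<alpha> * e" using h1(3) \<alpha> unfolding bochner_norm_scaleR by simp
    have R12: "?N ?R1 \<le> e" "?N ?R2 \<le> e" using f1(2) h1(2) by (simp_all add: bochner_norm_minus_commute[of M f1 f])
    have "?N (\<lambda>\<omega>. f \<omega> - h \<omega>) \<le> ?N ?L + (4 * e + 2 * (\<alpha> * e))" using 1 2 3 R3 R4 R12 by linarith
    also have "4 * e + 2 * (\<alpha> * e) = d"
    proof -
      have "4 * e + 2 * (\<alpha> * e) = (4 + 2 * \<alpha>) * e" by (simp add: algebra_simps)
      moreover have "4 + 2 * \<alpha> \<noteq> 0" using \<alpha> by linarith
      ultimately show ?thesis by (simp add: e_def)
    qed
    finally show "?N (\<lambda>\<omega>. f \<omega> - h \<omega>) \<le> ?N ?L + d" .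
  qed
qed

text \<open>The limit takes values in \<open>X\<close> only almost surely; it is redefined as zero on the exceptional event, since
members of \<open>bochner_L1\<close> take values in \<open>X\<close> everywhere.\<close>

lemma bochner_L1_complete:
  fixes f :: "nat \<Rightarrow> 'w \<Rightarrow> 'b::{banach,second_countable_topology}"
  assumes X: "subspace X" "closed X" and f: "\<And>n. f n \<in> bochner_L1 M X"
    and cauchy: "\<And>e. e > 0 \<Longrightarrow> \<exists>N. \<forall>m\<ge>N. \<forall>n\<ge>N. bochner_norm M (\<lambda>\<omega>. f m \<omega> - f n \<omega>) < e"
  obtains F where "F \<in> bochner_L1 M X" "(\<lambda>n. bochner_norm M (\<lambda>\<omega>. f n \<omega> - F \<omega>)) \<longlonglongrightarrow> 0"
proof -
  note i = bochner_L1_integrable(1)[OF f] and [measurable] = bochner_L1_integrable(2)[OF f]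
  have i1: "integrable M (\<lambda>\<omega>. norm (f m \<omega> - f n \<omega>) powr 1)" for m n using i by simp
  have c1: "\<exists>N. \<forall>m\<ge>N. \<forall>n\<ge>N. (\<integral>\<omega>. norm (f m \<omega> - f n \<omega>) powr 1 \<partial>M) < e" if "e > 0" for e
    using cauchy[OF that] by (simp add: bochner_norm_def)
  obtain F0 where F0 [measurable]: "F0 \<in> borel_measurable M"
    and "\<And>n. integrable M (\<lambda>\<omega>. norm (f n \<omega> - F0 \<omega>) powr 1)" "(\<lambda>n. \<integral>\<omega>. norm (f n \<omega> - F0 \<omega>) powr 1 \<partial>M) \<longlonglongrightarrow> 0"
    using Lp_complete[OF zero_less_one bochner_L1_integrable(2)[OF f] i1 c1] by blast
  then have iN: "\<And>n. integrable M (\<lambda>\<omega>. norm (f n \<omega> - F0 \<omega>))" and lim: "(\<lambda>n. \<integral>\<omega>. norm (f n \<omega> - F0 \<omega>) \<partial>M) \<longlonglongrightarrow> 0" by simp_all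
  have iF: "integrable M (\<lambda>\<omega>. f n \<omega> - F0 \<omega>)" for n
    by (rule Bochner_Integration.integrable_bound[OF iN[of n]]) auto
  obtain r :: "nat \<Rightarrow> nat" where r: "AE \<omega> in M. (\<lambda>n. f (r n) \<omega> - F0 \<omega>) \<longlonglongrightarrow> 0"
    using tendsto_L1_AE_subseq[of M "\<lambda>n \<omega>. f n \<omega> - F0 \<omega>", OF iF lim] by blast
  have FX: "AE \<omega> in M. F0 \<omega> \<in> X"
    using r AE_space
  proof eventually_elim
    case (elim \<omega>)
    have "(\<lambda>n. f (r n) \<omega>) \<longlonglongrightarrow> F0 \<omega>" using elim(1) by (rule LIM_zero_cancel)
    then show ?case by (rule closed_sequentially[OF X(2) bochner_L1_integrable(3)[OF f elim(2)]])
  qed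
  define F where "F \<omega> = (if F0 \<omega> \<in> X then F0 \<omega> else 0)" for \<omega>
  have Xm: "X \<in> sets borel" using X(2) by auto
  have Fm [measurable]: "F \<in> borel_measurable M" unfolding F_def[abs_def] using Xm by measurable
  have FF: "AE \<omega> in M. F \<omega> = F0 \<omega>" using FX by eventually_elim (simp add: F_def)
  have "integrable M (\<lambda>\<omega>. f 0 \<omega> - (f 0 \<omega> - F0 \<omega>))" by (rule Bochner_Integration.integrable_diff[OF i iF])
  then have "integrable M F0" by simp
  then have iFF: "integrable M F" using FF by (subst integrable_cong_AE[of _ _ F0]) auto
  show thesis
  proof
    show "F \<in> bochner_L1 M X" by (rule bochner_L1I[OF iFF]) (auto simp: F_def subspace_0[OF X(1)])
    have "bochner_norm M (\<lambda>\<omega>. f n \<omega> - F \<omega>) = (\<integral>\<omega>. norm (f n \<omega> - F0 \<omega>) \<partial>M)" for n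
      unfolding bochner_norm_def by (rule integral_cong_AE) (use FF in \<open>auto elim: eventually_mono\<close>)
    then show "(\<lambda>n. bochner_norm M (\<lambda>\<omega>. f n \<omega> - F \<omega>)) \<longlonglongrightarrow> 0" using lim by simp
  qed
qed

text \<open>Given \<open>h\<close>, choose \<open>(f n, f' n)\<close> in \<open>B\<close> with \<open>f n + f' n\<close> close to \<open>h\<close>.  Accretivity with
\<open>\<alpha> = 1\<close> bounds the distances of the \<open>f n\<close> by those of the sums; so \<open>f n\<close> converges to some \<open>F\<close>,
and \<open>(F, h - F)\<close> lies in the closure.\<close>

theorem m_accretive_operator_closure:
  fixes B :: "(('w \<Rightarrow> 'b::{banach,second_countable_topology}) \<times> ('w \<Rightarrow> 'b)) set"
  assumes X: "subspace X" "closed X" and B: "accretive M B" "B \<subseteq> bochner_L1 M X \<times> bochner_L1 M X"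
    and dense: "dense_in_bochner_L1 M X (range_Id_plus B)"
  shows "m_accretive M X (operator_closure M X B)"
  unfolding m_accretive_def
proof (intro conjI)
  let ?C = "operator_closure M X B" and ?N = "bochner_norm M"
  show sub: "?C \<subseteq> bochner_L1 M X \<times> bochner_L1 M X" by (auto simp: operator_closure_def)
  show "accretive M ?C" by (rule accretive_operator_closure[OF B])
  show "range_Id_plus ?C = bochner_L1 M X"
  proof
    show "range_Id_plus ?C \<subseteq> bochner_L1 M X"
    proof
      fix k assume "k \<in> range_Id_plus ?C"
      then obtain f f' where k: "k = (\<lambda>\<omega>. f \<omega> + f' \<omega>)" and ff: "(f, f') \<in> ?C"
        unfolding range_Id_plus_def by blast
      from ff sub have f: "f \<in> bochner_L1 M X" "f' \<in> bochner_L1 M X" by auto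
      show "k \<in> bochner_L1 M X" unfolding k
        by (rule bochner_L1I[OF Bochner_Integration.integrable_add[OF bochner_L1_integrable(1)[OF f(1)] bochner_L1_integrable(1)[OF f(2)]]])
          (rule subspace_add[OF X(1) bochner_L1_integrable(3)[OF f(1)] bochner_L1_integrable(3)[OF f(2)]])
    qed
    show "bochner_L1 M X \<subseteq> range_Id_plus ?C"
    proof
      fix h assume h: "h \<in> bochner_L1 M X"
      have "\<exists>f f'. (f, f') \<in> B \<and> ?N (\<lambda>\<omega>. h \<omega> - (f \<omega> + f' \<omega>)) < 1 / real (Suc n)" for n
      proof -
        have "1 / real (Suc n) > 0" by simp
        then obtain k where "k \<in> range_Id_plus B" "?N (\<lambda>\<omega>. h \<omega> - k \<omega>) < 1 / real (Suc n)"
          using dense h unfolding dense_in_bochner_L1_def by blast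
        then show ?thesis by (auto simp: range_Id_plus_def)
      qed
      then obtain f f' where f: "\<And>n. (f n, f' n) \<in> B" "\<And>n. ?N (\<lambda>\<omega>. h \<omega> - (f n \<omega> + f' n \<omega>)) < 1 / real (Suc n)" by metis
      have fX: "f n \<in> bochner_L1 M X" "f' n \<in> bochner_L1 M X" for n using f(1) B(2) by auto
      note ih = bochner_L1_integrable(1)[OF h] and i = bochner_L1_integrable(1)[OF fX(1)] and i' = bochner_L1_integrable(1)[OF fX(2)]
      have t0: "(\<lambda>n. 1 / real (Suc n)) \<longlonglongrightarrow> 0" using LIMSEQ_inverse_real_of_nat by (simp add: inverse_eq_divide)
      have c: "?N (\<lambda>\<omega>. f m \<omega> - f n \<omega>) \<le> 1 / real (Suc m) + 1 / real (Suc n)" for m n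
      proof -
        have "?N (\<lambda>\<omega>. f m \<omega> - f n \<omega>) \<le> ?N (\<lambda>\<omega>. f m \<omega> - f n \<omega> + 1 *\<^sub>R (f' m \<omega> - f' n \<omega>))"
          using B(1) f(1)[of m] f(1)[of n] zero_less_one unfolding accretive_def by blast
        also have "\<dots> = ?N (\<lambda>\<omega>. ((f m \<omega> + f' m \<omega>) - h \<omega>) + (h \<omega> - (f n \<omega> + f' n \<omega>)))" by (simp add: algebra_simps)
        also have "\<dots> \<le> ?N (\<lambda>\<omega>. (f m \<omega> + f' m \<omega>) - h \<omega>) + ?N (\<lambda>\<omega>. h \<omega> - (f n \<omega> + f' n \<omega>))"
          using ih i i' by (intro bochner_norm_add_le) auto
        also have "?N (\<lambda>\<omega>. (f m \<omega> + f' m \<omega>) - h \<omega>) = ?N (\<lambda>\<omega>. h \<omega> - (f m \<omega> + f' m \<omega>))" by (rule bochner_norm_minus_commute)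
        finally show ?thesis using f(2)[of m] f(2)[of n] by linarith
      qed
      obtain F where F: "F \<in> bochner_L1 M X" "(\<lambda>n. ?N (\<lambda>\<omega>. f n \<omega> - F \<omega>)) \<longlonglongrightarrow> 0"
      proof (rule bochner_L1_complete[OF X fX(1)])
        fix e :: real assume e: "e > 0"
        then have "eventually (\<lambda>n. 1 / real (Suc n) < e / 2) sequentially" by (intro order_tendstoD(2)[OF t0]) simp
        then obtain N where N: "\<And>n. n \<ge> N \<Longrightarrow> 1 / real (Suc n) < e / 2" by (auto simp: eventually_sequentially)
        have "?N (\<lambda>\<omega>. f m \<omega> - f n \<omega>) < e" if "m \<ge> N" "n \<ge> N" for m n
          using c[of m n] N[OF that(1)] N[OF that(2)] by linarith
        then show "\<exists>N. \<forall>m\<ge>N. \<forall>n\<ge>N. ?N (\<lambda>\<omega>. f m \<omega> - f n \<omega>) < e" by blast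
      qed
      define F' where "F' \<omega> = h \<omega> - F \<omega>" for \<omega>
      note iF = bochner_L1_integrable(1)[OF F(1)]
      have F'X: "F' \<in> bochner_L1 M X"
        unfolding F'_def[abs_def] using ih iF bochner_L1_integrable(3)[OF h] bochner_L1_integrable(3)[OF F(1)]
        by (intro bochner_L1I subspace_diff[OF X(1)]) auto
      have c1: "?N (\<lambda>\<omega>. F \<omega> - f n \<omega>) = ?N (\<lambda>\<omega>. f n \<omega> - F \<omega>)" for n by (rule bochner_norm_minus_commute)
      have c2: "?N (\<lambda>\<omega>. F' \<omega> - f' n \<omega>) \<le> 1 / real (Suc n) + ?N (\<lambda>\<omega>. f n \<omega> - F \<omega>)" for n
      proof -
        have "?N (\<lambda>\<omega>. F' \<omega> - f' n \<omega>) = ?N (\<lambda>\<omega>. (h \<omega> - (f n \<omega> + f' n \<omega>)) + (f n \<omega> - F \<omega>))"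
          by (simp add: F'_def algebra_simps)
        also have "\<dots> \<le> ?N (\<lambda>\<omega>. h \<omega> - (f n \<omega> + f' n \<omega>)) + ?N (\<lambda>\<omega>. f n \<omega> - F \<omega>)"
          using ih i i' iF by (intro bochner_norm_add_le) auto
        finally show ?thesis using f(2)[of n] by linarith
      qed
      have "(F, F') \<in> ?C"
        unfolding operator_closure_def
      proof (intro CollectI case_prodI2 conjI allI impI)
        fix a b and e :: real
        assume ab: "(F, F') = (a, b)" and e: "e > 0"
        have "(\<lambda>n. 1 / real (Suc n) + ?N (\<lambda>\<omega>. f n \<omega> - F \<omega>)) \<longlonglongrightarrow> 0"
          using tendsto_add[OF t0 F(2)] by simp
        then have "eventually (\<lambda>n. 1 / real (Suc n) + ?N (\<lambda>\<omega>. f n \<omega> - F \<omega>) < e) sequentially"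
          using e by (rule order_tendstoD(2))
        then obtain n where n: "1 / real (Suc n) + ?N (\<lambda>\<omega>. f n \<omega> - F \<omega>) < e" by (auto simp: eventually_sequentially)
        have "1 / real (Suc n) \<ge> 0" by simp
        then have "?N (\<lambda>\<omega>. F \<omega> - f n \<omega>) < e" "?N (\<lambda>\<omega>. F' \<omega> - f' n \<omega>) < e" using n c1[of n] c2[of n] by linarith+
        then show "\<exists>(h, h')\<in>B. ?N (\<lambda>\<omega>. a \<omega> - h \<omega>) < e \<and> ?N (\<lambda>\<omega>. b \<omega> - h' \<omega>) < e"
          using f(1)[of n] ab by blast
      qed (use F(1) F'X in auto)
      moreover have "h = (\<lambda>\<omega>. F \<omega> + F' \<omega>)" by (simp add: F'_def)
      ultimately show "h \<in> range_Id_plus ?C" unfolding range_Id_plus_def by blast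
    qed
  qed
qed

section \<open>The operator with random weight\<close>

locale random_neumann = neumann_data S p g1 g2
  for S :: "'a::euclidean_space set" and p g1 g2 :: real +
  fixes M :: "'w measure" and g :: "'w \<Rightarrow> 'a lebesgue_L1"
  assumes g: "g \<in> bochner_L1 M (L1 S)" and g_between: "AE \<omega> in M. g \<omega> \<in> L1_between g1 g2 S"
begin

lemma p_laplace_op_subset: "p_laplace_op M p S g \<subseteq> bochner_L1 M (L1 S) \<times> bochner_L1 M (L1 S)"
  by (auto simp: p_laplace_op_def)

lemma range_subset: "range_Id_plus (p_laplace_op M p S g) \<subseteq> bochner_L1 M (L1 S)"
proof
  fix k assume "k \<in> range_Id_plus (p_laplace_op M p S g)"
  then obtain f f' where k: "k = (\<lambda>\<omega>. f \<omega> + f' \<omega>)" and f: "f \<in> bochner_L1 M (L1 S)" "f' \<in> bochner_L1 M (L1 S)"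
    by (auto simp: range_Id_plus_def p_laplace_op_def)
  show "k \<in> bochner_L1 M (L1 S)" unfolding k
    by (rule bochner_L1I[OF Bochner_Integration.integrable_add[OF bochner_L1_integrable(1)[OF f(1)] bochner_L1_integrable(1)[OF f(2)]]])
      (rule subspace_add[OF L1_subspace bochner_L1_integrable(3)[OF f(1)] bochner_L1_integrable(3)[OF f(2)]])
qed

lemma accretive_p_laplace_op: "accretive M (p_laplace_op M p S g)"
  unfolding accretive_def
proof (clarify)
  fix f f' h h' and \<alpha> :: real
  assume f: "(f, f') \<in> p_laplace_op M p S g" and h: "(h, h') \<in> p_laplace_op M p S g" and \<alpha>: "\<alpha> > 0"
  have B: "f \<in> bochner_L1 M (L1 S)" "f' \<in> bochner_L1 M (L1 S)" "h \<in> bochner_L1 M (L1 S)" "h' \<in> bochner_L1 M (L1 S)"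
    using f h by (auto simp: p_laplace_op_def)
  note i = bochner_L1_integrable(1)[OF B(1)] bochner_L1_integrable(1)[OF B(2)] bochner_L1_integrable(1)[OF B(3)] bochner_L1_integrable(1)[OF B(4)]
  have "AE \<omega> in M. p_laplace_equation p S (rep_L1 (g \<omega>)) (rep_L1 (f \<omega>)) (rep_L1 (f' \<omega>))"
    "AE \<omega> in M. p_laplace_equation p S (rep_L1 (g \<omega>)) (rep_L1 (h \<omega>)) (rep_L1 (h' \<omega>))"
    using f h by (auto simp: p_laplace_op_def)
  then have "AE \<omega> in M. norm (f \<omega> - h \<omega>) \<le> norm (f \<omega> - h \<omega> + \<alpha> *\<^sub>R (f' \<omega> - h' \<omega>))"
    using g_between AE_space
  proof eventually_elim
    case (elim \<omega>)
    show ?case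
      by (rule p_laplace_accretive_L1[OF elim(3) _ _ _ _ elim(1,2)])
        (use B elim(4) \<alpha> bochner_L1_integrable(3) in auto)
  qed
  then show "bochner_norm M (\<lambda>\<omega>. f \<omega> - h \<omega>) \<le> bochner_norm M (\<lambda>\<omega>. f \<omega> - h \<omega> + \<alpha> *\<^sub>R (f' \<omega> - h' \<omega>))"
    unfolding bochner_norm_def using i by (intro integral_mono_AE) auto
qed

text \<open>The solution is chosen outcome by outcome through the resolvent, and as zero on a null event that contains
all outcomes with an inadmissible weight or an unbounded datum.  Measurability is that of a continuous
map composed with the measurable pair \<open>(g, h)\<close>.\<close>

theorem L1_infty_subset_range: "L1_infty M S \<subseteq> range_Id_plus (p_laplace_op M p S g)"
proof
  fix h assume "h \<in> L1_infty M S"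
  then have h: "h \<in> bochner_L1 M (L1 S)" and hL: "AE \<omega> in M. rep_L1 (h \<omega>) \<in> Linfty S" by (auto simp: L1_infty_def)
  note [measurable] = bochner_L1_integrable(2)[OF h] bochner_L1_integrable(2)[OF g]
  have "AE \<omega> in M. (g \<omega>, h \<omega>) \<in> solvable_data"
    using g_between hL AE_space
  proof eventually_elim
    case (elim \<omega>)
    then show ?case using bochner_L1_integrable(3)[OF h elim(3)] by (simp add: solvable_data_def)
  qed
  then obtain N where N: "\<And>\<omega>. \<omega> \<in> space M - N \<Longrightarrow> (g \<omega>, h \<omega>) \<in> solvable_data" "N \<in> null_sets M"
    by (rule AE_E3) blast
  have Nm [measurable]: "N \<in> sets M" using N(2) by auto
  have notN: "AE \<omega> in M. \<omega> \<notin> N" using N(2) by (rule AE_not_in)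
  define u where "u \<omega> = (if \<omega> \<in> N then 0 else resolvent (g \<omega>, h \<omega>))" for \<omega>
  have um: "u \<in> borel_measurable M"
  proof -
    have gh: "(\<lambda>\<omega>. (g \<omega>, h \<omega>)) \<in> borel_measurable M" by measurable
    have "(\<lambda>\<omega>. (g \<omega>, h \<omega>)) \<in> measurable (restrict_space M {\<omega>. \<omega> \<notin> N}) (restrict_space borel solvable_data)"
      using N(1) by (intro measurable_restrict_space2 measurable_restrict_space1[OF gh]) (auto simp: space_restrict_space)
    moreover have "resolvent \<in> borel_measurable (restrict_space borel solvable_data)"
      by (rule borel_measurable_continuous_on_restrict[OF resolvent_continuous])
    ultimately have "(\<lambda>\<omega>. resolvent (g \<omega>, h \<omega>)) \<in> borel_measurable (restrict_space M {\<omega>. \<omega> \<notin> N})"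
      by (rule measurable_compose)
    moreover have "{\<omega> \<in> space M. \<omega> \<in> N} \<in> sets M" by measurable
    ultimately show ?thesis unfolding u_def[abs_def] by (simp add: measurable_If_restrict_space_iff)
  qed
  have uS: "u \<omega> \<in> L1 S" if "\<omega> \<in> space M" for \<omega>
    using resolvent_is_solution[OF N(1), of \<omega>] that subspace_0[OF L1_subspace] by (auto simp: u_def is_solution_def)
  have ule: "norm (u \<omega>) \<le> norm (h \<omega>)" if "\<omega> \<in> space M" for \<omega>
    using norm_resolvent_le[OF N(1), of \<omega>] that by (auto simp: u_def)
  have iu: "integrable M u"
    by (rule Bochner_Integration.integrable_bound[OF bochner_L1_integrable(1)[OF h] um]) (use ule in auto)
  have uB: "u \<in> bochner_L1 M (L1 S)" by (rule bochner_L1I[OF iu uS])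
  have vB: "(\<lambda>\<omega>. h \<omega> - u \<omega>) \<in> bochner_L1 M (L1 S)"
    by (rule bochner_L1I[OF Bochner_Integration.integrable_diff[OF bochner_L1_integrable(1)[OF h] iu]])
      (rule subspace_diff[OF L1_subspace bochner_L1_integrable(3)[OF h] uS])
  have sol: "AE \<omega> in M. is_solution (g \<omega>) (h \<omega>) (u \<omega>)"
    using notN AE_space
  proof eventually_elim
    case (elim \<omega>)
    then show ?case using resolvent_is_solution[OF N(1), of \<omega>] by (simp add: u_def)
  qed
  have "AE \<omega> in M. rep_L1 (u \<omega>) \<in> W1p p S \<inter> Linfty S"
    using sol by eventually_elim (auto simp: is_solution_def p_laplace_equation_def W1p_def)
  moreover have "AE \<omega> in M. p_laplace_equation p S (rep_L1 (g \<omega>)) (rep_L1 (u \<omega>)) (rep_L1 (h \<omega> - u \<omega>))"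
    using sol by eventually_elim (simp add: is_solution_def)
  ultimately have "(u, \<lambda>\<omega>. h \<omega> - u \<omega>) \<in> p_laplace_op M p S g"
    using uB vB by (simp add: p_laplace_op_def)
  then show "h \<in> range_Id_plus (p_laplace_op M p S g)"
    unfolding range_Id_plus_def
    by (intro CollectI exI[of _ u] exI[of _ "\<lambda>\<omega>. h \<omega> - u \<omega>"]) simp
qed

lemma truncate_L1_in_L1: "u \<in> L1 S \<Longrightarrow> truncate_L1 (real n) u \<in> L1 S"
proof -
  assume "u \<in> L1 S"
  then have "AE x in lebesgue. x \<notin> S \<longrightarrow> rep_L1 u x = 0" by (simp add: L1_def)
  then have "AE x in lebesgue. x \<notin> S \<longrightarrow> rep_L1 (truncate_L1 (real n) u) x = 0"
    using rep_truncate_L1[of "real n" u, OF of_nat_0_le_iff] by eventually_elim (simp add: truncate_props(2))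
  then show ?thesis by (simp add: L1_def)
qed

theorem range_dense: "dense_in_bochner_L1 M (L1 S) (range_Id_plus (p_laplace_op M p S g))"
  unfolding dense_in_bochner_L1_def
proof (intro conjI ballI allI impI range_subset)
  fix h :: "'w \<Rightarrow> 'a lebesgue_L1" and e :: real assume h: "h \<in> bochner_L1 M (L1 S)" and e: "e > 0"
  note [measurable] = bochner_L1_integrable(2)[OF h] and ih = bochner_L1_integrable(1)[OF h]
  define hn where "hn n \<omega> = truncate_L1 (real n) (h \<omega>)" for n \<omega>
  have hm [measurable]: "hn n \<in> borel_measurable M" for n
  proof -
    have "truncate_L1 (real n) \<in> borel_measurable (borel :: 'a lebesgue_L1 measure)"
      by (intro borel_measurable_continuous_onI truncate_L1_continuous) simp
    then show ?thesis unfolding hn_def[abs_def] by (rule measurable_compose[rotated]) measurable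
  qed
  have le: "norm (h \<omega> - hn n \<omega>) \<le> norm (h \<omega>)" for n \<omega>
    unfolding hn_def by (rule norm_diff_truncate_L1_le)
  have "(\<lambda>n. bochner_norm M (\<lambda>\<omega>. h \<omega> - hn n \<omega>)) \<longlonglongrightarrow> (\<integral>\<omega>. 0 \<partial>M)"
    unfolding bochner_norm_def
  proof (rule integral_dominated_convergence[where w="\<lambda>\<omega>. norm (h \<omega>)"])
    show "AE \<omega> in M. (\<lambda>n. norm (h \<omega> - hn n \<omega>)) \<longlonglongrightarrow> 0"
      unfolding hn_def using truncate_L1_tendsto by auto
  qed (use ih le in auto)
  then have "eventually (\<lambda>n. bochner_norm M (\<lambda>\<omega>. h \<omega> - hn n \<omega>) < e) sequentially"
    using e by (intro order_tendstoD(2)) auto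
  then obtain n where n: "bochner_norm M (\<lambda>\<omega>. h \<omega> - hn n \<omega>) < e" by (auto simp: eventually_sequentially)
  have "integrable M (\<lambda>\<omega>. h \<omega> - hn n \<omega>)"
    by (rule Bochner_Integration.integrable_bound[OF ih]) (use le in auto)
  from Bochner_Integration.integrable_diff[OF ih this] have "integrable M (hn n)" by simp
  then have "hn n \<in> bochner_L1 M (L1 S)"
    by (rule bochner_L1I) (auto simp: hn_def intro: truncate_L1_in_L1 bochner_L1_integrable(3)[OF h])
  moreover have "rep_L1 (hn n \<omega>) \<in> Linfty S" for \<omega>
  proof -
    have "AE x in L. \<bar>rep_L1 (hn n \<omega>) x\<bar> \<le> real n"
      using AE_L[OF rep_truncate_L1[of "real n" "h \<omega>", OF of_nat_0_le_iff]]
      by eventually_elim (simp add: hn_def truncate_props(3))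
    then show ?thesis unfolding Linfty_def using rep_L1_L by blast
  qed
  ultimately have "hn n \<in> L1_infty M S" by (simp add: L1_infty_def)
  then show "\<exists>k\<in>range_Id_plus (p_laplace_op M p S g). bochner_norm M (\<lambda>\<omega>. h \<omega> - k \<omega>) < e"
    using L1_infty_subset_range n by blast
qed

theorem m_accretive_closure: "m_accretive M (L1 S) (operator_closure M (L1 S) (p_laplace_op M p S g))"
  by (rule m_accretive_operator_closure[OF L1_subspace L1_closed[OF S_sets] accretive_p_laplace_op p_laplace_op_subset range_dense])

end

theorem theorem4p8:
  fixes M :: "'w measure"
    and S :: "(real ^ 'n) set"
    and p g1 g2 :: real
    and g :: "'w \<Rightarrow> (real ^ 'n) lebesgue_L1"
  assumes "CARD('n) \<ge> 2"
    and "1 < p" and "p \<noteq> 2"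
    and "S \<noteq> {}" and "open S" and "bounded S" and "connected S" and "C1_domain S"
    and "0 < g1" and "g1 \<le> g2"
    and "prob_space M" and "complete_measure M"
    and "g \<in> bochner_L1 M (L1 S)"
    and "AE \<omega> in M. g \<omega> \<in> L1_between g1 g2 S"
  shows "L1_infty M S \<subseteq> range_Id_plus (p_laplace_op M p S g) \<and>
    dense_in_bochner_L1 M (L1 S) (range_Id_plus (p_laplace_op M p S g)) \<and>
    m_accretive M (L1 S) (operator_closure M (L1 S) (p_laplace_op M p S g))"
proof -
  interpret random_neumann S p g1 g2 M g
    using assms by unfold_locales auto
  show ?thesis
    using L1_infty_subset_range range_dense m_accretive_closure by blast
qed

end
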